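(* Consider the random profile matching problem RPMP-$k$ (defined in the context) with $n$ men, $n$ women, $k=k(n)$, under the Hamming distance $d_h(\mathbf{a},\mathbf{a}')=\sum_{i=1}^k\mathbf{1}(a_i\neq a_i')$. Then: (i) if $k(n)=\Omega(n^3)$, with high probability the fraction of participants with multiple stable partners tends to zero as $n\to\infty$; (ii) if $k(n)=\Omega(n^6)$, with high probability the stable matching is unique without resorting to tie-breaking (i.e., there is exactly one stable matching, and it does not depend on the tie-breaking lists); (iii) for any $\beta>1$, $$\mathbb{P}\left(X<\frac{k}{2}-\sqrt{\beta k\log n}\right)\le n^{1-\beta},$$ where $X$ is the matching distance of a randomly chosen participant.
   Context: RPMP-$k$: there is a set $\mathcal{M}$ of $n$ men and a set $\mathcal{W}$ of $n$ women. Each participant $x$ has a profile $\mathbf{a}(x)\in Q_k=\{0,1\}^k$; the profiles are independent and uniformly distributed on $Q_k$. Write $d_h(x,y)=d_h(\mathbf{a}(x),\mathbf{a}(y))$. Each participant $x$ has a tie-breaking list $T_x$, a uniformly random ordering of the opposite sex, all independent of each other and of the profiles. The strict preference list of $x$ ranks the opposite sex in increasing order of $d_h(x,\cdot)$, breaking ties by $T_x$. Stable matchings and blocking pairs are in the sense of Gale and Shapley; $y$ is a stable partner of $x$ if they are matched in some stable matching. The matching distance of a participant $x$ is $d_h(x,\mu(x))$ for a stable matching $\mu$ (this value is the same for all stable matchings). "With high probability" means with probability tending to $1$ as $n\to\infty$. $\log$ denotes the base-$2$ logarithm. *)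

theory Defs
  imports "HOL-Probability.Probability" "HOL-Library.Landau_Symbols"
begin

text \<open>Men and women are both indexed by {..<n}. A configuration consists of
  the men's profiles, the women's profiles (bit lists of length k), the men's
  tie-breaking lists and the women's tie-breaking lists. A tie-breaking list of
  a participant is a permutation sigma of {..<n}: sigma y is the position of y
  in the list.\<close>

type_synonym config =
  "(nat \<Rightarrow> bool list) \<times> (nat \<Rightarrow> bool list) \<times> (nat \<Rightarrow> nat \<Rightarrow> nat) \<times> (nat \<Rightarrow> nat \<Rightarrow> nat)"

definition profiles :: "nat \<Rightarrow> nat \<Rightarrow> (nat \<Rightarrow> bool list) set" where
  "profiles n k = PiE {..<n} (\<lambda>_. {xs. length xs = k})"

definition tielists :: "nat \<Rightarrow> (nat \<Rightarrow> nat \<Rightarrow> nat) set" where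
  "tielists n = PiE {..<n} (\<lambda>_. {\<sigma>. \<sigma> permutes {..<n}})"

definition configs :: "nat \<Rightarrow> nat \<Rightarrow> config set" where
  "configs n k = profiles n k \<times> profiles n k \<times> tielists n \<times> tielists n"

definition hamming :: "bool list \<Rightarrow> bool list \<Rightarrow> nat" where
  "hamming xs ys = card {i. i < length xs \<and> xs ! i \<noteq> ys ! i}"

definition man_prefers :: "config \<Rightarrow> nat \<Rightarrow> nat \<Rightarrow> nat \<Rightarrow> bool" where
  "man_prefers c i j j' = (case c of (am, aw, tm, tw) \<Rightarrow>
     hamming (am i) (aw j) < hamming (am i) (aw j') \<or>
     (hamming (am i) (aw j) = hamming (am i) (aw j') \<and> tm i j < tm i j'))"

definition woman_prefers :: "config \<Rightarrow> nat \<Rightarrow> nat \<Rightarrow> nat \<Rightarrow> bool" where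
  "woman_prefers c j i i' = (case c of (am, aw, tm, tw) \<Rightarrow>
     hamming (aw j) (am i) < hamming (aw j) (am i') \<or>
     (hamming (aw j) (am i) = hamming (aw j) (am i') \<and> tw j i < tw j i'))"

definition stable :: "nat \<Rightarrow> config \<Rightarrow> (nat \<Rightarrow> nat) \<Rightarrow> bool" where
  "stable n c \<mu> \<longleftrightarrow> \<mu> permutes {..<n} \<and>
     \<not> (\<exists>i<n. \<exists>j<n. \<exists>i'<n. \<mu> i' = j \<and> man_prefers c i j (\<mu> i) \<and> woman_prefers c j i i')"

definition man_partners :: "nat \<Rightarrow> config \<Rightarrow> nat \<Rightarrow> nat set" where
  "man_partners n c i = {j. \<exists>\<mu>. stable n c \<mu> \<and> \<mu> i = j}"

definition woman_partners :: "nat \<Rightarrow> config \<Rightarrow> nat \<Rightarrow> nat set" where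
  "woman_partners n c j = {i. \<exists>\<mu>. stable n c \<mu> \<and> \<mu> i = j}"

definition num_multi :: "nat \<Rightarrow> config \<Rightarrow> nat" where
  "num_multi n c = card {i. i < n \<and> card (man_partners n c i) \<ge> 2}
                 + card {j. j < n \<and> card (woman_partners n c j) \<ge> 2}"

definition unique_without_ties :: "nat \<Rightarrow> config \<Rightarrow> bool" where
  "unique_without_ties n c = (case c of (am, aw, tm, tw) \<Rightarrow>
     (\<exists>\<mu>. \<forall>tm' \<in> tielists n. \<forall>tw' \<in> tielists n.
        {\<nu>. stable n (am, aw, tm', tw') \<nu>} = {\<mu>}))"

text \<open>Matching distance of a participant p = (is_man, index), computed with
  some stable matching (the value is the same for all stable matchings).\<close>
definition match_dist :: "nat \<Rightarrow> config \<Rightarrow> bool \<times> nat \<Rightarrow> nat" where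
  "match_dist n c p = (case c of (am, aw, tm, tw) \<Rightarrow>
     (let \<mu> = (SOME \<mu>. stable n c \<mu>) in
      case p of (is_man, x) \<Rightarrow>
        if is_man then hamming (am x) (aw (\<mu> x))
        else hamming (aw x) (am (THE i. i < n \<and> \<mu> i = x))))"

end

theory Submission
  imports Defs "HOL-Real_Asymp.Real_Asymp"
begin

text \<open>
  Choose the threshold \<open>K\<close> so that a random pair has distance below \<open>K\<close> with probability about
  \<open>n powr (- 9/32)\<close>. Parts (i) and (ii) rest on two facts about \<open>K\<close>.

  The distances of one participant to two others tie below \<open>K\<close> with probability at most about
  \<open>n powr (- 9/16) / sqrt k\<close>, so few participants have such ties.

  With high probability there are no sets of \<open>\<delta> n\<close> men and \<open>\<delta> n\<close> women all of whose mutual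
  distances are at least \<open>K\<close>: given the men's profiles, which are nearly orthogonal, the women are
  independent, and each is far from all \<open>\<delta> n\<close> men with probability \<open>o(1)\<close>; a union bound over
  \<open>4 ^ n\<close> pairs of sets finishes. In a stable matching the participants matched at
  distance at least \<open>K\<close> form two such sets, so there are few of them. Since all stable
  partners of a participant are at the same distance, this gives (i).

  For (ii), two matchings that are stable for some tie-breaking differ first at a tie of some
  participant \<open>x\<close> between \<open>y\<close> and \<open>y'\<close>. If this tie is not below \<open>K\<close>, then \<open>y\<close> and \<open>y'\<close> are left
  over by the greedy matching below \<open>K\<close> in the market without \<open>x\<close>. That matching is independent of the
  profile of \<open>x\<close> and leaves at most \<open>\<delta> n\<close> participants over on each side, so the expected number of
  such ties is \<open>O(\<delta>\<^sup>2 n\<^sup>3 / sqrt k)\<close>.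

  Part (iii) is Hoeffding's inequality and a union bound over the \<open>n\<close> candidates.
\<close>

text \<open>A union bound over all ties is too weak. For (ii) it gives about
  \<open>n^3 / sqrt k\<close>, which stays of constant order when \<open>k\<close> is of order
  \<open>n^6\<close>; for (i) the expected number of ties per participant is about
  \<open>n^2 / sqrt k\<close>, of order \<open>sqrt n\<close> when \<open>k\<close> is of order
  \<open>n^3\<close>. Cutting at \<open>K\<close> gains \<open>n powr (- 9/16)\<close>, just enough
  for (i). In (ii) the ties above \<open>K\<close> gain only the factor \<open>\<delta>^2\<close>,
  where \<delta> tends to 0 after \<open>n\<close> has tended to infinity.

  Write \<open>s = x * sqrt (k * ln n)\<close>, \<open>u = a * sqrt (ln n / k)\<close> and
  \<open>v = b * sqrt (ln n / k)\<close> with \<open>b < a\<close>; the cutoff is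
  \<open>k/2 - s\<close>. Low ties require \<open>4 * x^2 > 1/2\<close>. The diagonal of the second
  moment requires \<open>a^2 < 1\<close>. The comparison of exponents requires
  \<open>(a - b) * (2 * x - (a + b) / 2) < 0\<close>, that is \<open>4 * x < a + b\<close>. So
  \<open>x\<close> lies between \<open>sqrt (1/8)\<close> and \<open>1/2\<close>; the choice is
  \<open>x = 3/8\<close>, \<open>a = 9/10\<close>, \<open>b = 27/40\<close>.

  Exponential sums stand in for the number of close men because their first two moments are exact
  products of \<open>cosh\<close>, which spares lower bounds for joint binomial tails.\<close>

section \<open>Stable matchings\<close>

text \<open>At a fixed point \<open>X\<close> of the monotone operator \<open>F\<close>, the set \<open>X\<close> contains the pairs that the women do
  not reject when choosing from \<open>Y\<close>, and \<open>Y\<close> those that the men do not reject when choosing from \<open>X\<close>;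
  then \<open>X \<inter> Y\<close> is a stable matching.\<close>
lemma exists_stable_rank:
  fixes rm rw :: "nat \<Rightarrow> nat \<Rightarrow> nat"
  assumes inj_m: "\<And>i. i < n \<Longrightarrow> inj_on (rm i) {..<n}"
    and inj_w: "\<And>j. j < n \<Longrightarrow> inj_on (rw j) {..<n}"
  shows "\<exists>\<mu>. \<mu> permutes {..<n} \<and>
    \<not> (\<exists>i<n. \<exists>j<n. \<exists>i'<n. \<mu> i' = j \<and> rm i j < rm i (\<mu> i) \<and> rw j i < rw j i')"
proof -
  define E where "E = {..<n} \<times> {..<n}"
  define RM where "RM X = {(i,j) \<in> X. \<exists>j'. (i,j') \<in> X \<and> rm i j' < rm i j}" for X
  define RW where "RW X = {(i,j) \<in> X. \<exists>i'. (i',j) \<in> X \<and> rw j i' < rw j i}" for X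
  define F where "F X = E - RW (E - RM X)" for X
  have "RM A \<subseteq> RM B" "RW A \<subseteq> RW B" if "A \<subseteq> B" for A B
    using that unfolding RM_def RW_def by auto
  then have "mono F"
    unfolding mono_def F_def by (meson Diff_mono order_refl)
  define X where "X = lfp F"
  define Y where "Y = E - RM X"
  have X: "X = E - RW Y"
    using lfp_unfold[OF \<open>mono F\<close>] unfolding X_def Y_def F_def by simp
  define P where "P = X \<inter> Y"
  have X_iff: "e \<in> X \<longleftrightarrow> e \<in> E \<and> e \<notin> RW Y" for e
    by (subst X) blast
  have PE: "P \<subseteq> {..<n} \<times> {..<n}"
    using X_iff unfolding P_def E_def by blast
  have P1: "(i,j) \<in> P \<longleftrightarrow> (i,j) \<in> X - RM X" for i j
    using X_iff[of "(i,j)"] unfolding P_def Y_def by blast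
  have P2: "(i,j) \<in> P \<longleftrightarrow> (i,j) \<in> Y - RW Y" for i j
    using X_iff[of "(i,j)"] unfolding P_def Y_def by blast
  have man: "\<exists>j'. (i,j') \<in> P \<and> rm i j' \<le> rm i j" if ij: "(i,j) \<in> X" for i j
  proof -
    obtain j' where j': "(i,j') \<in> X" "\<And>j''. (i,j'') \<in> X \<Longrightarrow> rm i j' \<le> rm i j''"
      using ex_has_least_nat[of "\<lambda>j. (i,j) \<in> X" j "rm i"] ij by blast
    then have "(i,j') \<in> P" unfolding P1 RM_def by (auto simp: not_less)
    then show ?thesis using j' that by auto
  qed
  have woman: "\<exists>i'. (i',j) \<in> P \<and> rw j i' \<le> rw j i" if ij: "(i,j) \<in> Y" for i j
  proof -
    obtain i' where i': "(i',j) \<in> Y" "\<And>i''. (i'',j) \<in> Y \<Longrightarrow> rw j i' \<le> rw j i''"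
      using ex_has_least_nat[of "\<lambda>i. (i,j) \<in> Y" i "rw j"] ij by blast
    then have "(i',j) \<in> P" unfolding P2 RW_def by (auto simp: not_less)
    then show ?thesis using i' that by auto
  qed
  \<comment> \<open>A pair of \<open>E\<close> outside \<open>Y\<close> lies in \<open>RM X\<close>
    and thereby in \<open>X\<close>. So every pair lies in \<open>X\<close> or in \<open>Y\<close>,
    and one of its two members is at least as well off in \<open>P\<close>.\<close>
  have dom: "(\<exists>j'. (i,j') \<in> P \<and> rm i j' \<le> rm i j) \<or> (\<exists>i'. (i',j) \<in> P \<and> rw j i' \<le> rw j i)"
    if "i < n" "j < n" for i j
    using that man[of i j] woman[of i j] unfolding Y_def E_def RM_def by blast
  have fun_m: "j = j'" if "(i,j) \<in> P" "(i,j') \<in> P" for i j j'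
  proof -
    have "\<not> rm i j < rm i j'" "\<not> rm i j' < rm i j"
      using that unfolding P1 RM_def by auto
    moreover have "i < n" "j < n" "j' < n" using that PE by auto
    ultimately show ?thesis using inj_m[of i] by (auto simp: inj_on_def)
  qed
  have fun_w: "i = i'" if "(i,j) \<in> P" "(i',j) \<in> P" for i i' j
  proof -
    have "\<not> rw j i < rw j i'" "\<not> rw j i' < rw j i"
      using that unfolding P2 RW_def by auto
    moreover have "j < n" "i < n" "i' < n" using that PE by auto
    ultimately show ?thesis using inj_w[of j] by (auto simp: inj_on_def)
  qed
  have fP: "finite P" using finite_subset[OF PE] by simp
  have "inj_on fst P"
  proof (rule inj_onI)
    fix p q assume "p \<in> P" "q \<in> P" "fst p = fst q"
    then obtain i j j' where "p = (i,j)" "q = (i,j')" by (cases p, cases q) auto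
    then show "p = q" using fun_m[of i j j'] \<open>p \<in> P\<close> \<open>q \<in> P\<close> by blast
  qed
  moreover have "inj_on snd P"
  proof (rule inj_onI)
    fix p q assume "p \<in> P" "q \<in> P" "snd p = snd q"
    then obtain i i' j where "p = (i,j)" "q = (i',j)" by (cases p, cases q) auto
    then show "p = q" using fun_w[of i j i'] \<open>p \<in> P\<close> \<open>q \<in> P\<close> by blast
  qed
  ultimately have "card (fst ` P) = card P" "card (snd ` P) = card P"
    by (simp_all add: card_image)
  then have cards: "card (fst ` P) = card (snd ` P)" by simp
  have sub: "fst ` P \<subseteq> {..<n}" "snd ` P \<subseteq> {..<n}" using PE by auto
  \<comment> \<open>\<open>P\<close> covers equally many men and women, so an uncovered man comes
    with an uncovered woman, and \<open>dom\<close> fails for that pair.\<close>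
  have full: "fst ` P = {..<n}"
  proof (rule ccontr)
    assume "fst ` P \<noteq> {..<n}"
    then have "card (fst ` P) < n" using sub psubset_card_mono[of "{..<n}" "fst ` P"] by auto
    then have "snd ` P \<noteq> {..<n}" using cards by auto
    then obtain i j where "i < n" "i \<notin> fst ` P" "j < n" "j \<notin> snd ` P"
      using sub \<open>fst ` P \<noteq> {..<n}\<close> by blast
    then show False using dom[of i j] by force
  qed
  define \<mu> where "\<mu> i = (if i < n then THE j. (i,j) \<in> P else i)" for i
  have mu: "(i, \<mu> i) \<in> P" if "i < n" for i
  proof -
    have "i \<in> fst ` P" using full that by simp
    then obtain j where j: "(i,j) \<in> P" by auto
    then have "(THE j. (i,j) \<in> P) = j" using fun_m by (intro the_equality) blast+
    then show ?thesis using j that by (simp add: \<mu>_def)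
  qed
  have inj: "inj_on \<mu> {..<n}"
    by (rule inj_onI) (metis mu fun_w lessThan_iff)
  have "\<mu> ` {..<n} \<subseteq> {..<n}" using mu PE by auto
  then have "bij_betw \<mu> {..<n} {..<n}"
    using inj by (simp add: bij_betw_def endo_inj_surj)
  then have perm: "\<mu> permutes {..<n}"
    by (rule bij_imp_permutes) (auto simp: \<mu>_def)
  show ?thesis
  proof (intro exI[of _ \<mu>] conjI perm notI)
    assume "\<exists>i<n. \<exists>j<n. \<exists>i'<n. \<mu> i' = j \<and> rm i j < rm i (\<mu> i) \<and> rw j i < rw j i'"
    then obtain i i' where *: "i < n" "i' < n" "rm i (\<mu> i') < rm i (\<mu> i)" "rw (\<mu> i') i < rw (\<mu> i') i'"
      by blast
    have "(i, \<mu> i) \<in> P" "(i', \<mu> i') \<in> P" using mu * by auto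
    then have "j = \<mu> i" if "(i, j) \<in> P" for j using fun_m that by blast
    moreover have "x = i'" if "(x, \<mu> i') \<in> P" for x
      using fun_w that \<open>(i', \<mu> i') \<in> P\<close> by blast
    moreover have "\<mu> i' < n" using PE \<open>(i', \<mu> i') \<in> P\<close> by blast
    ultimately consider j where "j = \<mu> i" "rm i j \<le> rm i (\<mu> i')"
      | x where "x = i'" "rw (\<mu> i') x \<le> rw (\<mu> i') i"
      using dom[of i "\<mu> i'"] * by blast
    then show False using * by cases auto
  qed
qed

lemma permutes_less:
  assumes "\<sigma> permutes {..<n}" "i < n"
  shows "\<sigma> i < (n::nat)"
  using permutes_in_image[OF assms(1), of i] assms(2) by simp

lemma man_prefers_Pair:
  "man_prefers (am, aw, tm, tw) i j j' \<longleftrightarrow> hamming (am i) (aw j) < hamming (am i) (aw j') \<or>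
     (hamming (am i) (aw j) = hamming (am i) (aw j') \<and> tm i j < tm i j')"
  by (simp add: man_prefers_def)

lemma woman_prefers_Pair:
  "woman_prefers (am, aw, tm, tw) j i i' \<longleftrightarrow> hamming (aw j) (am i) < hamming (aw j) (am i') \<or>
     (hamming (aw j) (am i) = hamming (aw j) (am i') \<and> tw j i < tw j i')"
  by (simp add: woman_prefers_def)

text \<open>Packs distance and tie-breaking position into a single number, so that
  \<open>exists_stable_rank\<close>, which is about injective ranks, applies.\<close>

lemma lex_rank_less:
  assumes "a < n" "b < (n::nat)"
  shows "h * n + a < h' * n + b \<longleftrightarrow> h < h' \<or> (h = h' \<and> a < b)"
proof -
  have *: "x * n + c < y * n + e" if "x < y" "c < n" for x y c e :: nat
  proof -
    have "x * n + c < (x + 1) * n" using that by simp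
    also have "\<dots> \<le> y * n" using that by (intro mult_right_mono) auto
    finally show ?thesis by simp
  qed
  show ?thesis using *[of h h' a b] *[of h' h b a] assms
    by (cases h h' rule: linorder_cases) auto
qed

lemma stable_exists:
  assumes "tm \<in> tielists n" "tw \<in> tielists n"
  shows "\<exists>\<mu>. stable n (am, aw, tm, tw) \<mu>"
proof -
  define rm where "rm i j = hamming (am i) (aw j) * n + tm i j" for i j
  define rw where "rw j i = hamming (aw j) (am i) * n + tw j i" for i j
  have tm: "tm i permutes {..<n}" and tw: "tw i permutes {..<n}" if "i < n" for i
    using assms that by (auto simp: tielists_def PiE_iff)
  have less: "tm i j < n" "tw i j < n" if "i < n" "j < n" for i j
    using permutes_less[OF tm] permutes_less[OF tw] that by auto
  have rm: "rm i j < rm i j' \<longleftrightarrow> man_prefers (am, aw, tm, tw) i j j'" if "i < n" "j < n" "j' < n" for i j j'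
    using lex_rank_less[OF less(1) less(1)] that by (auto simp: rm_def man_prefers_Pair)
  have rw: "rw i j < rw i j' \<longleftrightarrow> woman_prefers (am, aw, tm, tw) i j j'" if "i < n" "j < n" "j' < n" for i j j'
    using lex_rank_less[OF less(2) less(2)] that by (auto simp: rw_def woman_prefers_Pair)
  have inj: "inj_on (rm i) {..<n}" "inj_on (rw i) {..<n}" if "i < n" for i
  proof -
    have "j = j'" if "j < n" "j' < n" "rm i j = rm i j'" for j j'
    proof -
      have "\<not> rm i j < rm i j'" "\<not> rm i j' < rm i j" using that by auto
      then have "\<not> man_prefers (am, aw, tm, tw) i j j'" "\<not> man_prefers (am, aw, tm, tw) i j' j"
        using rm[of i j j'] rm[of i j' j] that(1,2) \<open>i < n\<close> by blast+
      then have "tm i j = tm i j'" by (auto simp: man_prefers_Pair)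
      then show ?thesis using permutes_inj[OF tm[OF \<open>i < n\<close>]] by (auto simp: inj_def)
    qed
    then show "inj_on (rm i) {..<n}" by (auto intro: inj_onI)
    have "j = j'" if "j < n" "j' < n" "rw i j = rw i j'" for j j'
    proof -
      have "\<not> rw i j < rw i j'" "\<not> rw i j' < rw i j" using that by auto
      then have "\<not> woman_prefers (am, aw, tm, tw) i j j'" "\<not> woman_prefers (am, aw, tm, tw) i j' j"
        using rw[of i j j'] rw[of i j' j] that(1,2) \<open>i < n\<close> by blast+
      then have "tw i j = tw i j'" by (auto simp: woman_prefers_Pair)
      then show ?thesis using permutes_inj[OF tw[OF \<open>i < n\<close>]] by (auto simp: inj_def)
    qed
    then show "inj_on (rw i) {..<n}" by (auto intro: inj_onI)
  qed
  obtain \<mu> where \<mu>: "\<mu> permutes {..<n}"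
    "\<not> (\<exists>i<n. \<exists>j<n. \<exists>i'<n. \<mu> i' = j \<and> rm i j < rm i (\<mu> i) \<and> rw j i < rw j i')"
    using exists_stable_rank[of n rm rw, OF inj] by blast
  have "stable n (am, aw, tm, tw) \<mu>"
    unfolding stable_def
  proof (intro conjI \<mu>(1) notI, elim exE conjE)
    fix i j i'
    assume "i < n" "j < n" "i' < n" "\<mu> i' = j" "man_prefers (am, aw, tm, tw) i j (\<mu> i)"
      "woman_prefers (am, aw, tm, tw) j i i'"
    then show False
      using \<mu>(2) rm[of i j "\<mu> i"] rw[of j i i'] permutes_less[OF \<mu>(1)] by blast
  qed
  then show ?thesis by blast
qed

section \<open>Equality of distances in all stable matchings\<close>

lemma hamming_commute:
  assumes "length xs = length ys"
  shows "hamming xs ys = hamming ys xs"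
  unfolding hamming_def using assms by (metis (mono_tags, lifting))

lemma profile_length:
  assumes "a \<in> profiles n k" "i < n"
  shows "length (a i) = k"
  using assms by (auto simp: profiles_def PiE_iff)

text \<open>Let \<open>M\<close> be the men preferring \<open>\<mu>\<close> to \<open>\<nu>\<close>. Both matchings send \<open>M\<close> onto the set of
  women preferring \<open>\<nu>\<close> to \<open>\<mu>\<close>. The total distance over \<open>M\<close> is at most as large for \<open>\<mu>\<close> as for
  \<open>\<nu>\<close>, and the women's preferences give the reverse inequality, so all distances agree.\<close>
lemma match_dist_le:
  assumes c: "(am, aw, tm, tw) \<in> configs n k" 
    and \<mu>: "stable n (am, aw, tm, tw) \<mu>" and \<nu>: "stable n (am, aw, tm, tw) \<nu>"
    and i: "i < n"
  shows "hamming (am i) (aw (\<mu> i)) \<ge> hamming (am i) (aw (\<nu> i))"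
proof -
  let ?mp = "man_prefers (am, aw, tm, tw)" and ?wp = "woman_prefers (am, aw, tm, tw)"
  define d where "d i j = hamming (am i) (aw j)" for i j
  \<comment> \<open>Symmetry of the distance is what makes the men's and the women's totals
    comparable; it has no analogue for arbitrary preferences.\<close>
  have dsym: "hamming (aw j) (am i) = d i j" if "i < n" "j < n" for i j
    using c that by (auto simp: d_def configs_def intro!: hamming_commute simp: profile_length)
  have pm: "\<mu> permutes {..<n}" "\<nu> permutes {..<n}" using \<mu> \<nu> by (auto simp: stable_def)
  note less = permutes_less[OF pm(1)] permutes_less[OF pm(2)]
  have tot_m: "?mp i j j' \<or> ?mp i j' j" if "i < n" "j < n" "j' < n" "j \<noteq> j'" for i j j'
  proof -
    have "tm i permutes {..<n}" using c that by (auto simp: configs_def tielists_def PiE_iff)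
    then have "tm i j \<noteq> tm i j'" using that permutes_inj by (metis injD)
    then show ?thesis by (auto simp: man_prefers_Pair)
  qed
  have tot_w: "?wp j i i' \<or> ?wp j i' i" if "i < n" "i' < n" "j < n" "i \<noteq> i'" for i j i'
  proof -
    have "tw j permutes {..<n}" using c that by (auto simp: configs_def tielists_def PiE_iff)
    then have "tw j i \<noteq> tw j i'" using that permutes_inj by (metis injD)
    then show ?thesis by (auto simp: woman_prefers_Pair)
  qed
  have irr: "\<not> ?mp i j j" for i j by (auto simp: man_prefers_Pair)
  define M where "M = {i. i < n \<and> ?mp i (\<mu> i) (\<nu> i)}"
  \<comment> \<open>Here \<open>x\<close> stands for the \<nu>-partner of \<open>j\<close> and
    \<open>y\<close> for the \<mu>-partner; for \<open>j < n\<close> both exist and are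
    unique.\<close>
  define W where "W = {j. j < n \<and> (\<forall>x y. x < n \<and> y < n \<and> \<nu> x = j \<and> \<mu> y = j \<longrightarrow> ?wp j x y)}"
  have fin: "finite M" "finite W" by (auto simp: M_def W_def)
  \<comment> \<open>Otherwise a man of \<open>M\<close> and his \<mu>-partner would block
    \<nu>.\<close>
  have MW: "\<mu> ` M \<subseteq> W"
  proof
    fix j assume "j \<in> \<mu> ` M"
    then obtain y where y: "y < n" "?mp y (\<mu> y) (\<nu> y)" "j = \<mu> y" by (auto simp: M_def)
    have "?wp j x y" if "x < n" "\<nu> x = j" for x
    proof -
      have "\<not> ?wp j y x" using \<nu> that y less by (auto simp: stable_def)
      moreover have "x \<noteq> y" using y that irr by auto
      ultimately show ?thesis using tot_w[of x y j] that y less by auto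
    qed
    moreover have "y' = y" if "\<mu> y' = j" for y' using that y permutes_inj[OF pm(1)] by (auto dest: injD)
    ultimately show "j \<in> W" using y less unfolding W_def by blast
  qed
  \<comment> \<open>Otherwise \<open>j\<close> and her \<nu>-partner would block \<mu>.\<close>
  have WM: "W \<subseteq> \<nu> ` M"
  proof
    fix j assume j: "j \<in> W"
    then have "j < n" by (auto simp: W_def)
    then obtain x y where xy: "x < n" "\<nu> x = j" "y < n" "\<mu> y = j"
      using pm by (metis permutes_def lessThan_iff)
    then have wp: "?wp j x y" using j by (auto simp: W_def)
    then have "\<not> ?mp x j (\<mu> x)" using \<mu> xy \<open>j < n\<close> by (auto simp: stable_def)
    moreover have "\<mu> x \<noteq> j"
    proof
      assume "\<mu> x = j"
      then have "x = y" using xy permutes_inj[OF pm(1)] by (auto dest: injD)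
      then show False using wp by (auto simp: woman_prefers_Pair)
    qed
    ultimately have "?mp x (\<mu> x) (\<nu> x)" using tot_m[of x j "\<mu> x"] xy \<open>j < n\<close> less by auto
    then show "j \<in> \<nu> ` M" using xy by (auto simp: M_def)
  qed
  have inj: "inj_on \<mu> M" "inj_on \<nu> M" using pm by (auto intro: permutes_inj_on)
  \<comment> \<open>Both images of \<open>M\<close> have the cardinality of \<open>M\<close>, so the
    chain of inclusions through \<open>W\<close> collapses.\<close>
  have "card W \<le> card (\<nu> ` M)" using WM fin by (intro card_mono) auto
  moreover have "card (\<mu> ` M) = card M" "card (\<nu> ` M) = card M" using inj by (auto simp: card_image)
  ultimately have "card W \<le> card (\<mu> ` M)" "card (\<nu> ` M) \<le> card W"
    using MW fin card_mono[of W "\<mu> ` M"] by auto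
  then have eqs: "\<mu> ` M = W" "\<nu> ` M = W"
    using card_seteq[OF fin(2) MW] card_seteq[OF _ WM] fin by auto
  have le: "d i (\<mu> i) \<le> d i (\<nu> i)" if "i \<in> M" for i
    using that by (auto simp: M_def man_prefers_Pair d_def)
  define im where "im = inv_into M \<mu>"
  define jn where "jn = inv_into M \<nu>"
  have bm: "bij_betw \<mu> M W" "bij_betw \<nu> M W" using eqs inj by (auto simp: bij_betw_def)
  have im: "im j \<in> M" "\<mu> (im j) = j" "jn j \<in> M" "\<nu> (jn j) = j" if "j \<in> W" for j
    using that eqs by (auto simp: im_def jn_def f_inv_into_f inv_into_into)
  have lew: "d (jn j) j \<le> d (im j) j" if "j \<in> W" for j
  proof -
    have "?wp j (jn j) (im j)" using that im[OF that] by (auto simp: W_def M_def)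
    then show ?thesis using im[OF that] that dsym by (auto simp: woman_prefers_Pair M_def W_def)
  qed
  have s1: "(\<Sum>i\<in>M. d i (\<mu> i)) = (\<Sum>j\<in>W. d (im j) j)"
    unfolding sum.reindex_bij_betw[OF bm(1), of "\<lambda>j. d (im j) j", symmetric]
    using inj by (intro sum.cong) (auto simp: im_def)
  have s2: "(\<Sum>i\<in>M. d i (\<nu> i)) = (\<Sum>j\<in>W. d (jn j) j)"
    unfolding sum.reindex_bij_betw[OF bm(2), of "\<lambda>j. d (jn j) j", symmetric]
    using inj by (intro sum.cong) (auto simp: jn_def)
  have tot: "(\<Sum>i\<in>M. d i (\<nu> i)) \<le> (\<Sum>i\<in>M. d i (\<mu> i))"
    unfolding s1 s2 by (intro sum_mono lew)
  show ?thesis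
  proof (cases "i \<in> M")
    case True
    have "d i (\<nu> i) \<le> d i (\<mu> i)"
    proof (rule ccontr)
      assume "\<not> ?thesis"
      then have "(\<Sum>i\<in>M. d i (\<mu> i)) < (\<Sum>i\<in>M. d i (\<nu> i))"
        using True fin le by (intro sum_strict_mono_ex1) (auto simp: not_le)
      then show False using tot by simp
    qed
    then show ?thesis by (simp add: d_def)
  next
    case False
    then have "\<not> ?mp i (\<mu> i) (\<nu> i)" using i by (auto simp: M_def)
    then show ?thesis by (auto simp: man_prefers_Pair)
  qed
qed

section \<open>Greedy matchings below a distance threshold\<close>

text \<open>Partial matchings by pairs at distance below \<open>K\<close> that no such pair blocks, where a pair blocks
  only if both sides strictly gain in distance. Tie-breaking plays no role.\<close>
definition level_stable :: "nat set \<Rightarrow> nat set \<Rightarrow> (nat \<Rightarrow> nat \<Rightarrow> nat) \<Rightarrow> nat \<Rightarrow> (nat \<times> nat) set \<Rightarrow> bool" where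
  "level_stable A B d K p \<longleftrightarrow> p \<subseteq> A \<times> B \<and>
     (\<forall>a b b'. (a, b) \<in> p \<and> (a, b') \<in> p \<longrightarrow> b = b') \<and>
     (\<forall>a a' b. (a, b) \<in> p \<and> (a', b) \<in> p \<longrightarrow> a = a') \<and>
     (\<forall>a b. (a, b) \<in> p \<longrightarrow> d a b < K) \<and>
     (\<forall>a\<in>A. \<forall>b\<in>B. d a b < K \<longrightarrow>
        (\<exists>b'. (a, b') \<in> p \<and> d a b' \<le> d a b) \<or> (\<exists>a'. (a', b) \<in> p \<and> d a' b \<le> d a b))"

lemma level_stableD:
  assumes "level_stable A B d K p"
  shows "p \<subseteq> A \<times> B"
    and "\<And>a b b'. (a, b) \<in> p \<Longrightarrow> (a, b') \<in> p \<Longrightarrow> b = b'"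
    and "\<And>a a' b. (a, b) \<in> p \<Longrightarrow> (a', b) \<in> p \<Longrightarrow> a = a'"
    and "\<And>a b. (a, b) \<in> p \<Longrightarrow> d a b < K"
    and "\<And>a b. a \<in> A \<Longrightarrow> b \<in> B \<Longrightarrow> d a b < K \<Longrightarrow>
        (\<exists>b'. (a, b') \<in> p \<and> d a b' \<le> d a b) \<or> (\<exists>a'. (a', b) \<in> p \<and> d a' b \<le> d a b)"
proof -
  note c = assms[unfolded level_stable_def]
  note c2 = conjunct2[OF c] note c3 = conjunct2[OF c2] note c4 = conjunct2[OF c3]
  show "p \<subseteq> A \<times> B" using conjunct1[OF c] .
  show "\<And>a b b'. (a, b) \<in> p \<Longrightarrow> (a, b') \<in> p \<Longrightarrow> b = b'"
    using conjunct1[OF c2] by blast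
  show "\<And>a a' b. (a, b) \<in> p \<Longrightarrow> (a', b) \<in> p \<Longrightarrow> a = a'"
    using conjunct1[OF c3] by blast
  show "\<And>a b. (a, b) \<in> p \<Longrightarrow> d a b < K"
    using conjunct1[OF c4] by blast
  show "\<And>a b. a \<in> A \<Longrightarrow> b \<in> B \<Longrightarrow> d a b < K \<Longrightarrow>
        (\<exists>b'. (a, b') \<in> p \<and> d a b' \<le> d a b) \<or> (\<exists>a'. (a', b) \<in> p \<and> d a' b \<le> d a b)"
    using conjunct2[OF c4] by blast
qed

lemma level_stable_converse:
  assumes "level_stable A B d K p"
  shows "level_stable B A (\<lambda>b a. d a b) K (p\<inverse>)"
  unfolding level_stable_def
proof (intro conjI)
  show "p\<inverse> \<subseteq> B \<times> A" using level_stableD(1)[OF assms] by blast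
  show "\<forall>a b b'. (a, b) \<in> p\<inverse> \<and> (a, b') \<in> p\<inverse> \<longrightarrow> b = b'"
    using level_stableD(3)[OF assms] by auto
  show "\<forall>a a' b. (a, b) \<in> p\<inverse> \<and> (a', b) \<in> p\<inverse> \<longrightarrow> a = a'"
    using level_stableD(2)[OF assms] by auto
  show "\<forall>a b. (a, b) \<in> p\<inverse> \<longrightarrow> d b a < K" using level_stableD(4)[OF assms] by auto
  show "\<forall>a\<in>B. \<forall>b\<in>A. d b a < K \<longrightarrow> (\<exists>b'. (a, b') \<in> p\<inverse> \<and> d b' a \<le> d b a) \<or>
      (\<exists>a'. (a', b) \<in> p\<inverse> \<and> d b a' \<le> d b a)"
    using level_stableD(5)[OF assms] by (metis converse_iff)
qed

text \<open>A pair of least distance in the symmetric difference is weakly dominated by a pair of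
  the other matching. The dominating pair shares a participant with it, so it cannot belong to the
  same matching; it therefore lies in the symmetric difference too, and minimality turns the
  inequality into a tie.\<close>

lemma level_stable_min_tie:
  assumes p: "level_stable A B d K p" and q: "level_stable A B d K q" and ne: "p \<noteq> q"
  obtains r s a b where "r = p \<and> s = q \<or> r = q \<and> s = p" "(a, b) \<in> r" "(a, b) \<notin> s"
    "\<And>x y. (x, y) \<in> r \<Longrightarrow> d x y < d a b \<Longrightarrow> (x, y) \<in> s"
    "\<And>x y. (x, y) \<in> s \<Longrightarrow> d x y < d a b \<Longrightarrow> (x, y) \<in> r"
    "(\<exists>b'. b' \<noteq> b \<and> (a, b') \<in> s \<and> d a b' = d a b) \<or>
     (\<exists>a'. a' \<noteq> a \<and> (a', b) \<in> s \<and> d a' b = d a b)"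
proof -
  define D where "D = (p - q) \<union> (q - p)"
  obtain e where "e \<in> D" using ne by (auto simp: D_def)
  then obtain f where f: "f \<in> D" "\<And>g. g \<in> D \<Longrightarrow> case_prod d f \<le> case_prod d g"
    using ex_has_least_nat[of "\<lambda>e. e \<in> D" e "case_prod d"] by blast
  obtain a b where ab: "f = (a, b)" by (cases f)
  have min: "d a b \<le> d x y" if "(x, y) \<in> D" for x y
    using f(2)[OF that] by (simp add: ab)
  obtain r s where rs: "r = p \<and> s = q \<or> r = q \<and> s = p" "(a, b) \<in> r" "(a, b) \<notin> s"
    using f(1) by (auto simp: D_def ab)
  have r: "level_stable A B d K r" and s: "level_stable A B d K s" using rs p q by auto
  have D: "D = (r - s) \<union> (s - r)" using rs by (auto simp: D_def)
  have *: "(\<exists>b'. (a, b') \<in> s \<and> d a b' \<le> d a b) \<or> (\<exists>a'. (a', b) \<in> s \<and> d a' b \<le> d a b)"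
    using level_stableD(1,4)[OF r] level_stableD(5)[OF s] rs(2) by blast
  have eq1: "b' \<noteq> b \<and> d a b' = d a b" if "(a, b') \<in> s" "d a b' \<le> d a b" for b'
  proof -
    have "b' \<noteq> b" using rs(3) that by auto
    then have "(a, b') \<notin> r" using level_stableD(2)[OF r rs(2)] by blast
    then have "d a b \<le> d a b'" using min that by (auto simp: D)
    then show ?thesis using that \<open>b' \<noteq> b\<close> by auto
  qed
  have eq2: "a' \<noteq> a \<and> d a' b = d a b" if "(a', b) \<in> s" "d a' b \<le> d a b" for a'
  proof -
    have "a' \<noteq> a" using rs(3) that by auto
    then have "(a', b) \<notin> r" using level_stableD(3)[OF r rs(2)] by blast
    then have "d a b \<le> d a' b" using min that by (auto simp: D)
    then show ?thesis using that \<open>a' \<noteq> a\<close> by auto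
  qed
  show ?thesis
  proof (rule that[OF rs])
    show "(x, y) \<in> s" if "(x, y) \<in> r" "d x y < d a b" for x y
      using min[of x y] that by (auto simp: D)
    show "(x, y) \<in> r" if "(x, y) \<in> s" "d x y < d a b" for x y
      using min[of x y] that by (auto simp: D)
    show "(\<exists>b'. b' \<noteq> b \<and> (a, b') \<in> s \<and> d a b' = d a b) \<or>
     (\<exists>a'. a' \<noteq> a \<and> (a', b) \<in> s \<and> d a' b = d a b)"
      using * eq1 eq2 by blast
  qed
qed

definition untied :: "nat \<Rightarrow> (nat \<Rightarrow> nat \<Rightarrow> nat) \<Rightarrow> nat \<Rightarrow> bool" where
  "untied n d K \<longleftrightarrow> (\<forall>x<n. \<forall>y<n. \<forall>y'<n. y \<noteq> y' \<and> d x y < K \<longrightarrow> d x y \<noteq> d x y')"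

text \<open>Leaving out \<open>x\<close> makes the set independent of the profile of \<open>x\<close>.\<close>
definition leftover :: "nat \<Rightarrow> (nat \<Rightarrow> nat \<Rightarrow> nat) \<Rightarrow> nat \<Rightarrow> nat \<Rightarrow> nat set" where
  "leftover n d K x = {y. y < n \<and> (\<exists>p. level_stable ({..<n} - {x}) {..<n} d K p \<and> y \<notin> snd ` p)}"

definition untied_leftover :: "nat \<Rightarrow> (nat \<Rightarrow> nat \<Rightarrow> nat) \<Rightarrow> nat \<Rightarrow> bool" where
  "untied_leftover n d K \<longleftrightarrow>
     (\<forall>x<n. \<forall>y\<in>leftover n d K x. \<forall>y'\<in>leftover n d K x. y \<noteq> y' \<longrightarrow> d x y \<noteq> d x y')"

text \<open>Cutting \<open>r\<close> off at \<open>K\<close> gives a greedy matching without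
  \<open>a\<close>: the partner of \<open>a\<close> in \<open>r\<close> is at distance at least
  \<open>K\<close>, and a pair dominating one below \<open>K\<close> is itself below
  \<open>K\<close>. It misses \<open>b\<close>, whose partner is \<open>a\<close>. It also misses
  \<open>b'\<close>: a pair of \<open>r\<close> below \<open>K\<close> containing \<open>b'\<close>
  would belong to \<open>s\<close> by \<open>sub\<close>, but \<open>s\<close> matches
  \<open>b'\<close> with \<open>a\<close>.\<close>

lemma leftover_tie:
  assumes r: "level_stable {..<n} {..<n} d K' r" and s: "level_stable {..<n} {..<n} d K' s" and "K \<le> K'"
    and ab: "(a, b) \<in> r" "(a, b') \<in> s" "d a b' = d a b" "K \<le> d a b"
    and sub: "\<And>x y. (x, y) \<in> r \<Longrightarrow> d x y < d a b \<Longrightarrow> (x, y) \<in> s"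
  shows "b \<in> leftover n d K a" "b' \<in> leftover n d K a"
proof -
  define p where "p = {(x, y) \<in> r. d x y < K}"
  have "a \<noteq> x" if "(x, y) \<in> p" for x y
    using that level_stableD(2)[OF r ab(1), of y] ab(4) by (auto simp: p_def)
  then have "p \<subseteq> ({..<n} - {a}) \<times> {..<n}"
    using level_stableD(1)[OF r] unfolding p_def by blast
  moreover have "(\<exists>y'. (x, y') \<in> p \<and> d x y' \<le> d x y) \<or> (\<exists>x'. (x', y) \<in> p \<and> d x' y \<le> d x y)"
    if "x < n" "y < n" "d x y < K" for x y
    using level_stableD(5)[OF r, of x y] that \<open>K \<le> K'\<close> unfolding p_def by fastforce
  moreover have "y = y'" if "(x, y) \<in> p" "(x, y') \<in> p" for x y y'
    using that level_stableD(2)[OF r, of x y y'] by (auto simp: p_def)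
  moreover have "x = x'" if "(x, y) \<in> p" "(x', y) \<in> p" for x x' y
    using that level_stableD(3)[OF r, of x y x'] by (auto simp: p_def)
  ultimately have p: "level_stable ({..<n} - {a}) {..<n} d K p"
    unfolding level_stable_def by (auto simp: p_def)
  have "b \<notin> snd ` p"
    using level_stableD(3)[OF r ab(1)] ab(4) by (force simp: p_def)
  moreover have "b' \<notin> snd ` p"
  proof
    assume "b' \<in> snd ` p"
    then obtain x where x: "(x, b') \<in> r" "d x b' < K" by (auto simp: p_def)
    then have "(x, b') \<in> s" using sub ab(4) by simp
    then have "x = a" using level_stableD(3)[OF s ab(2)] by simp
    then show False using x ab by simp
  qed
  ultimately show "b \<in> leftover n d K a" "b' \<in> leftover n d K a"
    using p level_stableD(1)[OF r] level_stableD(1)[OF s] ab unfolding leftover_def by blast+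
qed

text \<open>Below \<open>K\<close> the minimal tie contradicts \<open>untied\<close>; from
  \<open>K\<close> on, \<open>leftover_tie\<close> shows that it is a tie between two leftovers. In
  the application \<open>K'\<close> exceeds every distance, so complete matchings are
  compared.\<close>

lemma level_stable_unique:
  assumes low: "untied n d K" "untied n (\<lambda>y x. d x y) K"
    and high: "untied_leftover n d K" "untied_leftover n (\<lambda>y x. d x y) K"
    and p: "level_stable {..<n} {..<n} d K' p" and q: "level_stable {..<n} {..<n} d K' q"
    and "K \<le> K'"
  shows "p = q"
proof (rule ccontr)
  assume "p \<noteq> q"
  then obtain r s a b where rs: "r = p \<and> s = q \<or> r = q \<and> s = p" "(a, b) \<in> r" "(a, b) \<notin> s"
    "\<And>x y. (x, y) \<in> r \<Longrightarrow> d x y < d a b \<Longrightarrow> (x, y) \<in> s"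
    "\<And>x y. (x, y) \<in> s \<Longrightarrow> d x y < d a b \<Longrightarrow> (x, y) \<in> r"
    and tie: "(\<exists>b'. b' \<noteq> b \<and> (a, b') \<in> s \<and> d a b' = d a b) \<or>
     (\<exists>a'. a' \<noteq> a \<and> (a', b) \<in> s \<and> d a' b = d a b)"
    using level_stable_min_tie[OF p q] by metis
  have r: "level_stable {..<n} {..<n} d K' r" and s: "level_stable {..<n} {..<n} d K' s"
    using rs p q by auto
  have ab: "a < n" "b < n" using level_stableD(1)[OF r] rs by auto
  from tie show False
  proof (elim disjE exE conjE)
    fix b' assume b': "b' \<noteq> b" "(a, b') \<in> s" "d a b' = d a b"
    then have "b' < n" using level_stableD(1)[OF s] by auto
    then have "K \<le> d a b" using low(1) b' ab unfolding untied_def by (metis not_le)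
    then have "b \<in> leftover n d K a" "b' \<in> leftover n d K a"
      using leftover_tie[OF r s \<open>K \<le> K'\<close> rs(2) b'(2,3)] rs(4) by blast+
    then show False using high(1) b' ab unfolding untied_leftover_def by metis
  next
    fix a' assume a': "a' \<noteq> a" "(a', b) \<in> s" "d a' b = d a b"
    then have "a' < n" using level_stableD(1)[OF s] by auto
    then have "K \<le> d a b" using low(2) a' ab unfolding untied_def by (metis not_le)
    then have "a \<in> leftover n (\<lambda>y x. d x y) K b" "a' \<in> leftover n (\<lambda>y x. d x y) K b"
      using leftover_tie[OF level_stable_converse[OF r] level_stable_converse[OF s] \<open>K \<le> K'\<close>, of b a a']
        rs(2,4) a' by auto
    then show False using high(2) a' ab unfolding untied_leftover_def by metis
  qed
qed

section \<open>Far blocks and the number of leftovers\<close>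

definition far_block :: "nat \<Rightarrow> (nat \<Rightarrow> nat \<Rightarrow> nat) \<Rightarrow> nat \<Rightarrow> nat \<Rightarrow> bool" where
  "far_block n d K m \<longleftrightarrow> (\<exists>S T. S \<subseteq> {..<n} \<and> T \<subseteq> {..<n} \<and> card S = m \<and> card T = m \<and>
     (\<forall>x\<in>S. \<forall>y\<in>T. K \<le> d x y))"

lemma far_blockI:
  assumes "S \<subseteq> {..<n}" "T \<subseteq> {..<n}" "m \<le> card S" "m \<le> card T" "\<And>x y. x \<in> S \<Longrightarrow> y \<in> T \<Longrightarrow> K \<le> d x y"
  shows "far_block n d K m"
proof -
  obtain S' where "S' \<subseteq> S" "card S' = m" using assms(3) by (metis obtain_subset_with_card_n)
  moreover obtain T' where "T' \<subseteq> T" "card T' = m" using assms(4) by (metis obtain_subset_with_card_n)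
  ultimately show ?thesis using assms unfolding far_block_def by (metis subset_iff)
qed

lemma far_block_swap: "far_block n (\<lambda>y x. d x y) K m \<longleftrightarrow> far_block n d K m"
proof -
  have "far_block n (\<lambda>y x. e x y) K m" if e: "far_block n e K m" for e
  proof -
    obtain S T where "S \<subseteq> {..<n}" "T \<subseteq> {..<n}" "card S = m" "card T = m" "\<And>x y. x \<in> S \<Longrightarrow> y \<in> T \<Longrightarrow> K \<le> e x y"
      using e unfolding far_block_def by auto
    then show ?thesis unfolding far_block_def by (intro exI[of _ T] exI[of _ S]) auto
  qed
  from this[of d] this[of "\<lambda>y x. d x y"] show ?thesis by blast
qed

text \<open>Without ties below \<open>K\<close>, \<open>level_stable_min_tie\<close> leaves at most
  one greedy matching, and the leftovers are the complement of its range. Its unmatched men and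
  women are pairwise at distance at least \<open>K\<close>.\<close>

lemma card_leftover_le:
  assumes low: "untied n d K" "untied n (\<lambda>y x. d x y) K" and far: "\<not> far_block n d K m"
  shows "card (leftover n d K x) \<le> m"
proof (cases "\<exists>p. level_stable ({..<n} - {x}) {..<n} d K p")
  case False
  then show ?thesis by (simp add: leftover_def)
next
  case True
  then obtain p where p: "level_stable ({..<n} - {x}) {..<n} d K p" by blast
  have uniq: "q = p" if q: "level_stable ({..<n} - {x}) {..<n} d K q" for q
  proof (rule ccontr)
    assume "q \<noteq> p"
    then obtain r s a b where rs: "r = q \<and> s = p \<or> r = p \<and> s = q" "(a, b) \<in> r"
      and tie: "(\<exists>b'. b' \<noteq> b \<and> (a, b') \<in> s \<and> d a b' = d a b) \<or>
       (\<exists>a'. a' \<noteq> a \<and> (a', b) \<in> s \<and> d a' b = d a b)"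
      using level_stable_min_tie[OF q p] by metis
    have r: "level_stable ({..<n} - {x}) {..<n} d K r" and s: "level_stable ({..<n} - {x}) {..<n} d K s"
      using rs p q by auto
    have ab: "a < n" "b < n" "d a b < K" using level_stableD(1,4)[OF r] rs by auto
    from tie show False
    proof (elim disjE exE conjE)
      fix b' assume b': "b' \<noteq> b" "(a, b') \<in> s" "d a b' = d a b"
      then have "b' < n" using level_stableD(1)[OF s] by auto
      then show False using low(1) b' ab unfolding untied_def by metis
    next
      fix a' assume a': "a' \<noteq> a" "(a', b) \<in> s" "d a' b = d a b"
      then have "a' < n" using level_stableD(1)[OF s] by auto
      then show False using low(2) a' ab unfolding untied_def by metis
    qed
  qed
  have sub: "p \<subseteq> ({..<n} - {x}) \<times> {..<n}" using level_stableD(1)[OF p] .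
  have inj: "inj_on fst p" "inj_on snd p"
    using level_stableD(2,3)[OF p] by (auto simp: inj_on_def)
  have fin: "finite (fst ` p)" "finite (snd ` p)"
    using finite_subset[OF sub] by auto
  have left: "leftover n d K x = {..<n} - snd ` p"
    using p uniq unfolding leftover_def by blast
  show ?thesis
  proof (rule ccontr)
    assume *: "\<not> ?thesis"
    have psub: "fst ` p \<subseteq> {..<n} - {x}" "snd ` p \<subseteq> {..<n}" using sub by auto
    have "card ({..<n} - snd ` p) = n - card p"
      using psub fin inj by (simp add: card_Diff_subset card_image)
    \<comment> \<open>Removing \<open>x\<close> may leave one man fewer than women. The strict
      inequality in the negated claim absorbs this loss.\<close>
    moreover have "n - 1 \<le> card ({..<n} - {x})" using card_Diff1_le[of "{..<n}" x] by (cases "x < n") auto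
    then have "n - 1 - card p \<le> card ({..<n} - {x} - fst ` p)"
      using psub fin inj by (subst card_Diff_subset) (auto simp: card_image)
    ultimately have "m \<le> card ({..<n} - {x} - fst ` p)" "m \<le> card ({..<n} - snd ` p)"
      using * left by auto
    moreover have "K \<le> d a b" if "a \<in> {..<n} - {x} - fst ` p" "b \<in> {..<n} - snd ` p" for a b
      using level_stableD(5)[OF p, of a b] that by (force simp: not_less[symmetric])
    ultimately have "far_block n d K m"
      by (intro far_blockI[of "{..<n} - {x} - fst ` p" n "{..<n} - snd ` p"]) auto
    then show False using far by simp
  qed
qed

section \<open>Inner products of random profiles\<close>

text \<open>Up to the factor \<open>2 ^ card B\<close> this is the moment generating function of a
  sum of \<open>card B\<close> independent signs: each element contributes \<open>exp u\<close> or
  \<open>exp (- u)\<close>.\<close>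

lemma sum_Pow_exp:
  fixes u :: real
  assumes "finite B"
  shows "(\<Sum>X\<in>Pow B. exp (u * (real (card B) - 2 * real (card X)))) = (2 * cosh u) ^ card B"
  using assms
proof induction
  case empty
  then show ?case by simp
next
  case (insert b B)
  let ?f = "\<lambda>X. exp (u * (real (card B) - 2 * real (card X)))"
  have disj: "Pow B \<inter> insert b ` Pow B = {}" using insert by auto
  have inj: "inj_on (insert b) (Pow B)" using insert by (auto simp: inj_on_def)
  have "(\<Sum>X\<in>Pow (insert b B). exp (u * (real (card (insert b B)) - 2 * real (card X))))
      = (\<Sum>X\<in>Pow B. exp (u * (real (card (insert b B)) - 2 * real (card X))))
        + (\<Sum>X\<in>Pow B. exp (u * (real (card (insert b B)) - 2 * real (card (insert b X)))))"
    using insert disj inj by (simp add: Pow_insert sum.union_disjoint sum.reindex)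
  also have "\<dots> = (\<Sum>X\<in>Pow B. exp u * ?f X) + (\<Sum>X\<in>Pow B. exp (- u) * ?f X)"
  proof (intro arg_cong2[of _ _ _ _ "(+)"] sum.cong refl)
    fix X assume "X \<in> Pow B"
    then have X: "finite X" "b \<notin> X" using insert finite_subset by auto
    show "exp (u * (real (card (insert b B)) - 2 * real (card X))) = exp u * ?f X"
      using insert by (simp add: exp_add[symmetric] algebra_simps)
    show "exp (u * (real (card (insert b B)) - 2 * real (card (insert b X)))) = exp (- u) * ?f X"
      using insert X by (simp add: exp_add[symmetric] algebra_simps)
  qed
  also have "\<dots> = (2 * cosh u) * (\<Sum>X\<in>Pow B. ?f X)"
    by (simp add: sum_distrib_left[symmetric] cosh_field_def algebra_simps)
  also have "\<dots> = (2 * cosh u) ^ card (insert b B)" using insert by simp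
  finally show ?case .
qed

lemma sum_Pow_Un:
  fixes f g :: "'a set \<Rightarrow> real"
  assumes "A \<inter> B = {}"
  shows "(\<Sum>X\<in>Pow (A \<union> B). f (X \<inter> A) * g (X \<inter> B)) = sum f (Pow A) * sum g (Pow B)"
proof -
  have "sum f (Pow A) * sum g (Pow B) = (\<Sum>(P,Q)\<in>Pow A \<times> Pow B. f P * g Q)"
    by (simp add: sum_product sum.cartesian_product)
  also have "\<dots> = (\<Sum>X\<in>Pow (A \<union> B). f (X \<inter> A) * g (X \<inter> B))"
    by (rule sum.reindex_bij_witness[of _ "\<lambda>X. (X \<inter> A, X \<inter> B)" "\<lambda>(P,Q). P \<union> Q"])
      (use assms in \<open>auto intro!: arg_cong2[of _ _ _ _ "(*)"] arg_cong[of _ _ f] arg_cong[of _ _ g]\<close>)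
  finally show ?thesis by simp
qed

abbreviation cube :: "nat \<Rightarrow> bool list set" where
  "cube k \<equiv> {xs. length xs = k}"

lemma finite_cube [simp]: "finite (cube k)"
  using finite_lists_length_eq[of "UNIV :: bool set" k] by simp

lemma card_cube [simp]: "card (cube k) = 2 ^ k"
  using card_lists_length_eq[of "UNIV :: bool set" k] by simp

definition disagree :: "bool list \<Rightarrow> bool list \<Rightarrow> nat set" where
  "disagree a w = {l. l < length a \<and> a ! l \<noteq> w ! l}"

lemma hamming_disagree: "hamming a w = card (disagree a w)"
  by (simp add: hamming_def disagree_def)

lemma disagree_bij:
  assumes "length a = k"
  shows "bij_betw (disagree a) (cube k) (Pow {..<k})"
proof (rule bij_betw_byWitness[of _ "\<lambda>X. map (\<lambda>l. a ! l \<noteq> (l \<in> X)) [0..<k]"])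
  show "\<forall>w\<in>cube k. map (\<lambda>l. a ! l \<noteq> (l \<in> disagree a w)) [0..<k] = w"
    using assms by (auto simp: disagree_def intro!: nth_equalityI)
qed (use assms in \<open>auto simp: disagree_def\<close>)

lemma hamming_le: "hamming a w \<le> length a"
proof -
  have "disagree a w \<subseteq> {..<length a}" by (auto simp: disagree_def)
  then show ?thesis using card_mono[of "{..<length a}"] by (simp add: hamming_disagree)
qed

text \<open>The inner product of the profiles read as vectors of signs.\<close>
definition ip :: "bool list \<Rightarrow> bool list \<Rightarrow> real" where
  "ip a w = real (length a) - 2 * real (hamming a w)"

lemma sum_cube_ip:
  assumes "length a = k"
  shows "(\<Sum>w\<in>cube k. exp (u * ip a w)) = (2 * cosh u) ^ k"
proof -
  have "(\<Sum>w\<in>cube k. exp (u * ip a w)) = (\<Sum>X\<in>Pow {..<k}. exp (u * (real k - 2 * real (card X))))"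
    using sum.reindex_bij_betw[OF disagree_bij[OF assms],
        of "\<lambda>X. exp (u * (real k - 2 * real (card X)))"]
    by (simp add: ip_def hamming_disagree assms)
  then show ?thesis using sum_Pow_exp[of "{..<k}" u] by simp
qed

text \<open>Writing \<open>w\<close> as the set of coordinates in which it differs from \<open>a\<close>, its part inside
  \<open>disagree a b\<close> decides whether the two distances agree, and its part outside decides their size.\<close>
lemma
  assumes "length a = k" "length b = k" "length w = k"
  shows ip_add: "ip a w + ip b w =
      2 * (real (card ({..<k} - disagree a b)) - 2 * real (card (disagree a w \<inter> ({..<k} - disagree a b))))"
    and hamming_eq_iff: "hamming a w = hamming b w \<longleftrightarrow>
      2 * card (disagree a w \<inter> disagree a b) = card (disagree a b)"
proof -
  let ?X = "disagree a w" and ?D = "disagree a b"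
  have fin: "finite ?X" "finite ?D" by (auto simp: disagree_def)
  have sub: "?X \<subseteq> {..<k}" "?D \<subseteq> {..<k}" using assms by (auto simp: disagree_def)
  have b: "disagree b w = (?D - ?X) \<union> (?X - ?D)"
    using assms by (auto simp: disagree_def)
  have hb: "hamming b w = card (?D - ?X) + card (?X - ?D)"
    unfolding hamming_disagree b using fin by (subst card_Un_disjoint) auto
  have D: "card ?D = card (?D - ?X) + card (?X \<inter> ?D)"
    using card_Int_Diff[OF fin(2), of ?X] by (simp add: Int_commute)
  have X: "card ?X = card (?X - ?D) + card (?X \<inter> ?D)"
    using card_Int_Diff[OF fin(1), of ?D] by simp
  have X': "?X \<inter> ({..<k} - ?D) = ?X - ?D" using sub by auto
  have k: "k = card ({..<k} - ?D) + card ?D"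
    using card_Diff_subset[OF fin(2) sub(2)] card_mono[OF _ sub(2)] by simp
  show "ip a w + ip b w = 2 * (real (card ({..<k} - ?D)) - 2 * real (card (?X \<inter> ({..<k} - ?D))))"
    using hb D X k unfolding X' ip_def assms by (simp add: hamming_disagree)
  show "hamming a w = hamming b w \<longleftrightarrow> 2 * card (?X \<inter> ?D) = card ?D"
    using hb D X by (simp add: hamming_disagree)
qed

text \<open>The exponential weight depends only on the coordinates where \<open>a\<close> and
  \<open>b\<close> agree, and \<open>F\<close> only on those where they differ, so the sum
  factorizes. With \<open>F\<close> constant it gives second moments, with \<open>F\<close> the
  indicator of one half it counts ties.\<close>

lemma sum_cube_ip_pair:
  fixes F :: "nat \<Rightarrow> real"
  assumes "length a = k" "length b = k"
  shows "(\<Sum>w\<in>cube k. F (card (disagree a w \<inter> disagree a b)) * exp (u * (ip a w + ip b w)))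
    = (\<Sum>X\<in>Pow (disagree a b). F (card X)) * (2 * cosh (2 * u)) ^ (k - hamming a b)"
proof -
  let ?D = "disagree a b" and ?B = "{..<k} - disagree a b"
  have sub: "?D \<subseteq> {..<k}" using assms by (auto simp: disagree_def)
  have cB: "card ?B = k - hamming a b"
    using sub by (simp add: hamming_disagree card_Diff_subset finite_subset)
  have "(\<Sum>w\<in>cube k. F (card (disagree a w \<inter> ?D)) * exp (u * (ip a w + ip b w)))
    = (\<Sum>w\<in>cube k. F (card (disagree a w \<inter> ?D)) * exp (2 * u * (real (card ?B) - 2 * real (card (disagree a w \<inter> ?B)))))"
    using assms by (intro sum.cong) (auto simp: ip_add mult.assoc)
  also have "\<dots> = (\<Sum>X\<in>Pow {..<k}. F (card (X \<inter> ?D)) * exp (2 * u * (real (card ?B) - 2 * real (card (X \<inter> ?B)))))"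
    by (rule sum.reindex_bij_betw[OF disagree_bij[OF assms(1)]])
  also have "Pow {..<k} = Pow (?D \<union> ?B)" using sub by (intro arg_cong[of _ _ Pow]) auto
  also have "(\<Sum>X\<in>Pow (?D \<union> ?B). F (card (X \<inter> ?D)) * exp (2 * u * (real (card ?B) - 2 * real (card (X \<inter> ?B)))))
     = (\<Sum>X\<in>Pow ?D. F (card X)) * (\<Sum>X\<in>Pow ?B. exp (2 * u * (real (card ?B) - 2 * real (card X))))"
    by (rule sum_Pow_Un) auto
  finally show ?thesis using sum_Pow_exp[of ?B "2 * u"] cB by simp
qed

lemma sum_cube_ip2:
  assumes "length a = k" "length b = k"
  shows "(\<Sum>w\<in>cube k. exp (u * (ip a w + ip b w))) = 2 ^ k * cosh (2 * u) ^ (k - hamming a b)"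
proof -
  have "finite (disagree a b)" by (simp add: disagree_def)
  then have "(\<Sum>w\<in>cube k. exp (u * (ip a w + ip b w))) = 2 ^ hamming a b * (2 * cosh (2 * u)) ^ (k - hamming a b)"
    using sum_cube_ip_pair[OF assms, of "\<lambda>_. 1" u] by (simp add: card_Pow hamming_disagree)
  also have "\<dots> = (2 ^ hamming a b * 2 ^ (k - hamming a b)) * cosh (2 * u) ^ (k - hamming a b)"
    by (simp add: power_mult_distrib)
  also have "2 ^ hamming a b * 2 ^ (k - hamming a b) = (2 :: real) ^ k"
    using hamming_le[of a b] assms by (simp add: power_add[symmetric])
  finally show ?thesis .
qed

section \<open>Central binomial coefficients and the weight of ties\<close>

lemma central_binomial_upper: "real ((2 * n) choose n) ^ 2 * (2 * real n + 1) \<le> 16 ^ n"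
proof (induction n)
  case (Suc n)
  have *: "real (Suc n) * real ((2 * Suc n) choose Suc n) = 2 * (2 * real n + 1) * real ((2 * n) choose n)"
  proof -
    have "Suc n * (Suc n * ((2 * Suc n) choose Suc n)) = Suc n * (Suc (Suc (2 * n)) * (Suc (2 * n) choose n))"
      using Suc_times_binomial_eq[of "Suc (2 * n)" n] by simp
    also have "\<dots> = Suc (Suc (2 * n)) * (Suc n * (Suc (2 * n) choose Suc n))"
      using binomial_symmetric[of n "Suc (2 * n)"] by simp
    also have "Suc n * (Suc (2 * n) choose Suc n) = Suc (2 * n) * ((2 * n) choose n)"
      using Suc_times_binomial_eq[of "2 * n" n] by simp
    finally have "Suc n * (Suc n * ((2 * Suc n) choose Suc n)) = Suc n * (2 * (Suc (2 * n) * ((2 * n) choose n)))"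
      by simp
    then have "Suc n * ((2 * Suc n) choose Suc n) = 2 * (Suc (2 * n) * ((2 * n) choose n))"
      by (subst (asm) mult_left_cancel) auto
    then have "real (Suc n * ((2 * Suc n) choose Suc n)) = real (2 * (Suc (2 * n) * ((2 * n) choose n)))"
      by (rule arg_cong)
    then show ?thesis by (simp add: algebra_simps)
  qed
  let ?c = "real ((2 * n) choose n)" and ?c' = "real ((2 * Suc n) choose Suc n)" and ?x = "real n"
  have "(real (Suc n))\<^sup>2 * (?c'\<^sup>2 * (2 * real (Suc n) + 1)) = (real (Suc n) * ?c')\<^sup>2 * (2 * ?x + 3)"
    by (simp add: power2_eq_square algebra_simps)
  also have "\<dots> = 4 * ((2 * ?x + 1) * (2 * ?x + 3)) * (?c\<^sup>2 * (2 * ?x + 1))"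
    unfolding * by (simp add: power2_eq_square algebra_simps)
  \<comment> \<open>The factor \<open>2 * n + 1\<close> in the claim is fitted to this step: the two
    sides of the inequality between the quadratics differ by exactly 1.\<close>
  also have "\<dots> \<le> 4 * (4 * (?x + 1)\<^sup>2) * 16 ^ n"
  proof (rule mult_mono[OF mult_left_mono Suc])
    show "(2 * ?x + 1) * (2 * ?x + 3) \<le> 4 * (?x + 1)\<^sup>2"
      by (simp add: power2_eq_square algebra_simps)
  qed auto
  also have "\<dots> = (real (Suc n))\<^sup>2 * 16 ^ Suc n" by (simp add: power2_eq_square add.commute)
  finally show ?case by (simp only: mult_le_cancel_left_pos zero_less_power of_nat_0_less_iff zero_less_Suc)
qed simp

lemma card_half_subsets_le:
  assumes "finite D"
  shows "real (card {X. X \<subseteq> D \<and> 2 * card X = card D}) * sqrt (real (card D) + 1) \<le> 2 ^ card D"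
proof (cases "even (card D)")
  case False
  then have "2 * card X \<noteq> card D" for X :: "'a set" by (metis dvd_triv_left)
  then have "{X. X \<subseteq> D \<and> 2 * card X = card D} = {}" by simp
  then show ?thesis by (simp only:) simp
next
  case True
  then obtain m where m: "card D = 2 * m" by blast
  have "{X. X \<subseteq> D \<and> 2 * card X = card D} = {X. X \<subseteq> D \<and> card X = m}" using m by auto
  then have c: "card {X. X \<subseteq> D \<and> 2 * card X = card D} = (2 * m) choose m"
    using n_subsets[OF assms, of m] m by simp
  have "(real ((2 * m) choose m) * sqrt (2 * real m + 1))\<^sup>2 \<le> (2 ^ (2 * m))\<^sup>2"
  proof -
    have "((2 :: real) ^ (2 * m))\<^sup>2 = 16 ^ m"
      by (simp add: power_mult power2_eq_square power_mult_distrib[symmetric])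
    then show ?thesis using central_binomial_upper[of m] by (simp add: power_mult_distrib)
  qed
  then have "real ((2 * m) choose m) * sqrt (2 * real m + 1) \<le> 2 ^ (2 * m)"
    by (rule power2_le_imp_le) simp
  then show ?thesis unfolding c by (simp add: m)
qed

text \<open>A tie means that \<open>w\<close> splits \<open>disagree a b\<close> into two halves,
  which costs the central binomial factor. The exponential weight sees only the other coordinates
  and is unaffected.\<close>

lemma sum_cube_ties:
  assumes "length a = k" "length b = k"
  shows "(\<Sum>w\<in>cube k. of_bool (hamming a w = hamming b w) * exp (u * (ip a w + ip b w)))
    \<le> 2 ^ k / sqrt (real (hamming a b) + 1) * cosh (2 * u) ^ (k - hamming a b)"
proof -
  let ?h = "hamming a b"
  have fin: "finite (disagree a b)" by (simp add: disagree_def)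
  have "(\<Sum>w\<in>cube k. of_bool (hamming a w = hamming b w) * exp (u * (ip a w + ip b w)))
    = (\<Sum>w\<in>cube k. of_bool (2 * card (disagree a w \<inter> disagree a b) = ?h) * exp (u * (ip a w + ip b w)))"
    using assms by (intro sum.cong) (auto simp: hamming_eq_iff hamming_disagree[of a b])
  also have "\<dots> = (\<Sum>X\<in>Pow (disagree a b). of_bool (2 * card X = ?h)) * (2 * cosh (2 * u)) ^ (k - ?h)"
    using sum_cube_ip_pair[OF assms, of "\<lambda>c. of_bool (2 * c = ?h)" u] by simp
  also have "(\<Sum>X\<in>Pow (disagree a b). of_bool (2 * card X = ?h)) =
      real (card {X. X \<subseteq> disagree a b \<and> 2 * card X = card (disagree a b)})"
  proof -
    have "Pow (disagree a b) \<inter> {X. 2 * card X = ?h} = {X. X \<subseteq> disagree a b \<and> 2 * card X = card (disagree a b)}"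
      by (auto simp: hamming_disagree)
    then show ?thesis using fin by (simp add: sum_of_bool_eq)
  qed
  also have "\<dots> * (2 * cosh (2 * u)) ^ (k - ?h) \<le> 2 ^ ?h / sqrt (real ?h + 1) * (2 * cosh (2 * u)) ^ (k - ?h)"
  proof (rule mult_right_mono)
    have "0 < sqrt (real ?h + 1)" by simp
    then show "real (card {X. X \<subseteq> disagree a b \<and> 2 * card X = card (disagree a b)}) \<le> 2 ^ ?h / sqrt (real ?h + 1)"
      using card_half_subsets_le[OF fin] by (simp only: pos_le_divide_eq hamming_disagree)
    show "0 \<le> (2 * cosh (2 * u)) ^ (k - ?h)"
      by (simp add: cosh_real_nonneg)
  qed
  also have "\<dots> = (2 ^ ?h * 2 ^ (k - ?h)) / sqrt (real ?h + 1) * cosh (2 * u) ^ (k - ?h)"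
    by (simp add: power_mult_distrib)
  also have "2 ^ hamming a b * 2 ^ (k - hamming a b) = (2 :: real) ^ k"
    using hamming_le[of a b] assms by (simp add: power_add[symmetric])
  finally show ?thesis .
qed

section \<open>Comparison of \<open>cosh\<close> with exponentials\<close>

lemma cosh_double_le: "cosh (2 * x) \<le> cosh x ^ 4" for x :: real
proof -
  have "0 \<le> (cosh x ^ 2 - 1)\<^sup>2" by simp
  also have "\<dots> = cosh x ^ 4 - cosh (2 * x)"
    unfolding cosh_double_cosh by (simp add: power2_eq_square power4_eq_xxxx algebra_simps)
  finally show ?thesis by simp
qed

lemma cosh_ge_one_plus: "1 + x\<^sup>2 / 2 \<le> cosh x" for x :: real
proof -
  have "cosh x = 1 + 2 * sinh (x / 2) ^ 2"
    using cosh_double_cosh[of "x / 2"] cosh_square_eq[of "x / 2"] by simp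
  moreover have "\<bar>x / 2\<bar> \<le> \<bar>sinh (x / 2)\<bar>"
  proof -
    have "y \<le> sinh y" if "0 \<le> y" for y :: real
    proof -
      have "(\<lambda>y. sinh y - y) 0 \<le> (\<lambda>y. sinh y - y) y"
      proof (rule DERIV_nonneg_imp_nondecreasing[OF that])
        fix z :: real
        have "((\<lambda>y. sinh y - y) has_real_derivative cosh z - 1) (at z)"
          by (auto intro!: derivative_eq_intros)
        then show "\<exists>d. ((\<lambda>y. sinh y - y) has_real_derivative d) (at z) \<and> 0 \<le> d"
          using cosh_real_ge_1[of z] by (intro exI[of _ "cosh z - 1"]) auto
      qed
      then show ?thesis by simp
    qed
    from this[of "x / 2"] this[of "- x / 2"] show ?thesis by (cases "x \<ge> 0") auto
  qed
  then have "(x / 2)\<^sup>2 \<le> sinh (x / 2) ^ 2" by (metis abs_ge_zero power2_abs power_mono)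
  ultimately show ?thesis by (simp add: power_divide)
qed

text \<open>Agrees with the upper bound \<open>exp (x^2 / 2)\<close> to leading order. The quartic
  loss is harmless because \<open>k * u ^ 4\<close> tends to 0 for the \<open>u\<close> chosen
  later.\<close>

lemma cosh_ge_exp:
  fixes x :: real
  assumes "x\<^sup>2 \<le> 2"
  shows "exp (x\<^sup>2 / 2 - x ^ 4 / 4) \<le> cosh x"
proof -
  have "x\<^sup>2 / 2 - (x\<^sup>2 / 2)\<^sup>2 \<le> ln (1 + x\<^sup>2 / 2)"
    using assms by (intro ln_one_plus_pos_lower_bound) auto
  then have "exp (x\<^sup>2 / 2 - x ^ 4 / 4) \<le> 1 + x\<^sup>2 / 2"
    by (subst ln_ge_iff[symmetric]) (auto simp: power_divide add_pos_nonneg power2_eq_square power4_eq_xxxx)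
  then show ?thesis using cosh_ge_one_plus[of x] by linarith
qed

lemma cosh_le_exp: "cosh x \<le> exp (x\<^sup>2 / 2)" for x :: real
proof -
  have "cosh y \<le> exp (y\<^sup>2 / 2)" if "0 \<le> y" for y :: real
  proof -
    have "0 \<le> y\<^sup>2 / 2 - ln (cosh y)"
    proof -
      have "(\<lambda>y. y\<^sup>2 / 2 - ln (cosh y)) 0 \<le> (\<lambda>y. y\<^sup>2 / 2 - ln (cosh y)) y"
      proof (rule DERIV_nonneg_imp_nondecreasing[OF that])
        fix z :: real assume z: "0 \<le> z"
        have "((\<lambda>y. y\<^sup>2 / 2 - ln (cosh y)) has_real_derivative z - sinh z / cosh z) (at z)"
          by (auto intro!: derivative_eq_intros simp: cosh_real_pos)
        moreover have "0 \<le> z - sinh z / cosh z"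
        proof -
          have "(\<lambda>z. z * cosh z - sinh z) 0 \<le> (\<lambda>z. z * cosh z - sinh z) z"
          proof (rule DERIV_nonneg_imp_nondecreasing[OF z])
            fix t :: real assume "0 \<le> t"
            moreover have "((\<lambda>z. z * cosh z - sinh z) has_real_derivative t * sinh t) (at t)"
              by (auto intro!: derivative_eq_intros)
            ultimately show "\<exists>y. ((\<lambda>z. z * cosh z - sinh z) has_real_derivative y) (at t) \<and> 0 \<le> y"
              by (intro exI[of _ "t * sinh t"]) auto
          qed
          then show ?thesis by (simp add: pos_divide_le_eq cosh_real_pos)
        qed
        ultimately show "\<exists>d. ((\<lambda>y. y\<^sup>2 / 2 - ln (cosh y)) has_real_derivative d) (at z) \<and> 0 \<le> d"
          by blast
      qed
      then show ?thesis by simp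
    qed
    then have "ln (cosh y) \<le> y\<^sup>2 / 2" by simp
    then show ?thesis using ln_le_cancel_iff[of "cosh y" "exp (y\<^sup>2 / 2)"] cosh_real_pos[of y] by simp
  qed
  from this[of "\<bar>x\<bar>"] show ?thesis by (simp add: cosh_real_abs)
qed

section \<open>Tail bounds\<close>

lemma exp_ge_of_bool: "of_bool P \<le> exp x" if "P \<Longrightarrow> 0 \<le> x" for x :: real
  using that by (cases P) auto

lemma card_hamming_small_le:
  assumes a: "length a = k" and s: "0 \<le> s"
  shows "real (card {w \<in> cube k. real (hamming a w) < real k / 2 - s}) \<le> 2 ^ k * exp (- 2 * s\<^sup>2 / real k)"
proof (cases "k = 0")
  case True
  then have "{w \<in> cube k. real (hamming a w) < real k / 2 - s} = {}" using s by auto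
  then show ?thesis by (simp only:) simp
next
  case False
  \<comment> \<open>The minimizer of \<open>- 2 * z * s + k * z^2 / 2\<close>, the exponent of the
    Chernoff bound.\<close>
  define z where "z = 2 * s / real k"
  have z: "0 \<le> z" using s by (simp add: z_def)
  have "real (card {w \<in> cube k. real (hamming a w) < real k / 2 - s}) =
      (\<Sum>w\<in>cube k. of_bool (real (hamming a w) < real k / 2 - s))"
    by (simp add: sum_of_bool_eq Collect_conj_eq)
  also have "\<dots> \<le> (\<Sum>w\<in>cube k. exp (z * (ip a w - 2 * s)))"
    using z a by (intro sum_mono exp_ge_of_bool mult_nonneg_nonneg) (auto simp: ip_def)
  also have "\<dots> = exp (- 2 * z * s) * (\<Sum>w\<in>cube k. exp (z * ip a w))"
    by (simp add: sum_distrib_left exp_add[symmetric] algebra_simps)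
  also have "\<dots> = exp (- 2 * z * s) * (2 ^ k * cosh z ^ k)"
    by (simp add: sum_cube_ip[OF a] power_mult_distrib)
  also have "\<dots> \<le> exp (- 2 * z * s) * (2 ^ k * exp (z\<^sup>2 / 2) ^ k)"
    by (intro mult_left_mono power_mono cosh_le_exp) (auto simp: cosh_real_nonneg)
  also have "\<dots> = 2 ^ k * exp (- 2 * z * s + real k * (z\<^sup>2 / 2))"
    by (simp add: exp_of_nat_mult[symmetric] mult_exp_exp algebra_simps)
  also have "- 2 * z * s + real k * (z\<^sup>2 / 2) = - 2 * s\<^sup>2 / real k"
    using False by (simp add: z_def power2_eq_square field_simps)
  finally show ?thesis .
qed

lemma inverse_sqrt_hamming_le:
  assumes k: "0 < k" and h: "(1/2 - \<eta>) * real k \<le> real h" and \<eta>: "\<eta> \<le> 1/4"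
  shows "1 / sqrt (real h + 1) \<le> 2 / sqrt (real k)"
proof -
  have "real k / 4 \<le> (1/2 - \<eta>) * real k"
    using mult_right_mono[of "1/4" "1/2 - \<eta>" "real k"] \<eta> by simp
  then have "real k / 4 \<le> real h + 1" using h by linarith
  then have "sqrt (real k / 4) \<le> sqrt (real h + 1)" by (rule real_sqrt_le_mono)
  then have "1 / sqrt (real h + 1) \<le> 1 / sqrt (real k / 4)"
    using k by (intro divide_left_mono) auto
  then show ?thesis by (simp add: real_sqrt_divide)
qed

lemma card_all_ties_le:
  assumes ab: "length a = k" "length b = k" and k: "0 < k" and h: "(1/2 - \<eta>) * real k \<le> real (hamming a b)"
    and \<eta>: "\<eta> \<le> 1/4"
  shows "real (card {w \<in> cube k. hamming a w = hamming b w}) \<le> 2 ^ k * (2 / sqrt (real k))"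
proof -
  have "real (card {w \<in> cube k. hamming a w = hamming b w}) = (\<Sum>w\<in>cube k. of_bool (hamming a w = hamming b w))"
    by (simp add: sum_of_bool_eq Collect_conj_eq)
  also have "\<dots> \<le> 2 ^ k * (1 / sqrt (real (hamming a b) + 1))"
    using sum_cube_ties[OF ab, of 0] by simp
  also have "\<dots> \<le> 2 ^ k * (2 / sqrt (real k))"
    by (intro mult_left_mono inverse_sqrt_hamming_le[OF k h \<eta>]) simp
  finally show ?thesis .
qed

text \<open>Under a tie both inner products exceed \<open>2 * s\<close>, while their sum involves
  only about \<open>k/2\<close> coordinates, each counted twice. This gives the exponent
  \<open>4 * s^2 / k\<close>, twice that for a single distance, on top of the factor
  \<open>1 / sqrt k\<close> for the tie.\<close>

lemma card_ties_le:
  assumes ab: "length a = k" "length b = k" and k: "0 < k" and h: "(1/2 - \<eta>) * real k \<le> real (hamming a b)"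
    and \<eta>: "\<eta> \<le> 1/4" and s: "0 \<le> s"
  shows "real (card {w \<in> cube k. hamming a w = hamming b w \<and> real (hamming a w) < real k / 2 - s})
    \<le> 2 ^ k * (2 / sqrt (real k) * exp (- 4 * s\<^sup>2 / real k * (1 - 2 * \<eta>)))" (is "real (card ?W) \<le> _")
proof -
  let ?h = "hamming a b"
  \<comment> \<open>The minimizer of \<open>- 4 * z * s + k * z^2\<close>, the exponent for
    \<open>\<eta> = 0\<close>.\<close>
  define z where "z = 2 * s / real k"
  have z: "0 \<le> z" using s by (simp add: z_def)
  have hk: "?h \<le> k" using hamming_le[of a b] ab by simp
  have "real (card ?W) = (\<Sum>w\<in>cube k. of_bool (hamming a w = hamming b w \<and> real (hamming a w) < real k / 2 - s))"
    by (simp add: sum_of_bool_eq Collect_conj_eq)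
  also have "\<dots> \<le> (\<Sum>w\<in>cube k. of_bool (hamming a w = hamming b w) * exp (z * (ip a w + ip b w - 4 * s)))"
    using z ab by (intro sum_mono) (auto simp: ip_def intro!: mult_nonneg_nonneg)
  also have "\<dots> = exp (- 4 * z * s) * (\<Sum>w\<in>cube k. of_bool (hamming a w = hamming b w) * exp (z * (ip a w + ip b w)))"
    unfolding sum_distrib_left by (intro sum.cong refl) (simp add: mult_exp_exp algebra_simps)
  also have "\<dots> \<le> exp (- 4 * z * s) * (2 ^ k / sqrt (real ?h + 1) * cosh (2 * z) ^ (k - ?h))"
    by (intro mult_left_mono sum_cube_ties ab) auto
  also have "\<dots> \<le> exp (- 4 * z * s) * (2 ^ k * (2 / sqrt (real k)) * exp (4 * s\<^sup>2 / real k * (1 + 2 * \<eta>)))"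
  proof (intro mult_left_mono mult_mono)
    have "1 / sqrt (real ?h + 1) \<le> 2 / sqrt (real k)" by (rule inverse_sqrt_hamming_le[OF k h \<eta>])
    then show "2 ^ k / sqrt (real ?h + 1) \<le> 2 ^ k * (2 / sqrt (real k))"
      using mult_left_mono[of "1 / sqrt (real ?h + 1)" "2 / sqrt (real k)" "2 ^ k"] by simp
    have "cosh (2 * z) ^ (k - ?h) \<le> exp ((2 * z)\<^sup>2 / 2) ^ (k - ?h)"
      by (intro power_mono cosh_le_exp) (simp add: cosh_real_nonneg)
    also have "\<dots> = exp (2 * z\<^sup>2 * (real k - real ?h))"
      using hk by (simp add: exp_of_nat_mult[symmetric] of_nat_diff power2_eq_square algebra_simps)
    also have "\<dots> \<le> exp (2 * z\<^sup>2 * ((1/2 + \<eta>) * real k))"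
    proof -
      have "real k - real ?h \<le> (1/2 + \<eta>) * real k" using h by (simp add: algebra_simps)
      then show ?thesis by (simp add: mult_left_mono)
    qed
    also have "2 * z\<^sup>2 * ((1/2 + \<eta>) * real k) = 4 * s\<^sup>2 / real k * (1 + 2 * \<eta>)"
      using k by (simp add: z_def power2_eq_square field_simps)
    finally show "cosh (2 * z) ^ (k - ?h) \<le> exp (4 * s\<^sup>2 / real k * (1 + 2 * \<eta>))" .
  qed (auto simp: cosh_real_nonneg)
  also have "\<dots> = 2 ^ k * (2 / sqrt (real k) * exp (- 4 * z * s + 4 * s\<^sup>2 / real k * (1 + 2 * \<eta>)))"
    by (simp add: mult_exp_exp mult.assoc)
  also have "- 4 * z * s + 4 * s\<^sup>2 / real k * (1 + 2 * \<eta>) = - 4 * s\<^sup>2 / real k * (1 - 2 * \<eta>)"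
    using k by (simp add: z_def power2_eq_square field_simps)
  finally show ?thesis .
qed

text \<open>Keeps the covariance of two exponentials small when the profiles are nearly orthogonal.
  By \<open>cosh_double_le\<close>, \<open>k/2\<close> coordinates contribute at most the product
  \<open>(cosh u ^ k)^2\<close> of the means, and each of the \<open>\<eta> * k\<close> excess ones
  at most \<open>exp (2 * u^2)\<close>.\<close>

lemma cosh_power_half_le:
  fixes u :: real
  assumes "real j \<le> (1/2 + \<eta>) * real k" "0 \<le> \<eta>"
  shows "cosh (2 * u) ^ j \<le> (cosh u ^ k)\<^sup>2 * exp (2 * u\<^sup>2 * \<eta> * real k)"
proof -
  let ?X = "cosh (2 * u)"
  have X: "1 \<le> ?X" by (rule cosh_real_ge_1)
  then have lnX: "0 \<le> ln ?X" by simp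
  have "ln ?X \<le> ln (cosh u ^ 4)"
    using cosh_double_le[of u] X by (intro ln_mono) (auto simp: cosh_real_pos)
  then have l1: "ln ?X \<le> 4 * ln (cosh u)" by (simp add: ln_realpow cosh_real_pos)
  have "ln ?X \<le> ln (exp ((2 * u)\<^sup>2 / 2))"
    using cosh_le_exp[of "2 * u"] by (intro ln_mono) (auto simp: cosh_real_pos)
  then have l2: "ln ?X \<le> 2 * u\<^sup>2" by (simp add: power2_eq_square)
  have "?X ^ j = exp (real j * ln ?X)" by (simp add: exp_of_nat_mult cosh_real_pos)
  also have "\<dots> \<le> exp ((1/2 + \<eta>) * real k * ln ?X)"
    using assms lnX by (simp add: mult_right_mono)
  also have "(1/2 + \<eta>) * real k * ln ?X = real k / 2 * ln ?X + \<eta> * real k * ln ?X"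
    by (simp add: algebra_simps)
  also have "\<dots> \<le> real k / 2 * (4 * ln (cosh u)) + \<eta> * real k * (2 * u\<^sup>2)"
    using assms(2) by (intro add_mono mult_left_mono l1 l2) auto
  also have "\<dots> = real (2 * k) * ln (cosh u) + 2 * u\<^sup>2 * \<eta> * real k" by simp
  finally have "?X ^ j \<le> exp (real (2 * k) * ln (cosh u)) * exp (2 * u\<^sup>2 * \<eta> * real k)"
    by (simp add: exp_add[symmetric])
  also have "exp (real (2 * k) * ln (cosh u)) = (cosh u ^ k)\<^sup>2"
    unfolding exp_of_nat_mult by (simp add: cosh_real_pos power_mult[symmetric] mult.commute)
  finally show ?thesis .
qed

text \<open>Compare the exponential sums \<open>A w = (\<Sum>i\<in>S. exp (u * ip (a i) w))\<close> for the exponents \<open>u\<close> and \<open>v\<close>: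
  if every inner product is at most \<open>2 * s\<close> then the first is at most \<open>exp (2 * (u - v) * s)\<close>
  times the second. For suitable \<open>s\<close> this factor times the mean of the second is far below the mean
  of the first, so the first must be far below its mean, which Chebyshev's inequality excludes.\<close>
lemma card_all_far_le:
  assumes S: "finite S" "S \<noteq> {}" and a: "\<And>i. i \<in> S \<Longrightarrow> length (a i) = k"
    and spread: "\<And>i j. i \<in> S \<Longrightarrow> j \<in> S \<Longrightarrow> i \<noteq> j \<Longrightarrow> (1/2 - \<eta>) * real k \<le> real (hamming (a i) (a j))"
    and \<eta>: "0 \<le> \<eta>" and uv: "v \<le> u" and u2: "u\<^sup>2 \<le> 2"
  shows "real (card {w \<in> cube k. \<forall>i\<in>S. ip (a i) w \<le> 2 * s}) \<le> 2 ^ k *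
    (4 * exp (real k * u\<^sup>2) / real (card S) + 4 * (exp (2 * u\<^sup>2 * \<eta> * real k) - 1)
     + 2 * exp (2 * (u - v) * s + real k * v\<^sup>2 / 2 - real k * (u\<^sup>2 / 2 - u ^ 4 / 4)))"
    (is "real (card ?G) \<le> _")
proof -
  define m where "m = real (card S)"
  have m: "0 < m" using S by (simp add: m_def card_gt_0_iff)
  define C where "C = cosh u ^ k"
  have C: "0 < C" by (simp add: C_def cosh_real_pos)
  define e where "e = exp (2 * u\<^sup>2 * \<eta> * real k)"
  define A where "A x w = (\<Sum>i\<in>S. exp (x * ip (a i) w))" for x w
  have sumA: "(\<Sum>w\<in>cube k. A x w) = 2 ^ k * (m * cosh x ^ k)" for x
  proof -
    have "(\<Sum>w\<in>cube k. A x w) = (\<Sum>i\<in>S. \<Sum>w\<in>cube k. exp (x * ip (a i) w))"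
      unfolding A_def by (rule sum.swap)
    also have "\<dots> = (\<Sum>i\<in>S. (2 * cosh x) ^ k)"
      using a by (intro sum.cong sum_cube_ip) auto
    finally show ?thesis by (simp add: m_def power_mult_distrib)
  qed
  have sumA2: "(\<Sum>w\<in>cube k. (A u w)\<^sup>2) \<le> 2 ^ k * (m * C ^ 4 + m\<^sup>2 * (C\<^sup>2 * e))"
  proof -
    have "(\<Sum>w\<in>cube k. (A u w)\<^sup>2) = (\<Sum>w\<in>cube k. \<Sum>i\<in>S. \<Sum>j\<in>S. exp (u * (ip (a i) w + ip (a j) w)))"
      by (simp add: A_def power2_eq_square sum_product exp_add distrib_left)
    also have "\<dots> = (\<Sum>i\<in>S. \<Sum>w\<in>cube k. \<Sum>j\<in>S. exp (u * (ip (a i) w + ip (a j) w)))"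
      by (rule sum.swap)
    also have "\<dots> = (\<Sum>i\<in>S. \<Sum>j\<in>S. \<Sum>w\<in>cube k. exp (u * (ip (a i) w + ip (a j) w)))"
      by (intro sum.cong refl sum.swap)
    \<comment> \<open>The off-diagonal terms are close to the squared mean \<open>C^2\<close>. The
      variance is thus small against \<open>m^2 * C^2\<close> as soon as \<open>C^2\<close> is small
      against \<open>m\<close>.\<close>
    also have "\<dots> \<le> (\<Sum>i\<in>S. \<Sum>j\<in>S. 2 ^ k * (of_bool (i = j) * C ^ 4 + C\<^sup>2 * e))"
    proof (intro sum_mono)
      fix i j assume ij: "i \<in> S" "j \<in> S"
      have "(\<Sum>w\<in>cube k. exp (u * (ip (a i) w + ip (a j) w))) = 2 ^ k * cosh (2 * u) ^ (k - hamming (a i) (a j))"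
        using ij a by (intro sum_cube_ip2) auto
      also have "cosh (2 * u) ^ (k - hamming (a i) (a j)) \<le> of_bool (i = j) * C ^ 4 + C\<^sup>2 * e"
      proof (cases "i = j")
        case True
        have "cosh (2 * u) ^ k \<le> (cosh u ^ 4) ^ k"
          by (intro power_mono cosh_double_le) (simp add: cosh_real_nonneg)
        also have "\<dots> = C ^ 4" by (simp add: C_def power_mult[symmetric] mult.commute)
        finally show ?thesis using True C by (simp add: hamming_def e_def add_increasing2)
      next
        case False
        have "hamming (a i) (a j) \<le> k" using hamming_le[of "a i" "a j"] a ij by simp
        then have "real (k - hamming (a i) (a j)) \<le> (1/2 + \<eta>) * real k"
          using spread[OF ij False] by (simp add: of_nat_diff algebra_simps)
        then show ?thesis using cosh_power_half_le[of _ \<eta> k u] \<eta> False by (simp add: C_def e_def)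
      qed
      finally show "(\<Sum>w\<in>cube k. exp (u * (ip (a i) w + ip (a j) w))) \<le> 2 ^ k * (of_bool (i = j) * C ^ 4 + C\<^sup>2 * e)"
        by simp
    qed
    also have "\<dots> = 2 ^ k * (m * C ^ 4 + m\<^sup>2 * (C\<^sup>2 * e))"
      using S by (simp add: sum_distrib_left[symmetric] sum.distrib sum_distrib_right[symmetric]
          m_def power2_eq_square sum_of_bool_eq algebra_simps)
    finally show ?thesis .
  qed
  \<comment> \<open>On \<open>G1\<close> the sum falls below half its mean, which Chebyshev's
    inequality bounds. On \<open>G2\<close> it does not, and Markov's inequality for the exponent
    \<open>v\<close> applies.\<close>
  define G1 where "G1 = {w \<in> cube k. A u w \<le> m * C / 2}"
  define G2 where "G2 = {w \<in> cube k. (\<forall>i\<in>S. ip (a i) w \<le> 2 * s) \<and> m * C / 2 < A u w}"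
  have "real (card G1) * (m * C / 2)\<^sup>2 = (\<Sum>w\<in>G1. (m * C / 2)\<^sup>2)" by simp
  also have "\<dots> \<le> (\<Sum>w\<in>G1. (A u w - m * C)\<^sup>2)"
  proof (rule sum_mono)
    fix w assume "w \<in> G1"
    then have "A u w \<le> m * C / 2" by (simp only: G1_def mem_Collect_eq)
    then have "m * C / 2 \<le> m * C - A u w" by linarith
    then have "(m * C / 2)\<^sup>2 \<le> (m * C - A u w)\<^sup>2" using m C by (intro power_mono) auto
    then show "(m * C / 2)\<^sup>2 \<le> (A u w - m * C)\<^sup>2" by (simp add: power2_commute)
  qed
  also have "\<dots> \<le> (\<Sum>w\<in>cube k. (A u w - m * C)\<^sup>2)"
    by (rule sum_mono2) (auto simp: G1_def)
  also have "\<dots> = (\<Sum>w\<in>cube k. (A u w)\<^sup>2) - 2 * (m * C) * (\<Sum>w\<in>cube k. A u w) + 2 ^ k * (m * C)\<^sup>2"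
    by (simp add: power2_diff sum.distrib sum_subtractf sum_distrib_left algebra_simps)
  also have "\<dots> \<le> 2 ^ k * (m * C ^ 4 + m\<^sup>2 * C\<^sup>2 * (e - 1))"
    using sumA2 by (simp add: sumA C_def[symmetric] power_mult_distrib power2_eq_square algebra_simps)
  also have "\<dots> = 2 ^ k * (4 * C\<^sup>2 / m + 4 * (e - 1)) * (m * C / 2)\<^sup>2"
    using m by (simp add: power2_eq_square power4_eq_xxxx field_simps)
  finally have "real (card G1) \<le> 2 ^ k * (4 * C\<^sup>2 / m + 4 * (e - 1))"
    using m C by (subst (asm) mult_le_cancel_right_pos) auto
  also have "\<dots> \<le> 2 ^ k * (4 * exp (real k * u\<^sup>2) / m + 4 * (e - 1))"
  proof -
    have "C\<^sup>2 \<le> (exp (u\<^sup>2 / 2) ^ k)\<^sup>2"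
      unfolding C_def by (intro power_mono cosh_le_exp) (auto simp: cosh_real_nonneg)
    also have "\<dots> = exp (real k * u\<^sup>2)"
      by (simp add: exp_of_nat_mult[symmetric] power2_eq_square exp_add[symmetric])
    finally show ?thesis using m by (simp add: divide_right_mono)
  qed
  finally have G1: "real (card G1) \<le> 2 ^ k * (4 * exp (real k * u\<^sup>2) / m + 4 * (e - 1))" .
  have "real (card G2) * (m * C / 2) = (\<Sum>w\<in>G2. m * C / 2)" by simp
  also have "\<dots> \<le> (\<Sum>w\<in>G2. exp (2 * (u - v) * s) * A v w)"
  proof (rule sum_mono)
    fix w assume w: "w \<in> G2"
    have "m * C / 2 \<le> A u w" using w by (simp add: G2_def)
    also have "\<dots> \<le> (\<Sum>i\<in>S. exp (2 * (u - v) * s) * exp (v * ip (a i) w))"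
      unfolding A_def
    proof (rule sum_mono)
      fix i assume "i \<in> S"
      then have "(u - v) * ip (a i) w \<le> (u - v) * (2 * s)"
        using w uv by (intro mult_left_mono) (auto simp: G2_def)
      then show "exp (u * ip (a i) w) \<le> exp (2 * (u - v) * s) * exp (v * ip (a i) w)"
        by (simp add: exp_add[symmetric] algebra_simps)
    qed
    finally show "m * C / 2 \<le> exp (2 * (u - v) * s) * A v w"
      by (simp add: A_def sum_distrib_left)
  qed
  also have "\<dots> \<le> (\<Sum>w\<in>cube k. exp (2 * (u - v) * s) * A v w)"
    by (rule sum_mono2) (auto simp: G2_def A_def intro!: sum_nonneg mult_nonneg_nonneg)
  also have "\<dots> = exp (2 * (u - v) * s) * (2 ^ k * (m * cosh v ^ k))"
    by (simp add: sum_distrib_left[symmetric] sumA)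
  also have "\<dots> \<le> exp (2 * (u - v) * s) * (2 ^ k * (m * exp (real k * v\<^sup>2 / 2)))"
  proof -
    have "cosh v ^ k \<le> exp (v\<^sup>2 / 2) ^ k"
      by (intro power_mono cosh_le_exp) (simp add: cosh_real_nonneg)
    then show ?thesis using m by (simp add: exp_of_nat_mult[symmetric])
  qed
  also have "\<dots> \<le> 2 ^ k * (2 * exp (2 * (u - v) * s + real k * v\<^sup>2 / 2 - real k * (u\<^sup>2 / 2 - u ^ 4 / 4))) * (m * C / 2)"
  proof -
    have "exp (real k * (u\<^sup>2 / 2 - u ^ 4 / 4)) \<le> C"
      unfolding C_def exp_of_nat_mult by (intro power_mono cosh_ge_exp u2) auto
    then have "exp (2 * (u - v) * s) * exp (real k * v\<^sup>2 / 2) * exp (real k * (u\<^sup>2 / 2 - u ^ 4 / 4)) / exp (real k * (u\<^sup>2 / 2 - u ^ 4 / 4))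
       \<le> exp (2 * (u - v) * s) * exp (real k * v\<^sup>2 / 2) * C / exp (real k * (u\<^sup>2 / 2 - u ^ 4 / 4))"
      by (intro divide_right_mono mult_left_mono) auto
    then have "exp (2 * (u - v) * s) * exp (real k * v\<^sup>2 / 2)
        \<le> exp (2 * (u - v) * s + real k * v\<^sup>2 / 2 - real k * (u\<^sup>2 / 2 - u ^ 4 / 4)) * C"
      by (simp add: exp_add exp_diff)
    then have "(2 ^ k * m) * (exp (2 * (u - v) * s) * exp (real k * v\<^sup>2 / 2))
        \<le> (2 ^ k * m) * (exp (2 * (u - v) * s + real k * v\<^sup>2 / 2 - real k * (u\<^sup>2 / 2 - u ^ 4 / 4)) * C)"
      using m by (intro mult_left_mono) auto
    then show ?thesis by (simp add: algebra_simps)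
  qed
  finally have G2: "real (card G2) \<le> 2 ^ k * (2 * exp (2 * (u - v) * s + real k * v\<^sup>2 / 2 - real k * (u\<^sup>2 / 2 - u ^ 4 / 4)))"
    using m C by (subst (asm) mult_le_cancel_right_pos) auto
  have "?G \<subseteq> G1 \<union> G2" by (auto simp: G1_def G2_def)
  then have "card ?G \<le> card (G1 \<union> G2)" by (intro card_mono) (auto simp: G1_def G2_def)
  also have "\<dots> \<le> card G1 + card G2" by (rule card_Un_le)
  finally have "real (card ?G) \<le> real (card G1) + real (card G2)" by linarith
  then show ?thesis using G1 G2 by (simp add: m_def e_def algebra_simps)
qed

section \<open>Uniform random profiles\<close>

text \<open>Uniform probability by counting; \<open>prob_configs_le\<close> carries the estimates
  over to the probability measure.\<close>

definition proportion :: "'a set \<Rightarrow> ('a \<Rightarrow> bool) \<Rightarrow> real" where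
  "proportion A P = real (card {x \<in> A. P x}) / real (card A)"

lemma proportion_mono:
  assumes "finite A" "\<And>x. x \<in> A \<Longrightarrow> P x \<Longrightarrow> Q x"
  shows "proportion A P \<le> proportion A Q"
  unfolding proportion_def using assms by (intro divide_right_mono) (auto intro!: card_mono)

lemma proportion_disj:
  assumes "finite A"
  shows "proportion A (\<lambda>x. P x \<or> Q x) \<le> proportion A P + proportion A Q"
proof -
  have "{x \<in> A. P x \<or> Q x} = {x \<in> A. P x} \<union> {x \<in> A. Q x}" by auto
  then have "card {x \<in> A. P x \<or> Q x} \<le> card {x \<in> A. P x} + card {x \<in> A. Q x}"
    by (simp add: card_Un_le)
  then have "real (card {x \<in> A. P x \<or> Q x}) \<le> real (card {x \<in> A. P x}) + real (card {x \<in> A. Q x})"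
    by linarith
  then show ?thesis unfolding proportion_def by (simp add: divide_right_mono add_divide_distrib[symmetric])
qed

lemma sum_proportion:
  assumes "finite A" "finite I"
  shows "(\<Sum>i\<in>I. proportion A (P i)) = (\<Sum>x\<in>A. real (card {i \<in> I. P i x})) / real (card A)"
proof -
  have "(\<Sum>i\<in>I. real (card {x \<in> A. P i x})) = (\<Sum>i\<in>I. \<Sum>x\<in>A. of_bool (P i x))"
    using assms by (simp add: sum_of_bool_eq Collect_conj_eq)
  also have "\<dots> = (\<Sum>x\<in>A. \<Sum>i\<in>I. of_bool (P i x))" by (rule sum.swap)
  also have "\<dots> = (\<Sum>x\<in>A. real (card {i \<in> I. P i x}))"
    using assms by (simp add: sum_of_bool_eq Collect_conj_eq)
  finally show ?thesis by (simp add: proportion_def sum_divide_distrib[symmetric])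
qed

lemma proportion_markov:
  assumes "finite A" "finite I" "0 < c"
  shows "proportion A (\<lambda>x. c \<le> real (card {i \<in> I. P i x})) \<le> (\<Sum>i\<in>I. proportion A (P i)) / c"
proof -
  let ?B = "{x \<in> A. c \<le> real (card {i \<in> I. P i x})}"
  have "c * real (card ?B) = (\<Sum>x\<in>?B. c)" by simp
  also have "\<dots> \<le> (\<Sum>x\<in>?B. real (card {i \<in> I. P i x}))" by (rule sum_mono) auto
  also have "\<dots> \<le> (\<Sum>x\<in>A. real (card {i \<in> I. P i x}))" using assms by (intro sum_mono2) auto
  finally have "real (card ?B) \<le> (\<Sum>x\<in>A. real (card {i \<in> I. P i x})) / c"
    using assms by (simp add: field_simps)
  then have "proportion A (\<lambda>x. c \<le> real (card {i \<in> I. P i x})) \<le>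
      (\<Sum>x\<in>A. real (card {i \<in> I. P i x})) / c / real (card A)"
    unfolding proportion_def by (rule divide_right_mono) simp
  then show ?thesis
    unfolding sum_proportion[OF assms(1,2)] by (simp add: mult.commute)
qed

lemma proportion_bex:
  assumes "finite A" "finite I"
  shows "proportion A (\<lambda>x. \<exists>i\<in>I. P i x) \<le> (\<Sum>i\<in>I. proportion A (P i))"
proof -
  have "proportion A (\<lambda>x. \<exists>i\<in>I. P i x) \<le> proportion A (\<lambda>x. 1 \<le> real (card {i \<in> I. P i x}))"
  proof (rule proportion_mono[OF assms(1)])
    fix x assume "\<exists>i\<in>I. P i x"
    then have "{i \<in> I. P i x} \<noteq> {}" by auto
    then have "0 < card {i \<in> I. P i x}" using assms by (simp add: card_gt_0_iff)
    then show "1 \<le> real (card {i \<in> I. P i x})" by simp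
  qed
  also have "\<dots> \<le> (\<Sum>i\<in>I. proportion A (P i)) / 1" by (rule proportion_markov) (use assms in auto)
  finally show ?thesis by simp
qed

lemma profiles_basic: "finite (profiles n k)" "card (profiles n k) = 2 ^ (k * n)" "profiles n k \<noteq> {}"
proof -
  show "finite (profiles n k)" by (auto simp: profiles_def intro!: finite_PiE)
  show *: "card (profiles n k) = 2 ^ (k * n)" by (simp add: profiles_def card_PiE power_mult)
  show "profiles n k \<noteq> {}" using * by auto
qed

section \<open>Resampling one profile\<close>

lemma sum_profiles_resample:
  fixes f :: "(nat \<Rightarrow> bool list) \<Rightarrow> real"
  assumes "i < n"
  shows "(\<Sum>am\<in>profiles n k. \<Sum>v\<in>cube k. f (am(i := v))) = 2 ^ k * (\<Sum>am\<in>profiles n k. f am)"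
proof -
  let ?R = "PiE ({..<n} - {i}) (\<lambda>_. cube k)"
  have ins: "{..<n} = insert i ({..<n} - {i})" using assms by auto
  have prof: "profiles n k = (\<lambda>(y, g). g(i := y)) ` (cube k \<times> ?R)"
    unfolding profiles_def by (subst ins, subst PiE_insert_eq) simp
  have inj: "inj_on (\<lambda>(y, g). g(i := y)) (cube k \<times> ?R)"
    by (rule inj_combinator) simp
  have sum: "(\<Sum>am\<in>profiles n k. F am) = (\<Sum>y\<in>cube k. \<Sum>g\<in>?R. F (g(i := y)))" for F :: "(nat \<Rightarrow> bool list) \<Rightarrow> real"
    unfolding prof by (subst sum.reindex[OF inj]) (simp add: sum.cartesian_product case_prod_unfold)
  have "(\<Sum>am\<in>profiles n k. \<Sum>v\<in>cube k. f (am(i := v))) = (\<Sum>y\<in>cube k. \<Sum>g\<in>?R. \<Sum>v\<in>cube k. f (g(i := v)))"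
    by (simp add: sum)
  also have "\<dots> = 2 ^ k * (\<Sum>g\<in>?R. \<Sum>v\<in>cube k. f (g(i := v)))" by simp
  also have "(\<Sum>g\<in>?R. \<Sum>v\<in>cube k. f (g(i := v))) = (\<Sum>am\<in>profiles n k. f am)"
    unfolding sum by (rule sum.swap)
  finally show ?thesis .
qed

abbreviation "profile_pairs n k \<equiv> profiles n k \<times> profiles n k"

text \<open>Conditions on all profiles except that of \<open>i\<close>. Independence of one profile
  from all the others is used in this form.\<close>

lemma proportion_resample:
  assumes i: "i < n"
    and le: "\<And>am aw. am \<in> profiles n k \<Longrightarrow> aw \<in> profiles n k \<Longrightarrow>
      real (card {v \<in> cube k. E (am(i := v)) aw}) \<le> 2 ^ k * b"
  shows "proportion (profile_pairs n k) (\<lambda>(am, aw). E am aw) \<le> b"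
proof -
  let ?P = "profiles n k"
  have resample: "(\<Sum>am\<in>?P. \<Sum>v\<in>cube k. of_bool (E (am(i := v)) aw)) = 2 ^ k * (\<Sum>am\<in>?P. of_bool (E am aw) :: real)" for aw
    by (rule sum_profiles_resample[OF i])
  have "2 ^ k * real (card {x \<in> ?P \<times> ?P. (\<lambda>(am, aw). E am aw) x}) =
      2 ^ k * (\<Sum>(am,aw)\<in>?P \<times> ?P. of_bool (E am aw))"
    by (simp add: sum_of_bool_eq profiles_basic case_prod_unfold Collect_conj_eq)
  also have "\<dots> = 2 ^ k * (\<Sum>aw\<in>?P. \<Sum>am\<in>?P. of_bool (E am aw))"
    unfolding sum.cartesian_product[symmetric] by (subst sum.swap) simp
  also have "\<dots> = (\<Sum>aw\<in>?P. \<Sum>am\<in>?P. \<Sum>v\<in>cube k. of_bool (E (am(i := v)) aw))"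
    by (simp only: resample sum_distrib_left)
  also have "\<dots> \<le> (\<Sum>aw\<in>?P. \<Sum>am\<in>?P. 2 ^ k * b)"
    using le by (intro sum_mono) (simp add: sum_of_bool_eq Collect_conj_eq)
  also have "\<dots> = 2 ^ k * (b * real (card (?P \<times> ?P)))" by (simp add: card_cartesian_product)
  finally have "real (card {x \<in> ?P \<times> ?P. (\<lambda>(am, aw). E am aw) x}) \<le> b * real (card (?P \<times> ?P))"
    by (simp only: mult_le_cancel_left_pos zero_less_power zero_less_numeral)
  moreover have "0 < real (card (?P \<times> ?P))" by (simp add: card_cartesian_product profiles_basic)
  ultimately show ?thesis unfolding proportion_def by (simp only: pos_divide_le_eq)
qed

lemma proportion_profile_pairs_swap:
  "proportion (profile_pairs n k) (\<lambda>(am, aw). E am aw) = proportion (profile_pairs n k) (\<lambda>(am, aw). E aw am)"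
proof -
  have "card {x \<in> profile_pairs n k. (\<lambda>(am, aw). E am aw) x} = card {x \<in> profile_pairs n k. (\<lambda>(am, aw). E aw am) x}"
    by (rule bij_betw_same_card[of prod.swap]) (auto simp: bij_betw_def inj_on_def image_iff)
  then show ?thesis by (simp only: proportion_def)
qed

definition distances :: "(nat \<Rightarrow> bool list) \<Rightarrow> (nat \<Rightarrow> bool list) \<Rightarrow> nat \<Rightarrow> nat \<Rightarrow> nat" where
  "distances am aw i j = hamming (am i) (aw j)"

lemma distances_swap:
  assumes "am \<in> profiles n k" "aw \<in> profiles n k" "i < n" "j < n"
  shows "distances aw am j i = distances am aw i j"
  using assms by (auto simp: distances_def intro!: hamming_commute simp: profile_length)

section \<open>Nearly orthogonal profiles and the absence of far blocks\<close>

definition spread :: "nat \<Rightarrow> nat \<Rightarrow> real \<Rightarrow> (nat \<Rightarrow> bool list) \<Rightarrow> bool" where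
  "spread n k \<eta> a \<longleftrightarrow> (\<forall>i<n. \<forall>j<n. i \<noteq> j \<longrightarrow> (1/2 - \<eta>) * real k \<le> real (hamming (a i) (a j)))"

lemma proportion_not_spread_le:
  assumes "0 \<le> \<eta>"
  shows "proportion (profile_pairs n k) (\<lambda>(am, aw). \<not> spread n k \<eta> am) \<le> real n ^ 2 * exp (- 2 * \<eta>\<^sup>2 * real k)"
proof -
  let ?I = "{(i,j). i < n \<and> j < n \<and> i \<noteq> j}"
  let ?E = "\<lambda>ij (x :: (nat \<Rightarrow> bool list) \<times> (nat \<Rightarrow> bool list)).
    case ij of (i,j) \<Rightarrow> (case x of (am,aw) \<Rightarrow> real (hamming (am i) (am j)) < (1/2 - \<eta>) * real k)"
  have fin: "finite ?I" by (rule finite_subset[of _ "{..<n} \<times> {..<n}"]) auto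
  have "proportion (profile_pairs n k) (\<lambda>(am, aw). \<not> spread n k \<eta> am) \<le>
      proportion (profile_pairs n k) (\<lambda>x. \<exists>ij\<in>?I. ?E ij x)"
    by (rule proportion_mono) (auto simp: profiles_basic spread_def not_le)
  also have "\<dots> \<le> (\<Sum>ij\<in>?I. proportion (profile_pairs n k) (?E ij))"
    by (rule proportion_bex) (auto simp: profiles_basic fin)
  also have "\<dots> \<le> (\<Sum>ij\<in>?I. exp (- 2 * \<eta>\<^sup>2 * real k))"
  proof (rule sum_mono)
    fix ij assume "ij \<in> ?I"
    then obtain i j where ij: "ij = (i,j)" "i < n" "j < n" "i \<noteq> j" by blast
    have "proportion (profile_pairs n k) (\<lambda>(am,aw). real (hamming (am i) (am j)) < (1/2 - \<eta>) * real k) \<le> exp (- 2 * \<eta>\<^sup>2 * real k)"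
    proof (rule proportion_resample[OF ij(2)])
      fix am aw assume am: "am \<in> profiles n k"
      have "{v \<in> cube k. real (hamming ((am(i := v)) i) ((am(i := v)) j)) < (1/2 - \<eta>) * real k} =
          {v \<in> cube k. real (hamming (am j) v) < real k / 2 - \<eta> * real k}"
        using ij am by (auto simp: hamming_commute profile_length algebra_simps)
      moreover have "real (card {v \<in> cube k. real (hamming (am j) v) < real k / 2 - \<eta> * real k}) \<le>
          2 ^ k * exp (- 2 * (\<eta> * real k)\<^sup>2 / real k)"
        by (rule card_hamming_small_le) (use ij am assms in \<open>auto simp: profile_length\<close>)
      moreover have "- 2 * (\<eta> * real k)\<^sup>2 / real k = - 2 * \<eta>\<^sup>2 * real k"
        by (simp add: power2_eq_square)
      ultimately show "real (card {v \<in> cube k. real (hamming ((am(i := v)) i) ((am(i := v)) j)) < (1/2 - \<eta>) * real k})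
         \<le> 2 ^ k * exp (- 2 * \<eta>\<^sup>2 * real k)" by metis
    qed
    then show "proportion (profile_pairs n k) (?E ij) \<le> exp (- 2 * \<eta>\<^sup>2 * real k)" by (simp add: ij)
  qed
  also have "\<dots> \<le> real n ^ 2 * exp (- 2 * \<eta>\<^sup>2 * real k)"
  proof -
    have "card ?I \<le> card ({..<n} \<times> {..<n})" by (rule card_mono) auto
    then have "real (card ?I) \<le> real (n * n)" unfolding of_nat_le_iff by simp
    then show ?thesis by (simp add: power2_eq_square)
  qed
  finally show ?thesis .
qed

text \<open>Translates between the integral cutoff and the real bound \<open>k/2 - s\<close>. If
  \<open>x\<close> is negative, both sides are false.\<close>

lemma less_nat_ceiling_iff: "h < nat \<lceil>x\<rceil> \<longleftrightarrow> real h < x"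
  by (simp add: nat_less_iff zless_nat_eq_int_zless less_ceiling_iff)

lemma proportion_far_block_le:
  assumes \<eta>: "0 \<le> \<eta>" and uv: "v \<le> u" "u\<^sup>2 \<le> 2" and m: "0 < m" and K: "K = nat \<lceil>real k / 2 - s\<rceil>"
    and q: "q = 4 * exp (real k * u\<^sup>2) / real m + 4 * (exp (2 * u\<^sup>2 * \<eta> * real k) - 1)
     + 2 * exp (2 * (u - v) * s + real k * v\<^sup>2 / 2 - real k * (u\<^sup>2 / 2 - u ^ 4 / 4))"
  shows "proportion (profile_pairs n k) (\<lambda>(am, aw). spread n k \<eta> am \<and> far_block n (distances am aw) K m) \<le> 4 ^ n * q ^ m"
proof -
  let ?I = "{S. S \<subseteq> {..<n} \<and> card S = m}"
  let ?P = "profiles n k"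
  have fin: "finite ?I" by simp
  let ?E = "\<lambda>ST (x :: (nat \<Rightarrow> bool list) \<times> (nat \<Rightarrow> bool list)).
    case ST of (S,T) \<Rightarrow> (case x of (am,aw) \<Rightarrow> spread n k \<eta> am \<and> (\<forall>i\<in>S. \<forall>j\<in>T. K \<le> distances am aw i j))"
  have "1 \<le> exp (2 * u\<^sup>2 * \<eta> * real k)" using \<eta> by simp
  then have q0: "0 \<le> q" unfolding q by (intro add_nonneg_nonneg) auto
  have "proportion (profile_pairs n k) (\<lambda>(am, aw). spread n k \<eta> am \<and> far_block n (distances am aw) K m) \<le>
      proportion (profile_pairs n k) (\<lambda>x. \<exists>ST\<in>?I \<times> ?I. ?E ST x)"
    by (rule proportion_mono) (auto simp: profiles_basic far_block_def)
  also have "\<dots> \<le> (\<Sum>ST\<in>?I \<times> ?I. proportion (profile_pairs n k) (?E ST))"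
    by (rule proportion_bex) (auto simp: profiles_basic fin)
  also have "\<dots> \<le> (\<Sum>ST\<in>?I \<times> ?I. q ^ m)"
  proof (rule sum_mono)
    fix ST assume "ST \<in> ?I \<times> ?I"
    then obtain S T where ST: "ST = (S,T)" "S \<subseteq> {..<n}" "card S = m" "T \<subseteq> {..<n}" "card T = m" by blast
    have one: "real (card {aw \<in> ?P. ?E ST (am,aw)}) \<le> real (card ?P) * q ^ m" if am: "am \<in> ?P" for am
    proof (cases "spread n k \<eta> am")
      case False
      then show ?thesis using q0 by (simp add: ST)
    next
      case True
      define G where "G = {w \<in> cube k. \<forall>i\<in>S. ip (am i) w \<le> 2 * s}"
      have finS: "finite S" using ST finite_subset by blast
      have G: "real (card G) \<le> 2 ^ k * q"
        unfolding G_def q ST(3)[symmetric]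
      proof (rule card_all_far_le[OF finS])
        show "S \<noteq> {}" using ST m by auto
        show "length (am i) = k" if "i \<in> S" for i using that ST am profile_length by blast
        show "(1/2 - \<eta>) * real k \<le> real (hamming (am i) (am j))" if "i \<in> S" "j \<in> S" "i \<noteq> j" for i j
          using True that ST unfolding spread_def by blast
      qed (use assms in auto)
      \<comment> \<open>With the men fixed, the condition restricts each woman of \<open>T\<close>
        separately to \<open>G\<close>, so the count is a product over the women.\<close>
      have "{aw \<in> ?P. ?E ST (am,aw)} \<subseteq> PiE {..<n} (\<lambda>j. if j \<in> T then G else cube k)"
      proof
        fix aw assume aw: "aw \<in> {aw \<in> ?P. ?E ST (am,aw)}"
        have "aw j \<in> G" if "j \<in> T" for j
        proof -
          have "j < n" using that ST by auto
          have "ip (am i) (aw j) \<le> 2 * s" if "i \<in> S" for i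
          proof -
            have "\<not> hamming (am i) (aw j) < K" using aw that \<open>j \<in> T\<close> by (auto simp: ST distances_def not_less)
            then have "real k / 2 - s \<le> real (hamming (am i) (aw j))"
              unfolding K less_nat_ceiling_iff by simp
            moreover have "length (am i) = k" using am that ST profile_length by blast
            ultimately show ?thesis by (simp add: ip_def)
          qed
          then show ?thesis using aw \<open>j < n\<close> by (auto simp: G_def profile_length)
        qed
        then show "aw \<in> PiE {..<n} (\<lambda>j. if j \<in> T then G else cube k)"
          using aw by (auto simp: profiles_def PiE_iff)
      qed
      then have "card {aw \<in> ?P. ?E ST (am,aw)} \<le> card (PiE {..<n} (\<lambda>j. if j \<in> T then G else cube k))"
        by (intro card_mono finite_PiE) (auto simp: G_def)
      also have "\<dots> = (\<Prod>j<n. card (if j \<in> T then G else cube k))" by (simp add: card_PiE)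
      finally have "real (card {aw \<in> ?P. ?E ST (am,aw)}) \<le> real (\<Prod>j<n. card (if j \<in> T then G else cube k))"
        by (simp only: of_nat_le_iff)
      also have "\<dots> = (\<Prod>j<n. real (card (if j \<in> T then G else cube k)))" by (rule of_nat_prod)
      also have "\<dots> \<le> (\<Prod>j<n. 2 ^ k * (if j \<in> T then q else 1))"
        using G by (intro prod_mono) auto
      also have "\<dots> = 2 ^ (k * n) * (\<Prod>j<n. if j \<in> T then q else 1)"
        by (simp add: prod.distrib power_mult)
      also have "(\<Prod>j<n. if j \<in> T then q else 1) = q ^ m"
        using ST by (subst prod.inter_restrict[symmetric]) (auto simp: Int_absorb1)
      finally show ?thesis by (simp add: profiles_basic)
    qed
    have "real (card {x \<in> ?P \<times> ?P. ?E ST x}) = (\<Sum>am\<in>?P. real (card {aw \<in> ?P. ?E ST (am,aw)}))"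
    proof -
      have "{x \<in> ?P \<times> ?P. ?E ST x} = Sigma ?P (\<lambda>am. {aw \<in> ?P. ?E ST (am,aw)})" by auto
      then show ?thesis by (simp add: profiles_basic)
    qed
    also have "\<dots> \<le> (\<Sum>am\<in>?P. real (card ?P) * q ^ m)" by (intro sum_mono one)
    also have "\<dots> = q ^ m * real (card (?P \<times> ?P))" by (simp add: card_cartesian_product)
    finally have "real (card {x \<in> ?P \<times> ?P. ?E ST x}) \<le> q ^ m * real (card (?P \<times> ?P))" .
    moreover have "0 < real (card (?P \<times> ?P))" by (simp add: card_cartesian_product profiles_basic)
    ultimately show "proportion (profile_pairs n k) (?E ST) \<le> q ^ m"
      unfolding proportion_def by (simp only: pos_divide_le_eq)
  qed
  also have "\<dots> = real (card ?I * card ?I) * q ^ m" by (simp add: card_cartesian_product)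
  also have "\<dots> \<le> 4 ^ n * q ^ m"
  proof (rule mult_right_mono)
    have "?I \<subseteq> Pow {..<n}" by auto
    then have "card ?I \<le> card (Pow {..<n})" by (intro card_mono) auto
    then have "card ?I \<le> 2 ^ n" by (simp add: card_Pow)
    then have "card ?I * card ?I \<le> 2 ^ n * 2 ^ n" by (intro mult_mono) auto
    also have "\<dots> = (4 :: nat) ^ n" by (simp add: power_mult_distrib[symmetric])
    finally have "real (card ?I * card ?I) \<le> real (4 ^ n)" by (simp only: of_nat_le_iff)
    then show "real (card ?I * card ?I) \<le> 4 ^ n" by simp
  qed (use q0 in auto)
  finally show ?thesis .
qed

section \<open>Ties below the cutoff and ties between leftovers\<close>

lemma level_stable_cong:
  assumes "\<And>a b. a \<in> A \<Longrightarrow> b \<in> B \<Longrightarrow> d a b = d' a b" and p: "level_stable A B d K p"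
  shows "level_stable A B d' K p"
proof -
  have e: "d a b = d' a b" if "(a, b) \<in> p" for a b
    using that level_stableD(1)[OF p] assms(1) by blast
  have "(\<exists>b'. (a, b') \<in> p \<and> d' a b' \<le> d' a b) \<or> (\<exists>a'. (a', b) \<in> p \<and> d' a' b \<le> d' a b)"
    if ab: "a \<in> A" "b \<in> B" "d' a b < K" for a b
  proof -
    have "d a b = d' a b" using ab assms(1) by simp
    then show ?thesis using level_stableD(5)[OF p, of a b] ab e by (metis (no_types))
  qed
  moreover have "d' a b < K" if "(a, b) \<in> p" for a b
    using level_stableD(4)[OF p that] e[OF that] by simp
  ultimately show ?thesis
    unfolding level_stable_def
    using level_stableD(1)[OF p] level_stableD(2)[OF p] level_stableD(3)[OF p]
    by (intro conjI ballI allI impI) blast+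
qed

text \<open>Greedy matchings without \<open>x\<close> involve no distance from \<open>x\<close>.
  Hence the leftovers stay fixed while the profile of \<open>x\<close> is resampled.\<close>

lemma leftover_cong:
  assumes "\<And>a b. a < n \<Longrightarrow> a \<noteq> x \<Longrightarrow> b < n \<Longrightarrow> d a b = d' a b"
  shows "leftover n d K x = leftover n d' K x"
proof -
  have "level_stable ({..<n} - {x}) {..<n} d K p \<longleftrightarrow> level_stable ({..<n} - {x}) {..<n} d' K p" for p
    using level_stable_cong[of "{..<n} - {x}" "{..<n}" d d' K p]
      level_stable_cong[of "{..<n} - {x}" "{..<n}" d' d K p] assms by fastforce
  then show ?thesis by (simp add: leftover_def)
qed

lemma untied_cong:
  assumes "\<And>a b. a < n \<Longrightarrow> b < n \<Longrightarrow> d a b = d' a b"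
  shows "untied n d K = untied n d' K"
  using assms unfolding untied_def by (intro iff_allI imp_cong refl) auto

lemma untied_leftover_cong:
  assumes "\<And>a b. a < n \<Longrightarrow> b < n \<Longrightarrow> d a b = d' a b"
  shows "untied_leftover n d K = untied_leftover n d' K"
proof -
  have "leftover n d K x = leftover n d' K x" for x
    using assms by (intro leftover_cong) auto
  moreover have "d x y = d' x y" if "x < n" "y \<in> leftover n d' K x" for x y
    using that assms by (auto simp: leftover_def)
  ultimately show ?thesis unfolding untied_leftover_def by simp
qed

lemma far_block_cong:
  assumes "\<And>a b. a < n \<Longrightarrow> b < n \<Longrightarrow> d a b = d' a b" and far: "far_block n d K m"
  shows "far_block n d' K m"
proof -
  obtain S T where "S \<subseteq> {..<n}" "T \<subseteq> {..<n}" "card S = m" "card T = m" "\<And>x y. x \<in> S \<Longrightarrow> y \<in> T \<Longrightarrow> K \<le> d x y"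
    using far unfolding far_block_def by auto
  moreover have "K \<le> d' x y" if "x \<in> S" "y \<in> T" for x y
  proof -
    have "x < n" "y < n" using that calculation by auto
    then show ?thesis using assms(1) calculation(5)[OF that] by simp
  qed
  ultimately show ?thesis by (intro far_blockI[of S n T]) auto
qed

definition low_tied :: "nat \<Rightarrow> (nat \<Rightarrow> nat \<Rightarrow> nat) \<Rightarrow> nat \<Rightarrow> nat \<Rightarrow> bool" where
  "low_tied n d K x \<longleftrightarrow> (\<exists>y<n. \<exists>y'<n. y \<noteq> y' \<and> d x y < K \<and> d x y = d x y')"

lemma untied_iff_low_tied: "untied n d K \<longleftrightarrow> (\<forall>x<n. \<not> low_tied n d K x)"
  by (auto simp: untied_def low_tied_def)

lemma card_pairs_le:
  fixes U :: "nat set"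
  assumes "U \<subseteq> {..<n}" "card U \<le> m"
  shows "finite {(y, y'). y \<in> U \<and> y' \<in> U \<and> y \<noteq> y'}" "card {(y, y'). y \<in> U \<and> y' \<in> U \<and> y \<noteq> y'} \<le> m ^ 2"
proof -
  have "finite U" using finite_subset[OF assms(1)] by simp
  then have fin: "finite (U \<times> U)" by simp
  have sub: "{(y, y'). y \<in> U \<and> y' \<in> U \<and> y \<noteq> y'} \<subseteq> U \<times> U" by auto
  show "finite {(y, y'). y \<in> U \<and> y' \<in> U \<and> y \<noteq> y'}" using sub fin by (rule finite_subset)
  have "card {(y, y'). y \<in> U \<and> y' \<in> U \<and> y \<noteq> y'} \<le> card U * card U"
    using card_mono[OF fin sub] by (simp add: card_cartesian_product)
  also have "\<dots> \<le> m ^ 2" using assms(2) by (simp add: power2_eq_square mult_mono)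
  finally show "card {(y, y'). y \<in> U \<and> y' \<in> U \<and> y \<noteq> y'} \<le> m ^ 2" .
qed

lemma card_exists_pair_le:
  fixes b :: real and U :: "nat set"
  assumes "finite C" "U \<subseteq> {..<n}" "card U \<le> m" "0 \<le> b"
    and "\<And>y y'. y \<in> U \<Longrightarrow> y' \<in> U \<Longrightarrow> y \<noteq> y' \<Longrightarrow> real (card {v \<in> C. P y y' v}) \<le> b"
  shows "real (card {v \<in> C. \<exists>y\<in>U. \<exists>y'\<in>U. y \<noteq> y' \<and> P y y' v}) \<le> real m ^ 2 * b"
proof -
  let ?I = "{(y, y'). y \<in> U \<and> y' \<in> U \<and> y \<noteq> y'}"
  have "{v \<in> C. \<exists>y\<in>U. \<exists>y'\<in>U. y \<noteq> y' \<and> P y y' v} = (\<Union>(y,y')\<in>?I. {v \<in> C. P y y' v})" by auto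
  then have "real (card {v \<in> C. \<exists>y\<in>U. \<exists>y'\<in>U. y \<noteq> y' \<and> P y y' v}) \<le> real (\<Sum>(y,y')\<in>?I. card {v \<in> C. P y y' v})"
    using card_UN_le[OF card_pairs_le(1)[OF assms(2,3)], of "\<lambda>(y,y'). {v \<in> C. P y y' v}"]
    by (simp only: of_nat_le_iff case_prod_unfold)
  also have "\<dots> = (\<Sum>(y,y')\<in>?I. real (card {v \<in> C. P y y' v}))" by (simp add: case_prod_unfold)
  also have "\<dots> \<le> (\<Sum>(y,y')\<in>?I. b)" using assms(5) by (intro sum_mono) auto
  also have "\<dots> = real (card ?I) * b" by (simp add: case_prod_unfold)
  also have "\<dots> \<le> real (m ^ 2) * b"
    using card_pairs_le(2)[OF assms(2,3)] assms(4) by (intro mult_right_mono) (simp_all only: of_nat_le_iff)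
  finally show ?thesis by simp
qed

text \<open>With all but the profile of \<open>x\<close> fixed, \<open>card_ties_le\<close> is
  summed over the at most \<open>n^2\<close> pairs of candidates.\<close>

lemma proportion_low_tied_le:
  assumes x: "x < n" and k: "0 < k" and \<eta>: "\<eta> \<le> 1/4" and s: "0 \<le> s" and K: "K = nat \<lceil>real k / 2 - s\<rceil>"
  shows "proportion (profile_pairs n k) (\<lambda>(am, aw). spread n k \<eta> aw \<and> low_tied n (distances am aw) K x)
    \<le> real n ^ 2 * (2 / sqrt (real k) * exp (- 4 * s\<^sup>2 / real k * (1 - 2 * \<eta>)))" (is "_ \<le> real n ^ 2 * ?t")
proof (rule proportion_resample[OF x])
  fix am aw assume P: "am \<in> profiles n k" "aw \<in> profiles n k"
  let ?W = "{v \<in> cube k. spread n k \<eta> aw \<and> low_tied n (distances (am(x := v)) aw) K x}"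
  show "real (card ?W) \<le> 2 ^ k * (real n ^ 2 * ?t)"
  proof (cases "spread n k \<eta> aw")
    case False
    then show ?thesis by simp
  next
    case True
    let ?T = "\<lambda>y y' v. hamming (aw y) v = hamming (aw y') v \<and> real (hamming (aw y) v) < real k / 2 - s"
    have "?W \<subseteq> {v \<in> cube k. \<exists>y\<in>{..<n}. \<exists>y'\<in>{..<n}. y \<noteq> y' \<and> ?T y y' v}"
    proof
      fix v assume v: "v \<in> ?W"
      then obtain y y' where y: "y < n" "y' < n" "y \<noteq> y'" "hamming v (aw y) < K" "hamming v (aw y) = hamming v (aw y')"
        by (auto simp: low_tied_def distances_def)
      then have "?T y y' v" using v P(2) unfolding K less_nat_ceiling_iff
        by (simp add: hamming_commute[of v] profile_length)
      then show "v \<in> {v \<in> cube k. \<exists>y\<in>{..<n}. \<exists>y'\<in>{..<n}. y \<noteq> y' \<and> ?T y y' v}" using v y by auto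
    qed
    then have "card ?W \<le> card {v \<in> cube k. \<exists>y\<in>{..<n}. \<exists>y'\<in>{..<n}. y \<noteq> y' \<and> ?T y y' v}"
      by (intro card_mono) auto
    then have "real (card ?W) \<le> real (card {v \<in> cube k. \<exists>y\<in>{..<n}. \<exists>y'\<in>{..<n}. y \<noteq> y' \<and> ?T y y' v})"
      by (simp only: of_nat_le_iff)
    also have "\<dots> \<le> real n ^ 2 * (2 ^ k * ?t)"
    proof (rule card_exists_pair_le)
      fix y y' assume "y \<in> {..<n}" "y' \<in> {..<n}" "y \<noteq> y'"
      then show "real (card {v \<in> cube k. ?T y y' v}) \<le> 2 ^ k * ?t"
        using True P by (intro card_ties_le k \<eta> s) (auto simp: profile_length spread_def)
    qed auto
    finally show ?thesis by (simp add: mult.left_commute)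
  qed
qed

lemma proportion_not_untied_leftover_le:
  assumes k: "0 < k" and \<eta>: "\<eta> \<le> 1/4"
  shows "proportion (profile_pairs n k) (\<lambda>(am, aw). spread n k \<eta> aw \<and>
      (\<forall>x<n. card (leftover n (distances am aw) K x) \<le> m) \<and> \<not> untied_leftover n (distances am aw) K)
    \<le> real n * (real m ^ 2 * (2 / sqrt (real k)))" (is "proportion _ ?E \<le> _")
proof -
  \<comment> \<open>For each \<open>x\<close> only the size bound on its own leftovers is kept: it
    survives resampling the profile of \<open>x\<close>, whereas the bounds for other participants
    may not.\<close>
  let ?F = "\<lambda>x (am, aw). spread n k \<eta> aw \<and> card (leftover n (distances am aw) K x) \<le> m \<and>
      (\<exists>y\<in>leftover n (distances am aw) K x. \<exists>y'\<in>leftover n (distances am aw) K x. y \<noteq> y' \<and>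
        distances am aw x y = distances am aw x y')"
  have "proportion (profile_pairs n k) ?E \<le> proportion (profile_pairs n k) (\<lambda>p. \<exists>x\<in>{..<n}. ?F x p)"
  proof (rule proportion_mono)
    show "finite (profile_pairs n k)" by (simp add: profiles_basic)
    fix p assume "?E p"
    then show "\<exists>x\<in>{..<n}. ?F x p" unfolding untied_leftover_def by (cases p) auto
  qed
  also have "\<dots> \<le> (\<Sum>x<n. proportion (profile_pairs n k) (?F x))"
    by (rule proportion_bex) (auto simp: profiles_basic)
  also have "\<dots> \<le> (\<Sum>x<n. real m ^ 2 * (2 / sqrt (real k)))"
  proof (intro sum_mono proportion_resample)
    fix x am aw assume x: "x \<in> {..<n}" and P: "am \<in> profiles n k" "aw \<in> profiles n k"
    define U where "U = leftover n (distances am aw) K x"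
    have U: "leftover n (distances (am(x := v)) aw) K x = U" for v
      unfolding U_def by (rule leftover_cong) (simp add: distances_def)
    have sub: "U \<subseteq> {..<n}" by (auto simp: U_def leftover_def)
    let ?W = "{v \<in> cube k. spread n k \<eta> aw \<and> card (leftover n (distances (am(x := v)) aw) K x) \<le> m \<and>
      (\<exists>y\<in>leftover n (distances (am(x := v)) aw) K x. \<exists>y'\<in>leftover n (distances (am(x := v)) aw) K x. y \<noteq> y' \<and>
        distances (am(x := v)) aw x y = distances (am(x := v)) aw x y')}"
    show "real (card ?W) \<le> 2 ^ k * (real m ^ 2 * (2 / sqrt (real k)))"
    proof (cases "spread n k \<eta> aw \<and> card U \<le> m")
      case False
      then have "?W = {}" by (auto simp: U)
      then show ?thesis by (simp only:) simp
    next
      case True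
      let ?T = "\<lambda>y y' v. hamming (aw y) v = hamming (aw y') v"
      have "?W \<subseteq> {v \<in> cube k. \<exists>y\<in>U. \<exists>y'\<in>U. y \<noteq> y' \<and> ?T y y' v}"
      proof
        fix v assume v: "v \<in> ?W"
        then obtain y y' where y: "y \<in> U" "y' \<in> U" "y \<noteq> y'" "hamming v (aw y) = hamming v (aw y')"
          by (auto simp: distances_def U)
        moreover have "y < n" "y' < n" using y sub by auto
        ultimately have "?T y y' v" using v P(2)
          by (simp add: hamming_commute[of v] profile_length)
        then show "v \<in> {v \<in> cube k. \<exists>y\<in>U. \<exists>y'\<in>U. y \<noteq> y' \<and> ?T y y' v}" using v y by auto
      qed
      then have "card ?W \<le> card {v \<in> cube k. \<exists>y\<in>U. \<exists>y'\<in>U. y \<noteq> y' \<and> ?T y y' v}"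
        by (intro card_mono) auto
      then have "real (card ?W) \<le> real (card {v \<in> cube k. \<exists>y\<in>U. \<exists>y'\<in>U. y \<noteq> y' \<and> ?T y y' v})"
        by (simp only: of_nat_le_iff)
      also have "\<dots> \<le> real m ^ 2 * (2 ^ k * (2 / sqrt (real k)))"
      proof (rule card_exists_pair_le[OF _ sub])
        fix y y' assume "y \<in> U" "y' \<in> U" "y \<noteq> y'"
        then have y: "y < n" "y' < n" "y \<noteq> y'" using sub by auto
        then have "(1/2 - \<eta>) * real k \<le> real (hamming (aw y) (aw y'))"
          using True unfolding spread_def by blast
        then show "real (card {v \<in> cube k. ?T y y' v}) \<le> 2 ^ k * (2 / sqrt (real k))"
          using y P by (intro card_all_ties_le[OF _ _ k _ \<eta>]) (auto simp: profile_length)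
      qed (use True in auto)
      finally show ?thesis by (simp add: mult.left_commute)
    qed
  qed auto
  finally show ?thesis by simp
qed

section \<open>Reduction to events on profiles\<close>

lemma configs_lengths:
  assumes "(am, aw, tm, tw) \<in> configs n k"
  shows "am \<in> profiles n k" "aw \<in> profiles n k" "tm \<in> tielists n" "tw \<in> tielists n"
  using assms by (auto simp: configs_def)

lemma
  assumes "am \<in> profiles n k" "aw \<in> profiles n k"
  shows untied_transpose: "untied n (\<lambda>y x. distances am aw x y) K \<longleftrightarrow> untied n (distances aw am) K"
    and untied_leftover_transpose:
      "untied_leftover n (\<lambda>y x. distances am aw x y) K \<longleftrightarrow> untied_leftover n (distances aw am) K"
    and far_block_transpose: "far_block n (distances aw am) K m \<longleftrightarrow> far_block n (distances am aw) K m"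
proof -
  have sw: "distances am aw b a = distances aw am a b" if "a < n" "b < n" for a b
    using distances_swap[OF assms, of b a] that by simp
  show "untied n (\<lambda>y x. distances am aw x y) K \<longleftrightarrow> untied n (distances aw am) K"
    by (rule untied_cong[OF sw])
  show "untied_leftover n (\<lambda>y x. distances am aw x y) K \<longleftrightarrow> untied_leftover n (distances aw am) K"
    by (rule untied_leftover_cong[OF sw])
  have "far_block n (distances aw am) K m \<longleftrightarrow> far_block n (\<lambda>y x. distances am aw x y) K m"
  proof
    assume far: "far_block n (distances aw am) K m"
    show "far_block n (\<lambda>y x. distances am aw x y) K m"
      by (rule far_block_cong[OF _ far]) (simp add: sw)
  next
    assume far: "far_block n (\<lambda>y x. distances am aw x y) K m"
    show "far_block n (distances aw am) K m"
      by (rule far_block_cong[OF _ far]) (simp add: sw)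
  qed
  then show "far_block n (distances aw am) K m \<longleftrightarrow> far_block n (distances am aw) K m"
    by (simp only: far_block_swap[of n "distances am aw"])
qed

text \<open>The cutoff \<open>Suc k\<close> exceeds every distance, so nothing is cut off. A pair
  whose members both strictly gain in distance blocks under any tie-breaking lists.\<close>

lemma stable_level_stable:
  assumes am: "am \<in> profiles n k" and aw: "aw \<in> profiles n k"
    and st: "stable n (am, aw, tm, tw) \<mu>"
  shows "level_stable {..<n} {..<n} (distances am aw) (Suc k) {(i, \<mu> i) |i. i < n}"
proof -
  have perm: "\<mu> permutes {..<n}" using st by (simp add: stable_def)
  have dom: "distances am aw a (\<mu> a) \<le> distances am aw a b \<or> distances am aw i b \<le> distances am aw a b"
    if "a < n" "b < n" "i < n" "\<mu> i = b" for a b i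
  proof (rule ccontr)
    assume *: "\<not> ?thesis"
    then have "man_prefers (am, aw, tm, tw) a b (\<mu> a)" by (simp add: man_prefers_Pair distances_def)
    moreover have "distances aw am b a < distances aw am b i"
      using * that am aw by (simp add: distances_swap[OF am aw])
    then have "woman_prefers (am, aw, tm, tw) b a i" by (simp add: woman_prefers_Pair distances_def)
    ultimately show False using st that unfolding stable_def by blast
  qed
  show ?thesis
    unfolding level_stable_def
  proof (intro conjI allI impI ballI)
    show "{(i, \<mu> i) |i. i < n} \<subseteq> {..<n} \<times> {..<n}" using permutes_less[OF perm] by auto
  next
    fix a b b' assume "(a, b) \<in> {(i, \<mu> i) |i. i < n} \<and> (a, b') \<in> {(i, \<mu> i) |i. i < n}"
    then show "b = b'" by auto
  next
    fix a a' b assume "(a, b) \<in> {(i, \<mu> i) |i. i < n} \<and> (a', b) \<in> {(i, \<mu> i) |i. i < n}"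
    then have "\<mu> a = \<mu> a'" by auto
    then show "a = a'" using permutes_inj[OF perm] by (simp add: inj_eq)
  next
    fix a b assume "(a, b) \<in> {(i, \<mu> i) |i. i < n}"
    then have "a < n" by auto
    then show "distances am aw a b < Suc k"
      using hamming_le[of "am a" "aw b"] profile_length[OF am] by (simp add: distances_def)
  next
    fix a b assume ab: "a \<in> {..<n}" "b \<in> {..<n}"
    obtain i where i: "i < n" "\<mu> i = b"
      using ab perm by (metis lessThan_iff permutes_def)
    then show "(\<exists>b'. (a, b') \<in> {(i, \<mu> i) |i. i < n} \<and> distances am aw a b' \<le> distances am aw a b) \<or>
        (\<exists>a'. (a', b) \<in> {(i, \<mu> i) |i. i < n} \<and> distances am aw a' b \<le> distances am aw a b)"
      using dom[of a b i] ab by auto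
  qed
qed

text \<open>Whatever the lists, stable matchings are level stable, a notion free of lists, so
  \<open>level_stable_unique\<close> identifies them all. Existence for each choice of lists turns
  this into a singleton.\<close>

lemma unique_without_tiesI:
  assumes c: "(am, aw, tm, tw) \<in> configs n k"
    and low: "untied n (distances am aw) K" "untied n (distances aw am) K"
    and high: "untied_leftover n (distances am aw) K" "untied_leftover n (distances aw am) K"
    and K: "K \<le> Suc k"
  shows "unique_without_ties n (am, aw, tm, tw)"
proof -
  note P = configs_lengths[OF c]
  have low': "untied n (\<lambda>y x. distances am aw x y) K"
    using low(2) untied_transpose[OF P(1,2)] by blast
  have high': "untied_leftover n (\<lambda>y x. distances am aw x y) K"
    using high(2) untied_leftover_transpose[OF P(1,2)] by blast
  obtain \<mu> where \<mu>: "stable n (am, aw, tm, tw) \<mu>" using stable_exists[OF P(3,4)] by blast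
  have eq: "\<nu> = \<mu>" if \<nu>: "stable n (am, aw, tm', tw') \<nu>" for tm' tw' \<nu>
  proof
    fix i
    have "{(i, \<nu> i) |i. i < n} = {(i, \<mu> i) |i. i < n}"
      using level_stable_unique[OF low(1) low' high(1) high'
          stable_level_stable[OF P(1,2) \<nu>] stable_level_stable[OF P(1,2) \<mu>] K] .
    then have "\<nu> i = \<mu> i" if "i < n" using that by auto
    moreover have "\<nu> permutes {..<n}" "\<mu> permutes {..<n}" using \<mu> \<nu> by (auto simp: stable_def)
    then have "\<nu> i = \<mu> i" if "\<not> i < n" using that by (simp add: permutes_def)
    ultimately show "\<nu> i = \<mu> i" by blast
  qed
  have "{\<nu>. stable n (am, aw, tm', tw') \<nu>} = {\<mu>}" if t: "tm' \<in> tielists n" "tw' \<in> tielists n" for tm' tw'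
  proof -
    obtain \<nu> where \<nu>: "stable n (am, aw, tm', tw') \<nu>" using stable_exists[OF t] by blast
    then show ?thesis using eq by blast
  qed
  then show ?thesis by (auto simp: unique_without_ties_def)
qed

section \<open>Participants with several stable partners\<close>

lemma stable_inv:
  assumes st: "stable n (am, aw, tm, tw) \<mu>"
  shows "stable n (aw, am, tw, tm) (inv \<mu>)"
proof -
  have perm: "\<mu> permutes {..<n}" using st by (simp add: stable_def)
  note inv = permutes_inverses[OF perm] 
  have pinv: "inv \<mu> permutes {..<n}" using perm by (rule permutes_inv)
  show ?thesis
    unfolding stable_def
  proof (intro conjI pinv notI, elim exE conjE)
    fix i j i'
    assume *: "i < n" "j < n" "i' < n" "inv \<mu> i' = j" "man_prefers (aw, am, tw, tm) i j (inv \<mu> i)"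
      "woman_prefers (aw, am, tw, tm) j i i'"
    have "\<mu> j = i'" using inv * by auto
    then have "man_prefers (am, aw, tm, tw) j i (\<mu> j)"
      using *(6) by (simp add: man_prefers_Pair woman_prefers_Pair)
    moreover have "woman_prefers (am, aw, tm, tw) i j (inv \<mu> i)"
      using *(5) by (simp add: man_prefers_Pair woman_prefers_Pair)
    moreover have "inv \<mu> i < n" "\<mu> (inv \<mu> i) = i" using permutes_less[OF pinv] inv * by auto
    ultimately show False using st * unfolding stable_def by blast
  qed
qed

lemma woman_partners_swap:
  "woman_partners n (am, aw, tm, tw) j = man_partners n (aw, am, tw, tm) j"
proof -
  have "i \<in> man_partners n (aw, am, tw, tm) j" if i: "i \<in> woman_partners n (am, aw, tm, tw) j" for am aw tm tw i
  proof -
    obtain \<mu> where \<mu>: "stable n (am, aw, tm, tw) \<mu>" "\<mu> i = j" using i by (auto simp: woman_partners_def)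
    then have "\<mu> permutes {..<n}" by (simp add: stable_def)
    then have "inv \<mu> j = i" using \<mu>(2) permutes_inverses(2) by auto
    then show ?thesis using stable_inv[OF \<mu>(1)] by (auto simp: man_partners_def)
  qed
  moreover have "i \<in> woman_partners n (am, aw, tm, tw) j" if i: "i \<in> man_partners n (aw, am, tw, tm) j" for i
  proof -
    obtain \<mu> where \<mu>: "stable n (aw, am, tw, tm) \<mu>" "\<mu> j = i" using i by (auto simp: man_partners_def)
    then have "\<mu> permutes {..<n}" by (simp add: stable_def)
    then have "inv \<mu> i = j" using \<mu>(2) permutes_inverses(2) by auto
    then show ?thesis using stable_inv[OF \<mu>(1)] by (auto simp: woman_partners_def)
  qed
  ultimately show ?thesis by blast
qed

lemma card_multi_men_le:
  assumes c: "(am, aw, tm, tw) \<in> configs n k" and far: "\<not> far_block n (distances am aw) K m"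
  shows "card {i. i < n \<and> card (man_partners n (am, aw, tm, tw) i) \<ge> 2}
    \<le> card {i \<in> {..<n}. low_tied n (distances am aw) K i} + m"
proof -
  let ?c = "(am, aw, tm, tw)" and ?d = "distances am aw"
  note P = configs_lengths[OF c]
  obtain \<mu> where \<mu>: "stable n ?c \<mu>" using stable_exists[OF P(3,4)] by blast
  have perm: "\<mu> permutes {..<n}" using \<mu> by (simp add: stable_def)
  have dist: "?d i (\<nu> i) = ?d i (\<mu> i)" if \<nu>: "stable n ?c \<nu>" and "i < n" for \<nu> i
    using match_dist_le[OF c \<mu> \<nu> \<open>i < n\<close>] match_dist_le[OF c \<nu> \<mu> \<open>i < n\<close>]
    unfolding distances_def by (rule antisym)
  define R where "R = {i. i < n \<and> K \<le> ?d i (\<mu> i)}"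
  have R: "card R < m"
  proof (rule ccontr)
    assume "\<not> card R < m"
    moreover have "card (\<mu> ` R) = card R"
      using permutes_inj_on[OF perm] by (rule card_image)
    \<comment> \<open>By stability \<open>x\<close> or \<open>y\<close> is matched at distance at
      most \<open>?d x y\<close>, and both are matched at distance at least
      \<open>K\<close>.\<close>
    moreover have "K \<le> ?d x y" if x: "x \<in> R" and y: "y \<in> \<mu> ` R" for x y
    proof -
      obtain x' where x': "x' \<in> R" "y = \<mu> x'" using y by auto
      have ls: "level_stable {..<n} {..<n} ?d (Suc k) {(i, \<mu> i) |i. i < n}"
        by (rule stable_level_stable[OF P(1,2) \<mu>])
      have "x < n" "x' < n" using x x' by (auto simp: R_def)
      have "y < n" using permutes_less[OF perm \<open>x' < n\<close>] x' by simp
      have "?d x y < Suc k"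
        using hamming_le[of "am x" "aw y"] profile_length[OF P(1) \<open>x < n\<close>] by (simp add: distances_def)
      then have "(\<exists>b'. (x, b') \<in> {(i, \<mu> i) |i. i < n} \<and> ?d x b' \<le> ?d x y) \<or>
          (\<exists>a'. (a', y) \<in> {(i, \<mu> i) |i. i < n} \<and> ?d a' y \<le> ?d x y)"
        using level_stableD(5)[OF ls] \<open>x < n\<close> \<open>y < n\<close> by simp
      then show ?thesis
      proof (elim disjE exE conjE)
        fix b' assume "(x, b') \<in> {(i, \<mu> i) |i. i < n}" "?d x b' \<le> ?d x y"
        then show ?thesis using x by (auto simp: R_def)
      next
        fix a' assume a': "(a', y) \<in> {(i, \<mu> i) |i. i < n}" "?d a' y \<le> ?d x y"
        then have "\<mu> a' = \<mu> x'" using x' by auto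
        then have "a' = x'" using permutes_inj[OF perm] by (simp add: inj_eq)
        then show ?thesis using a' x' by (auto simp: R_def)
      qed
    qed
    moreover have "R \<subseteq> {..<n}" by (auto simp: R_def)
    moreover have "\<mu> ` R \<subseteq> {..<n}" using permutes_less[OF perm] by (auto simp: R_def)
    ultimately have "far_block n ?d K m" by (intro far_blockI[of R n "\<mu> ` R"]) auto
    then show False using far by simp
  qed
  have sub: "{i. i < n \<and> card (man_partners n ?c i) \<ge> 2} \<subseteq> {i \<in> {..<n}. low_tied n ?d K i} \<union> R"
  proof
    fix i assume "i \<in> {i. i < n \<and> card (man_partners n ?c i) \<ge> 2}"
    then have i: "i < n" "card (man_partners n ?c i) \<ge> 2" by auto
    have "\<exists>j\<in>man_partners n ?c i. j \<noteq> \<mu> i"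
    proof (rule ccontr)
      assume "\<not> ?thesis"
      then have "man_partners n ?c i \<subseteq> {\<mu> i}" by auto
      then have "card (man_partners n ?c i) \<le> card {\<mu> i}" by (intro card_mono) auto
      then show False using i by simp
    qed
    then obtain \<nu> where \<nu>: "stable n ?c \<nu>" "\<nu> i \<noteq> \<mu> i" by (auto simp: man_partners_def)
    have "\<nu> permutes {..<n}" using \<nu> by (simp add: stable_def)
    then have less: "\<mu> i < n" "\<nu> i < n" using permutes_less[OF perm] permutes_less[of \<nu>] i by auto
    \<comment> \<open>By \<open>dist\<close> the second partner is at the same distance as the
      first.\<close>
    have "low_tied n ?d K i" if "?d i (\<mu> i) < K"
      using that less \<nu> dist[OF \<nu>(1) i(1)] unfolding low_tied_def by metis
    then show "i \<in> {i \<in> {..<n}. low_tied n ?d K i} \<union> R"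
      using i by (cases "?d i (\<mu> i) < K") (auto simp: R_def)
  qed
  have "finite ({i \<in> {..<n}. low_tied n ?d K i} \<union> R)" by (simp add: R_def)
  then have "card {i. i < n \<and> card (man_partners n ?c i) \<ge> 2} \<le> card ({i \<in> {..<n}. low_tied n ?d K i} \<union> R)"
    using sub by (rule card_mono)
  also have "\<dots> \<le> card {i \<in> {..<n}. low_tied n ?d K i} + card R" by (rule card_Un_le)
  finally show ?thesis using R by linarith
qed

lemma num_multi_le:
  assumes c: "(am, aw, tm, tw) \<in> configs n k" and far: "\<not> far_block n (distances am aw) K m"
  shows "num_multi n (am, aw, tm, tw) \<le> card {i \<in> {..<n}. low_tied n (distances am aw) K i}
     + card {i \<in> {..<n}. low_tied n (distances aw am) K i} + 2 * m"
proof -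
  have c': "(aw, am, tw, tm) \<in> configs n k" using c by (auto simp: configs_def)
  have far': "\<not> far_block n (distances aw am) K m"
    using far far_block_transpose[OF configs_lengths(1,2)[OF c]] by blast
  then show ?thesis
    using card_multi_men_le[OF c far] card_multi_men_le[OF c' far']
    by (simp add: num_multi_def woman_partners_swap)
qed

section \<open>From configurations to profiles\<close>

lemma finite_configs: "finite (configs n k)" and configs_nonempty: "configs n k \<noteq> {}"
  and finite_tielists: "finite (tielists n)" and tielists_nonempty: "tielists n \<noteq> {}"
proof -
  show f: "finite (tielists n)" by (auto simp: tielists_def intro!: finite_PiE finite_permutations)
  have "restrict (\<lambda>_. id) {..<n} \<in> tielists n" by (auto simp: tielists_def permutes_id)
  then show e: "tielists n \<noteq> {}" by blast
  show "finite (configs n k)" using f by (simp add: configs_def profiles_basic)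
  show "configs n k \<noteq> {}" using e by (simp add: configs_def profiles_basic)
qed

text \<open>The tie-breaking lists are independent of the profiles, so their number cancels from the
  quotient.\<close>

lemma prob_configs_le:
  assumes "\<And>am aw tm tw. (am, aw, tm, tw) \<in> configs n k \<Longrightarrow> (am, aw, tm, tw) \<in> S \<Longrightarrow> E am aw"
  shows "measure_pmf.prob (pmf_of_set (configs n k)) S \<le> proportion (profile_pairs n k) (\<lambda>(am, aw). E am aw)"
proof -
  let ?T = "tielists n" and ?P = "profiles n k"
  let ?f = "\<lambda>(am, aw, tm, tw). ((am, aw), (tm, tw))"
  have inj: "inj_on ?f A" for A by (auto simp: inj_on_def)
  have "?f ` (configs n k \<inter> S) \<subseteq> {p \<in> ?P \<times> ?P. (\<lambda>(am, aw). E am aw) p} \<times> (?T \<times> ?T)"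
    using assms by (auto simp: configs_def)
  then have "card (?f ` (configs n k \<inter> S)) \<le> card ({p \<in> ?P \<times> ?P. (\<lambda>(am, aw). E am aw) p} \<times> (?T \<times> ?T))"
    by (intro card_mono) (auto simp: profiles_basic finite_tielists)
  then have "card (configs n k \<inter> S) \<le> card {p \<in> ?P \<times> ?P. (\<lambda>(am, aw). E am aw) p} * card (?T \<times> ?T)"
    by (simp only: card_image[OF inj] card_cartesian_product)
  then have le: "real (card (configs n k \<inter> S)) \<le> real (card {p \<in> ?P \<times> ?P. (\<lambda>(am, aw). E am aw) p}) * real (card (?T \<times> ?T))"
    unfolding of_nat_mult[symmetric] of_nat_le_iff .
  have T: "0 < real (card (?T \<times> ?T))"
    using finite_tielists tielists_nonempty by (simp add: card_gt_0_iff)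
  have c: "card (configs n k) = card (?P \<times> ?P) * card (?T \<times> ?T)"
    by (simp add: configs_def card_cartesian_product)
  have "measure_pmf.prob (pmf_of_set (configs n k)) S = real (card (configs n k \<inter> S)) / real (card (configs n k))"
    by (rule measure_pmf_of_set[OF configs_nonempty finite_configs])
  also have "\<dots> \<le> real (card {p \<in> ?P \<times> ?P. (\<lambda>(am, aw). E am aw) p}) * real (card (?T \<times> ?T)) / real (card (configs n k))"
    using le by (rule divide_right_mono) simp
  also have "\<dots> = proportion (?P \<times> ?P) (\<lambda>(am, aw). E am aw)"
    using T unfolding c proportion_def of_nat_mult by simp
  finally show ?thesis .
qed

text \<open>The bound of \<open>card_all_far_le\<close>: the probability that a random profile is
  far from all of \<open>m\<close> given spread profiles.\<close>

definition far_rate :: "nat \<Rightarrow> real \<Rightarrow> real \<Rightarrow> real \<Rightarrow> real \<Rightarrow> nat \<Rightarrow> real" where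
  "far_rate k \<eta> s u v m = 4 * exp (real k * u\<^sup>2) / real m + 4 * (exp (2 * u\<^sup>2 * \<eta> * real k) - 1)
     + 2 * exp (2 * (u - v) * s + real k * v\<^sup>2 / 2 - real k * (u\<^sup>2 / 2 - u ^ 4 / 4))"

text \<open>The bound of \<open>card_ties_le\<close>: the probability that a random profile has
  equal distances below the cutoff to two given spread profiles.\<close>

definition tie_rate :: "nat \<Rightarrow> real \<Rightarrow> real \<Rightarrow> real" where
  "tie_rate k \<eta> s = 2 / sqrt (real k) * exp (- 4 * s\<^sup>2 / real k * (1 - 2 * \<eta>))"

lemma proportion_disj_le:
  assumes "finite A" "proportion A P \<le> a" "proportion A Q \<le> b"
  shows "proportion A (\<lambda>x. P x \<or> Q x) \<le> a + b"
  using proportion_disj[OF assms(1), of P Q] assms by linarith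

text \<open>By \<open>num_multi_le\<close> each side contributes its low-tied participants and at
  most \<open>m\<close> others. Markov's inequality limits the former to fewer than \<open>c\<close>
  per side.\<close>

lemma prob_many_multi_le:
  assumes k: "0 < k" and \<eta>: "0 \<le> \<eta>" "\<eta> \<le> 1/4" and uv: "v \<le> u" "u\<^sup>2 \<le> 2"
    and m: "0 < m" and s: "0 \<le> s" and c: "0 < c"
  shows "measure_pmf.prob (pmf_of_set (configs n k)) {cfg. 2 * c + 2 * real m \<le> real (num_multi n cfg)}
    \<le> 2 * (real n ^ 2 * exp (- 2 * \<eta>\<^sup>2 * real k)) + 4 ^ n * far_rate k \<eta> s u v m ^ m
      + 2 * (real n ^ 3 * tie_rate k \<eta> s / c)"
proof -
  define K where "K = nat \<lceil>real k / 2 - s\<rceil>"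
  let ?A = "profile_pairs n k"
  have fin: "finite ?A" by (simp add: profiles_basic)
  let ?N = "\<lambda>(am, aw). \<not> spread n k \<eta> am" and ?N' = "\<lambda>(am, aw). \<not> spread n k \<eta> aw"
  let ?F = "\<lambda>(am, aw). spread n k \<eta> am \<and> far_block n (distances am aw) K m"
  let ?L = "\<lambda>x (am, aw). spread n k \<eta> aw \<and> low_tied n (distances am aw) K x"
  let ?L' = "\<lambda>x (am, aw). spread n k \<eta> am \<and> low_tied n (distances aw am) K x"
  let ?M = "\<lambda>p. c \<le> real (card {x \<in> {..<n}. ?L x p})" and ?M' = "\<lambda>p. c \<le> real (card {x \<in> {..<n}. ?L' x p})"
  let ?e = "real n ^ 2 * exp (- 2 * \<eta>\<^sup>2 * real k)"
  let ?r = "4 ^ n * far_rate k \<eta> s u v m ^ m" and ?t = "real n ^ 3 * tie_rate k \<eta> s / c"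
  have N: "proportion ?A ?N \<le> ?e" by (rule proportion_not_spread_le[OF \<eta>(1)])
  then have N': "proportion ?A ?N' \<le> ?e" by (subst proportion_profile_pairs_swap)
  have F: "proportion ?A ?F \<le> ?r"
    by (rule proportion_far_block_le[OF \<eta>(1) uv m K_def]) (simp add: far_rate_def)
  have L: "proportion ?A (?L x) \<le> real n ^ 2 * tie_rate k \<eta> s" if "x < n" for x
    unfolding tie_rate_def by (rule proportion_low_tied_le[OF that k \<eta>(2) s K_def])
  then have L': "proportion ?A (?L' x) \<le> real n ^ 2 * tie_rate k \<eta> s" if "x < n" for x
    using that by (subst proportion_profile_pairs_swap)
  have markov: "proportion ?A (\<lambda>p. c \<le> real (card {x \<in> {..<n}. G x p})) \<le> ?t"
    if "\<And>x. x < n \<Longrightarrow> proportion ?A (G x) \<le> real n ^ 2 * tie_rate k \<eta> s" for G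
  proof -
    have "proportion ?A (\<lambda>p. c \<le> real (card {x \<in> {..<n}. G x p})) \<le> (\<Sum>x<n. proportion ?A (G x)) / c"
      by (rule proportion_markov[OF fin _ c]) simp
    also have "\<dots> \<le> (\<Sum>x<n. real n ^ 2 * tie_rate k \<eta> s) / c"
      using that c by (intro divide_right_mono sum_mono) auto
    also have "\<dots> = ?t" by (simp add: power3_eq_cube power2_eq_square)
    finally show ?thesis .
  qed
  have M: "proportion ?A ?M \<le> ?t" by (rule markov[OF L])
  have M': "proportion ?A ?M' \<le> ?t" by (rule markov[OF L'])
  let ?E = "\<lambda>p. ?N p \<or> ?N' p \<or> ?F p \<or> ?M p \<or> ?M' p"
  have "measure_pmf.prob (pmf_of_set (configs n k)) {cfg. 2 * c + 2 * real m \<le> real (num_multi n cfg)}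
      \<le> proportion ?A (\<lambda>(am, aw). ?E (am, aw))"
  proof (rule prob_configs_le, rule ccontr)
    fix am aw tm tw
    assume cfg: "(am, aw, tm, tw) \<in> configs n k"
      "(am, aw, tm, tw) \<in> {cfg. 2 * c + 2 * real m \<le> real (num_multi n cfg)}"
    assume "\<not> ?E (am, aw)"
    then have ne: "spread n k \<eta> am" "spread n k \<eta> aw" "\<not> far_block n (distances am aw) K m"
      "real (card {x \<in> {..<n}. low_tied n (distances am aw) K x}) < c"
      "real (card {x \<in> {..<n}. low_tied n (distances aw am) K x}) < c"
      by (auto simp: not_le)
    have "real (num_multi n (am, aw, tm, tw)) \<le> real (card {i \<in> {..<n}. low_tied n (distances am aw) K i}
       + card {i \<in> {..<n}. low_tied n (distances aw am) K i} + 2 * m)"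
      using num_multi_le[OF cfg(1) ne(3)] by (simp only: of_nat_le_iff)
    then show False using cfg(2) ne(4,5) by simp
  qed
  also have "\<dots> \<le> ?e + (?e + (?r + (?t + ?t)))"
    unfolding case_prod_eta[of ?E] by (intro proportion_disj_le fin N N' F M M')
  finally show ?thesis by linarith
qed

lemma prob_not_unique_le:
  assumes k: "0 < k" and \<eta>: "0 \<le> \<eta>" "\<eta> \<le> 1/4" and uv: "v \<le> u" "u\<^sup>2 \<le> 2"
    and m: "0 < m" and s: "0 \<le> s"
  shows "measure_pmf.prob (pmf_of_set (configs n k)) {cfg. \<not> unique_without_ties n cfg}
    \<le> 2 * (real n ^ 2 * exp (- 2 * \<eta>\<^sup>2 * real k)) + 4 ^ n * far_rate k \<eta> s u v m ^ m
      + 2 * (real n ^ 3 * tie_rate k \<eta> s) + 2 * (real n * (real m ^ 2 * (2 / sqrt (real k))))"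
proof -
  define K where "K = nat \<lceil>real k / 2 - s\<rceil>"
  have Kk: "K \<le> Suc k"
  proof -
    have "\<lceil>real k / 2 - s\<rceil> \<le> int k" using s by (simp add: ceiling_le_iff)
    then have "K \<le> k" unfolding K_def by (simp only: nat_le_iff)
    then show ?thesis by simp
  qed
  let ?A = "profile_pairs n k"
  have fin: "finite ?A" by (simp add: profiles_basic)
  let ?N = "\<lambda>(am, aw). \<not> spread n k \<eta> am" and ?N' = "\<lambda>(am, aw). \<not> spread n k \<eta> aw"
  let ?F = "\<lambda>(am, aw). spread n k \<eta> am \<and> far_block n (distances am aw) K m"
  let ?L = "\<lambda>x (am, aw). spread n k \<eta> aw \<and> low_tied n (distances am aw) K x"
  let ?L' = "\<lambda>x (am, aw). spread n k \<eta> am \<and> low_tied n (distances aw am) K x"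
  let ?M = "\<lambda>p. \<exists>x\<in>{..<n}. ?L x p" and ?M' = "\<lambda>p. \<exists>x\<in>{..<n}. ?L' x p"
  \<comment> \<open>The size bound on the leftovers is built into this event. It is supplied
    afterwards by \<open>card_leftover_le\<close>, whose hypotheses hold outside the preceding
    events.\<close>
  let ?U = "\<lambda>(am, aw). spread n k \<eta> aw \<and>
      (\<forall>x<n. card (leftover n (distances am aw) K x) \<le> m) \<and> \<not> untied_leftover n (distances am aw) K"
  let ?U' = "\<lambda>(am, aw). spread n k \<eta> am \<and>
      (\<forall>x<n. card (leftover n (distances aw am) K x) \<le> m) \<and> \<not> untied_leftover n (distances aw am) K"
  let ?e = "real n ^ 2 * exp (- 2 * \<eta>\<^sup>2 * real k)"
  let ?r = "4 ^ n * far_rate k \<eta> s u v m ^ m" and ?t = "real n ^ 3 * tie_rate k \<eta> s"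
  let ?w = "real n * (real m ^ 2 * (2 / sqrt (real k)))"
  have N: "proportion ?A ?N \<le> ?e" by (rule proportion_not_spread_le[OF \<eta>(1)])
  then have N': "proportion ?A ?N' \<le> ?e" by (subst proportion_profile_pairs_swap)
  have F: "proportion ?A ?F \<le> ?r"
    by (rule proportion_far_block_le[OF \<eta>(1) uv m K_def]) (simp add: far_rate_def)
  have L: "proportion ?A (?L x) \<le> real n ^ 2 * tie_rate k \<eta> s" if "x < n" for x
    unfolding tie_rate_def by (rule proportion_low_tied_le[OF that k \<eta>(2) s K_def])
  then have L': "proportion ?A (?L' x) \<le> real n ^ 2 * tie_rate k \<eta> s" if "x < n" for x
    using that by (subst proportion_profile_pairs_swap)
  have union: "proportion ?A (\<lambda>p. \<exists>x\<in>{..<n}. G x p) \<le> ?t"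
    if "\<And>x. x < n \<Longrightarrow> proportion ?A (G x) \<le> real n ^ 2 * tie_rate k \<eta> s" for G
  proof -
    have "proportion ?A (\<lambda>p. \<exists>x\<in>{..<n}. G x p) \<le> (\<Sum>x<n. proportion ?A (G x))"
      by (rule proportion_bex[OF fin]) simp
    also have "\<dots> \<le> (\<Sum>x<n. real n ^ 2 * tie_rate k \<eta> s)"
      using that by (intro sum_mono) auto
    also have "\<dots> = ?t" by (simp add: power3_eq_cube power2_eq_square)
    finally show ?thesis .
  qed
  have M: "proportion ?A ?M \<le> ?t" by (rule union[OF L])
  have M': "proportion ?A ?M' \<le> ?t" by (rule union[OF L'])
  have U: "proportion ?A ?U \<le> ?w" by (rule proportion_not_untied_leftover_le[OF k \<eta>(2)])
  then have U': "proportion ?A ?U' \<le> ?w" by (subst proportion_profile_pairs_swap)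
  let ?E = "\<lambda>p. ?N p \<or> ?N' p \<or> ?F p \<or> ?M p \<or> ?M' p \<or> ?U p \<or> ?U' p"
  have "measure_pmf.prob (pmf_of_set (configs n k)) {cfg. \<not> unique_without_ties n cfg}
      \<le> proportion ?A (\<lambda>(am, aw). ?E (am, aw))"
  proof (rule prob_configs_le, rule ccontr)
    fix am aw tm tw
    assume cfg: "(am, aw, tm, tw) \<in> configs n k"
      "(am, aw, tm, tw) \<in> {cfg. \<not> unique_without_ties n cfg}"
    note P = configs_lengths[OF cfg(1)]
    assume "\<not> ?E (am, aw)"
    then have ne: "spread n k \<eta> am" "spread n k \<eta> aw" "\<not> far_block n (distances am aw) K m"
      "untied n (distances am aw) K" "untied n (distances aw am) K"
      "(\<forall>x<n. card (leftover n (distances am aw) K x) \<le> m) \<Longrightarrow> untied_leftover n (distances am aw) K"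
      "(\<forall>x<n. card (leftover n (distances aw am) K x) \<le> m) \<Longrightarrow> untied_leftover n (distances aw am) K"
      unfolding untied_iff_low_tied by auto
    have low: "untied n (\<lambda>y x. distances am aw x y) K" "untied n (\<lambda>y x. distances aw am x y) K"
      using ne(4,5) untied_transpose[OF P(1,2)] untied_transpose[OF P(2,1)] by blast+
    have far: "\<not> far_block n (distances aw am) K m"
      using ne(3) far_block_transpose[OF P(1,2)] by blast
    have "untied_leftover n (distances am aw) K"
      using ne(6) card_leftover_le[OF ne(4) low(1) ne(3)] by blast
    moreover have "untied_leftover n (distances aw am) K"
      using ne(7) card_leftover_le[OF ne(5) low(2) far] by blast
    ultimately show False
      using unique_without_tiesI[OF cfg(1) ne(4,5) _ _ Kk] cfg(2) by blast
  qed
  also have "\<dots> \<le> ?e + (?e + (?r + (?t + (?t + (?w + ?w)))))"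
    unfolding case_prod_eta[of ?E] by (intro proportion_disj_le fin N N' F M M' U U')
  finally show ?thesis by (simp only: mult_2 add.assoc add.left_commute)
qed

section \<open>The matching distance of a random participant\<close>

lemma proportion_close_le:
  assumes x: "x < n" and s: "0 \<le> s"
  shows "proportion (profile_pairs n k) (\<lambda>(am, aw). \<exists>y\<in>{..<n}. real (hamming (am x) (aw y)) < real k / 2 - s)
    \<le> real n * exp (- 2 * s\<^sup>2 / real k)"
proof (rule proportion_resample[OF x])
  fix am aw assume P: "am \<in> profiles n k" "aw \<in> profiles n k"
  let ?W = "\<lambda>y. {v \<in> cube k. real (hamming (aw y) v) < real k / 2 - s}"
  have "{v \<in> cube k. \<exists>y\<in>{..<n}. real (hamming ((am(x := v)) x) (aw y)) < real k / 2 - s} = (\<Union>y\<in>{..<n}. ?W y)"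
    using P by (auto simp: hamming_commute profile_length)
  then have "real (card {v \<in> cube k. \<exists>y\<in>{..<n}. real (hamming ((am(x := v)) x) (aw y)) < real k / 2 - s})
      \<le> real (\<Sum>y<n. card (?W y))"
    using card_UN_le[of "{..<n}" ?W] by (simp only: of_nat_le_iff finite_lessThan)
  also have "\<dots> = (\<Sum>y<n. real (card (?W y)))" by simp
  also have "\<dots> \<le> (\<Sum>y<n. 2 ^ k * exp (- 2 * s\<^sup>2 / real k))"
    using P s by (intro sum_mono card_hamming_small_le) (auto simp: profile_length)
  also have "\<dots> = 2 ^ k * (real n * exp (- 2 * s\<^sup>2 / real k))" by simp
  finally show "real (card {v \<in> cube k. \<exists>y\<in>{..<n}. real (hamming ((am(x := v)) x) (aw y)) < real k / 2 - s})
      \<le> 2 ^ k * (real n * exp (- 2 * s\<^sup>2 / real k))" .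
qed

lemma prob_pair_le:
  fixes A :: "'a set" and B :: "'b set"
  assumes A: "finite A" "A \<noteq> {}" and B: "finite B" "B \<noteq> {}"
    and le: "\<And>p. p \<in> B \<Longrightarrow> measure_pmf.prob (pmf_of_set A) {c. (c, p) \<in> S} \<le> b"
  shows "measure_pmf.prob (pmf_of_set (A \<times> B)) S \<le> b"
proof -
  have cA: "0 < real (card A)" using A by (simp add: card_gt_0_iff)
  have cB: "0 < real (card B)" using B by (simp add: card_gt_0_iff)
  have "card ((A \<times> B) \<inter> S) = card (SIGMA p:B. A \<inter> {c. (c, p) \<in> S})"
    by (rule bij_betw_same_card[of prod.swap], rule bij_betw_byWitness[of _ prod.swap]) auto
  also have "\<dots> = (\<Sum>p\<in>B. card (A \<inter> {c. (c, p) \<in> S}))" using A B by (simp add: card_SigmaI)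
  finally have "real (card ((A \<times> B) \<inter> S)) = (\<Sum>p\<in>B. real (card (A \<inter> {c. (c, p) \<in> S})))" by simp
  also have "\<dots> \<le> (\<Sum>p\<in>B. b * real (card A))"
  proof (rule sum_mono)
    fix p assume "p \<in> B"
    then have "real (card (A \<inter> {c. (c, p) \<in> S})) / real (card A) \<le> b"
      using le[of p] by (simp add: measure_pmf_of_set A)
    then show "real (card (A \<inter> {c. (c, p) \<in> S})) \<le> b * real (card A)"
      using cA by (simp only: pos_divide_le_eq)
  qed
  also have "\<dots> = b * real (card (A \<times> B))" by (simp add: card_cartesian_product)
  finally have "real (card ((A \<times> B) \<inter> S)) \<le> b * real (card (A \<times> B))" .
  moreover have "0 < real (card (A \<times> B))" using cA cB by (simp add: card_cartesian_product)
  ultimately have "real (card ((A \<times> B) \<inter> S)) / real (card (A \<times> B)) \<le> b"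
    by (simp only: pos_divide_le_eq)
  then show ?thesis using A B by (simp add: measure_pmf_of_set)
qed

lemma match_dist_tail:
  assumes n: "n \<ge> 1" and \<beta>: "\<beta> > 1"
  shows "measure_pmf.prob (pmf_of_set (configs n k \<times> (UNIV \<times> {..<n})))
        {(c, p). real (match_dist n c p) < real k / 2 - sqrt (\<beta> * real k * log 2 (real n))}
      \<le> real n powr (1 - \<beta>)"
proof (rule prob_pair_le)
  show "finite (configs n k)" "configs n k \<noteq> {}" by (rule finite_configs configs_nonempty)+
  show "finite ((UNIV :: bool set) \<times> {..<n})" "(UNIV :: bool set) \<times> {..<n} \<noteq> {}" using n by (auto simp: lessThan_empty_iff)
  fix p :: "bool \<times> nat" assume p: "p \<in> UNIV \<times> {..<n}"
  then obtain b x where bx: "p = (b, x)" "x < n" by auto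
  define s where "s = sqrt (\<beta> * real k * log 2 (real n))"
  have log: "0 \<le> log 2 (real n)" using n by simp
  then have s: "0 \<le> s" "s\<^sup>2 = \<beta> * real k * log 2 (real n)" using \<beta> by (simp_all add: s_def)
  let ?S = "{c. (c, p) \<in> {(c, p). real (match_dist n c p) < real k / 2 - s}}"
  let ?E = "\<lambda>am aw. \<exists>y\<in>{..<n}. real (hamming (am x) (aw y)) < real k / 2 - s"
  have proportion: "proportion (profile_pairs n k) (\<lambda>(am, aw). ?E am aw) \<le> real n powr (1 - \<beta>)"
  proof (cases "k = 0")
    case True
    \<comment> \<open>For \<open>k = 0\<close> the bound \<open>k/2 - s\<close> is 0, and no
      distance lies below it.\<close>
    then have "proportion (profile_pairs n k) (\<lambda>(am, aw). ?E am aw) = 0"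
      using s by (simp add: proportion_def case_prod_unfold)
    then show ?thesis by simp
  next
    case False
    have "proportion (profile_pairs n k) (\<lambda>(am, aw). ?E am aw) \<le> real n * exp (- 2 * s\<^sup>2 / real k)"
      by (rule proportion_close_le[OF bx(2) s(1)])
    also have "- 2 * s\<^sup>2 / real k = - 2 * \<beta> * log 2 (real n)"
      using False by (simp add: s(2))
    \<comment> \<open>There is room to spare: the binary logarithm is at least the natural one, and
      a factor 2 in the exponent is given away.\<close>
    also have "exp (- 2 * \<beta> * log 2 (real n)) \<le> exp (- \<beta> * ln (real n))"
    proof -
      have "ln (real n) \<le> log 2 (real n)"
      proof -
        have "ln (2 :: real) \<le> 1" using ln_le_minus_one[of "2 :: real"] by simp
        then have "ln (real n) / 1 \<le> ln (real n) / ln 2"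
          using n by (intro divide_left_mono) auto
        then show ?thesis by (simp add: log_def)
      qed
      then have "ln (real n) \<le> 2 * log 2 (real n)" using log by linarith
      then have "\<beta> * ln (real n) \<le> \<beta> * (2 * log 2 (real n))" using \<beta> by (intro mult_left_mono) auto
      then show ?thesis by simp
    qed
    also have "real n * exp (- \<beta> * ln (real n)) = real n powr (1 - \<beta>)"
      using n by (simp add: powr_def exp_diff exp_minus left_diff_distrib divide_inverse)
    finally show ?thesis using n by (simp add: mult_left_mono)
  qed
  have "measure_pmf.prob (pmf_of_set (configs n k)) ?S \<le> real n powr (1 - \<beta>)"
  proof (cases b)
    case True
    have "measure_pmf.prob (pmf_of_set (configs n k)) ?S \<le> proportion (profile_pairs n k) (\<lambda>(am, aw). ?E am aw)"
    proof (rule prob_configs_le)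
      fix am aw tm tw assume c: "(am, aw, tm, tw) \<in> configs n k" "(am, aw, tm, tw) \<in> ?S"
      define \<mu> where "\<mu> = (SOME \<mu>. stable n (am, aw, tm, tw) \<mu>)"
      have "stable n (am, aw, tm, tw) \<mu>"
        unfolding \<mu>_def by (rule someI_ex[OF stable_exists[OF configs_lengths(3,4)[OF c(1)]]])
      then have "\<mu> permutes {..<n}" by (simp add: stable_def)
      then have "\<mu> x < n" using bx(2) by (rule permutes_less)
      moreover have "match_dist n (am, aw, tm, tw) p = hamming (am x) (aw (\<mu> x))"
        using True bx by (simp add: match_dist_def \<mu>_def)
      ultimately show "?E am aw" using c(2) by auto
    qed
    then show ?thesis using proportion by linarith
  next
    case False
    have "measure_pmf.prob (pmf_of_set (configs n k)) ?S \<le> proportion (profile_pairs n k) (\<lambda>(am, aw). ?E aw am)"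
    proof (rule prob_configs_le)
      fix am aw tm tw assume c: "(am, aw, tm, tw) \<in> configs n k" "(am, aw, tm, tw) \<in> ?S"
      define \<mu> where "\<mu> = (SOME \<mu>. stable n (am, aw, tm, tw) \<mu>)"
      have "stable n (am, aw, tm, tw) \<mu>"
        unfolding \<mu>_def by (rule someI_ex[OF stable_exists[OF configs_lengths(3,4)[OF c(1)]]])
      then have perm: "\<mu> permutes {..<n}" by (simp add: stable_def)
      \<comment> \<open>Ensures that the \<open>THE\<close> in \<open>match_dist\<close> denotes the
        actual partner, \<open>inv \<mu> x\<close>.\<close>
      have "\<exists>!i. i < n \<and> \<mu> i = x"
      proof (rule ex1I[of _ "inv \<mu> x"])
        show "inv \<mu> x < n \<and> \<mu> (inv \<mu> x) = x"
          using permutes_less[OF permutes_inv[OF perm] bx(2)] permutes_inverses(1)[OF perm] by simp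
        show "i = inv \<mu> x" if "i < n \<and> \<mu> i = x" for i
          using that permutes_inverses(2)[OF perm] by auto
      qed
      then have "(THE i. i < n \<and> \<mu> i = x) < n" by (rule the1I2) simp
      moreover have "match_dist n (am, aw, tm, tw) p = hamming (aw x) (am (THE i. i < n \<and> \<mu> i = x))"
        using False bx by (simp add: match_dist_def \<mu>_def)
      ultimately show "?E aw am" using c(2) by auto
    qed
    also have "\<dots> = proportion (profile_pairs n k) (\<lambda>(am, aw). ?E am aw)" by (rule proportion_profile_pairs_swap)
    finally show ?thesis using proportion by linarith
  qed
  then show "measure_pmf.prob (pmf_of_set (configs n k))
      {c. (c, p) \<in> {(c, p). real (match_dist n c p) < real k / 2 - sqrt (\<beta> * real k * log 2 (real n))}}
    \<le> real n powr (1 - \<beta>)" by (simp add: s_def)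
qed

section \<open>Asymptotics\<close>

text \<open>The constants keep \<open>exp (k u\<^sup>2) = n powr (81/100)\<close> of smaller order than \<open>n\<close>, while the tie
  exponent \<open>4 s\<^sup>2 / k = 9/16 * ln n\<close> exceeds \<open>1/2 * ln n\<close> and the last exponent of \<open>far_rate\<close> tends to
  \<open>- \<infinity>\<close>.\<close>
lemma far_rate_le:
  fixes C \<delta> :: real
  assumes n: "n \<ge> 2" and k: "real n ^ 3 \<le> C * real k" and C: "0 < C" and \<delta>: "0 < \<delta>" and m: "\<delta> * real n \<le> real m"
    and u: "u = 9/10 * sqrt (ln (real n) / real k)" and v: "v = 27/40 * sqrt (ln (real n) / real k)"
    and s: "s = 3/8 * sqrt (ln (real n) * real k)" and \<eta>: "\<eta> = 1 / sqrt (real n)"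
  shows "far_rate k \<eta> s u v m \<le> 4 * exp (81/100 * ln (real n)) / (\<delta> * real n)
    + 4 * (exp (81/50 * ln (real n) / sqrt (real n)) - 1)
    + 2 * exp (- 27/3200 * ln (real n) + 6561/40000 * C * ln (real n) ^ 2 / real n ^ 3)"
proof -
  let ?l = "ln (real n)"
  have n0: "0 < real n ^ 3" using n by simp
  then have "0 < C * real k" using k by linarith
  then have k0: "0 < real k" using C by (simp add: zero_less_mult_iff)
  have l0: "0 \<le> ?l" using n by simp
  have sq: "sqrt (?l / real k) ^ 2 = ?l / real k" using l0 k0 by simp
  have u2: "u\<^sup>2 = 81/100 * (?l / real k)" unfolding u power_mult_distrib sq by (simp add: power2_eq_square)
  have v2: "v\<^sup>2 = 729/1600 * (?l / real k)" unfolding v power_mult_distrib sq by (simp add: power2_eq_square)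
  have u4: "u ^ 4 = 6561/10000 * (?l / real k)\<^sup>2"
    using arg_cong[OF u2, of "\<lambda>x. x\<^sup>2"] by (simp add: power_mult[symmetric] power_mult_distrib power_divide)
  have us: "2 * (u - v) * s = 27/160 * ?l"
  proof -
    have "sqrt (?l / real k) * sqrt (?l * real k) = ?l"
      using k0 l0 by (simp add: real_sqrt_mult[symmetric])
    then show ?thesis unfolding u v s by (simp add: algebra_simps)
  qed
  have 1: "real k * u\<^sup>2 = 81/100 * ?l" using k0 by (simp add: u2)
  \<comment> \<open>The choice \<open>\<eta> = 1 / sqrt n\<close> balances two demands:
    \<open>\<eta> * ln n\<close> tends to 0, so the covariance term vanishes, while
    \<open>\<eta>^2 * k\<close> is at least of order \<open>n^2\<close>, so failure of
    \<open>spread\<close> is unlikely.\<close>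
  have 2: "2 * u\<^sup>2 * \<eta> * real k = 81/50 * ?l / sqrt (real n)" using k0 by (simp add: u2 \<eta>)
  \<comment> \<open>The coefficients \<open>27/160\<close>, \<open>729/3200\<close> and
    \<open>- 81/200\<close> add up to \<open>- 27/3200\<close>, negative because
    \<open>9/10 + 27/40\<close> slightly exceeds \<open>4 * 3/8\<close>.\<close>
  have 3: "2 * (u - v) * s + real k * v\<^sup>2 / 2 - real k * (u\<^sup>2 / 2 - u ^ 4 / 4)
      = - 27/3200 * ?l + 6561/40000 * (?l\<^sup>2 / real k)"
    unfolding us u4 u2 v2 using k0 by (simp add: field_simps power2_eq_square)
  have "1 / real k \<le> C / real n ^ 3" using k k0 n0 C by (simp add: field_simps)
  then have "?l\<^sup>2 * (1 / real k) \<le> ?l\<^sup>2 * (C / real n ^ 3)" by (rule mult_left_mono) simp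
  then have 4: "?l\<^sup>2 / real k \<le> C * ?l\<^sup>2 / real n ^ 3" by (simp add: mult.commute)
  have 5: "4 * exp (81/100 * ?l) / real m \<le> 4 * exp (81/100 * ?l) / (\<delta> * real n)"
  proof -
    have "0 < \<delta> * real n" using \<delta> n by simp
    then show ?thesis using m by (intro divide_left_mono) (auto intro!: mult_pos_pos)
  qed
  show ?thesis
    unfolding far_rate_def 1 2 3 using 4 5 by (intro add_mono mult_left_mono) auto
qed

lemma far_term_eventually_le:
  fixes C \<delta> :: real and k :: "nat \<Rightarrow> nat" and m :: "nat \<Rightarrow> nat"
  assumes ev: "\<forall>\<^sub>F n in at_top. real n ^ 3 \<le> C * real (k n)" and C: "0 < C" and \<delta>: "0 < \<delta>"
    and m: "\<And>n. \<delta> * real n \<le> real (m n)"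
    and u: "\<And>n. u n = 9/10 * sqrt (ln (real n) / real (k n))" and v: "\<And>n. v n = 27/40 * sqrt (ln (real n) / real (k n))"
    and s: "\<And>n. s n = 3/8 * sqrt (ln (real n) * real (k n))" and \<eta>: "\<And>n. \<eta> n = 1 / sqrt (real n)"
  shows "\<forall>\<^sub>F n in at_top. 4 ^ n * far_rate (k n) (\<eta> n) (s n) (u n) (v n) (m n) ^ m n \<le> (1/2) ^ n"
proof -
  let ?Q = "\<lambda>n :: nat. 4 * exp (81/100 * ln (real n)) / (\<delta> * real n)
    + 4 * (exp (81/50 * ln (real n) / sqrt (real n)) - 1)
    + 2 * exp (- 27/3200 * ln (real n) + 6561/40000 * C * ln (real n) ^ 2 / real n ^ 3)"
  have "?Q \<longlonglongrightarrow> 0"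
  proof -
    have "(\<lambda>n :: nat. 4 * exp (81/100 * ln (real n)) / (\<delta> * real n)) \<longlonglongrightarrow> 0"
      using \<delta> by real_asymp
    moreover have "(\<lambda>n :: nat. 4 * (exp (81/50 * ln (real n) / sqrt (real n)) - 1)) \<longlonglongrightarrow> 0"
      by real_asymp
    moreover have "(\<lambda>n :: nat. 2 * exp (- 27/3200 * ln (real n) + 6561/40000 * C * ln (real n) ^ 2 / real n ^ 3)) \<longlonglongrightarrow> 0"
      using C by real_asymp
    ultimately show ?thesis by (intro tendsto_add_zero)
  qed
  \<comment> \<open>Raised to a power of at least \<open>\<delta> * n\<close>, this bound is at most
    \<open>(1/8) ^ n\<close>, which beats the \<open>4 ^ n\<close> of the union bound.\<close>
  then have "\<forall>\<^sub>F n in at_top. ?Q n < 8 powr (- 1 / \<delta>)" by (rule order_tendstoD) simp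
  then show ?thesis using ev eventually_ge_at_top[of 2]
  proof eventually_elim
    case (elim n)
    let ?q = "far_rate (k n) (\<eta> n) (s n) (u n) (v n) (m n)"
    have "?q \<le> ?Q n"
      by (rule far_rate_le[OF elim(3,2) C \<delta> m u v s \<eta>])
    then have q: "?q \<le> 8 powr (- 1 / \<delta>)" using elim(1) by linarith
    have "0 \<le> 2 * (u n)\<^sup>2 * \<eta> n * real (k n)" by (simp add: \<eta>)
    then have "1 \<le> exp (2 * (u n)\<^sup>2 * \<eta> n * real (k n))" by simp
    then have q0: "0 \<le> ?q" unfolding far_rate_def by (intro add_nonneg_nonneg) auto
    have "?q ^ m n \<le> (8 powr (- 1 / \<delta>)) ^ m n" using q q0 by (rule power_mono)
    also have "\<dots> = 8 powr (- (real (m n) / \<delta>))" by (simp add: powr_realpow[symmetric] powr_powr)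
    also have "\<dots> \<le> 8 powr (- real n)"
      using m[of n] \<delta> by (intro powr_mono) (auto simp: field_simps)
    also have "\<dots> = (1/8) ^ n" by (simp add: powr_minus powr_realpow power_divide inverse_eq_divide)
    finally have "4 ^ n * ?q ^ m n \<le> 4 ^ n * (1/8) ^ n" by (rule mult_left_mono) simp
    then show ?case by (simp add: power_mult_distrib[symmetric])
  qed
qed

lemma spread_term_le:
  fixes C :: real
  assumes n: "n \<ge> 2" and k: "real n ^ 3 \<le> C * real k" and C: "0 < C"
  shows "real n ^ 2 * exp (- 2 * (1 / sqrt (real n))\<^sup>2 * real k) \<le> real n ^ 2 * exp (- 2 * real n ^ 2 / C)"
proof -
  have "real n ^ 2 * real n \<le> real k * C" using k by (simp add: power2_eq_square power3_eq_cube mult.commute)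
  then have "real n ^ 2 / C \<le> real k / real n" using n C by (simp add: field_simps)
  then show ?thesis using n by (simp add: power_divide)
qed

lemma tie_rate_le:
  fixes C :: real
  assumes n: "n \<ge> 2" and k: "real n ^ j \<le> C * real k" and C: "0 < C"
    and s: "s = 3/8 * sqrt (ln (real n) * real k)"
  shows "tie_rate k (1 / sqrt (real n)) s \<le> 2 * sqrt C / sqrt (real n ^ j) * exp (- 9/16 * ln (real n) * (1 - 2 / sqrt (real n)))"
    and "2 / sqrt (real k) \<le> 2 * sqrt C / sqrt (real n ^ j)"
proof -
  have n0: "0 < real n ^ j" using n by simp
  then have "0 < C * real k" using k by linarith
  then have k0: "0 < real k" using C by (simp add: zero_less_mult_iff)
  have "sqrt (real n ^ j) \<le> sqrt (C * real k)" using k by (rule real_sqrt_le_mono)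
  then have "sqrt (real n ^ j) \<le> sqrt C * sqrt (real k)" by (simp add: real_sqrt_mult)
  moreover have "0 < sqrt (real n ^ j)" "0 < sqrt (real k)" using n0 k0 by simp_all
  ultimately show le: "2 / sqrt (real k) \<le> 2 * sqrt C / sqrt (real n ^ j)"
    by (simp add: field_simps)
  have s2: "s\<^sup>2 = 9/64 * (ln (real n) * real k)"
    using n by (simp add: s power_mult_distrib power_divide)
  then have "- 4 * s\<^sup>2 / real k * (1 - 2 * (1 / sqrt (real n))) = - 9/16 * ln (real n) * (1 - 2 / sqrt (real n))"
    unfolding s2 using k0 by simp
  then show "tie_rate k (1 / sqrt (real n)) s \<le> 2 * sqrt C / sqrt (real n ^ j) * exp (- 9/16 * ln (real n) * (1 - 2 / sqrt (real n)))"
    unfolding tie_rate_def using le by (metis exp_ge_zero mult_right_mono)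
qed

text \<open>Secures the range in which \<open>cosh_ge_exp\<close> applies.\<close>

lemma u_square_le:
  fixes C :: real
  assumes n: "n \<ge> 2" and k: "real n ^ 3 \<le> C * real k" and C: "0 < C" and large: "C * ln (real n) \<le> real n ^ 3"
  shows "(9/10 * sqrt (ln (real n) / real k))\<^sup>2 \<le> 2"
proof -
  have "0 < real n ^ 3" using n by simp
  then have "0 < C * real k" using k by linarith
  then have k0: "0 < real k" using C by (simp add: zero_less_mult_iff)
  have "C * ln (real n) \<le> C * real k" using large k by linarith
  then have "ln (real n) \<le> real k" using C by simp
  then have "ln (real n) / real k \<le> 1" using k0 by simp
  moreover have "(sqrt (ln (real n) / real k))\<^sup>2 = ln (real n) / real k" using n by simp
  ultimately show ?thesis unfolding power_mult_distrib by (simp only:) (simp add: power2_eq_square)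
qed

section \<open>Limits for the first two claims\<close>

lemma bigo_power_bound:
  fixes k :: "nat \<Rightarrow> nat"
  assumes "(\<lambda>n. real n ^ j) \<in> O(\<lambda>n. real (k n))"
  obtains C where "0 < C" "\<forall>\<^sub>F n in at_top. real n ^ j \<le> C * real (k n)"
proof -
  obtain C where C: "0 < C" "\<forall>\<^sub>F n in at_top. norm (real n ^ j) \<le> C * norm (real (k n))"
    using assms by (auto elim: landau_o.bigE)
  show ?thesis by (rule that[OF C(1)]) (use C(2) in simp)
qed

lemma multi_fraction_tendsto:
  fixes k :: "nat \<Rightarrow> nat" and \<epsilon> :: real
  assumes big: "(\<lambda>n. real n ^ 3) \<in> O(\<lambda>n. real (k n))" and \<epsilon>: "0 < \<epsilon>"
  shows "((\<lambda>n. measure_pmf.prob (pmf_of_set (configs n (k n)))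
               {c. real (num_multi n c) / (2 * real n) > \<epsilon>}) \<longlongrightarrow> 0) at_top"
proof -
  obtain C where C: "0 < C" "\<forall>\<^sub>F n in at_top. real n ^ 3 \<le> C * real (k n)"
    using bigo_power_bound[OF big] by blast
  \<comment> \<open>With \<open>c = \<delta> * n\<close> and
    \<open>m \<le> \<delta> * n + 1\<close>, the threshold \<open>2 * c + 2 * m\<close> is at most
    \<open>\<epsilon> * n + 2\<close>, hence at most \<open>2 * \<epsilon> * n\<close> once
    \<open>\<epsilon> * n \<ge> 2\<close>.\<close>
  define \<delta> where "\<delta> = \<epsilon> / 4"
  have \<delta>: "0 < \<delta>" using \<epsilon> by (simp add: \<delta>_def)
  define m where "m n = nat \<lceil>\<delta> * real n\<rceil>" for n
  define u where "u n = 9/10 * sqrt (ln (real n) / real (k n))" for n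
  define v where "v n = 27/40 * sqrt (ln (real n) / real (k n))" for n
  define s where "s n = 3/8 * sqrt (ln (real n) * real (k n))" for n
  define \<eta> where "\<eta> n = 1 / sqrt (real n)" for n
  have m: "\<delta> * real n \<le> real (m n)" for n unfolding m_def by (rule real_nat_ceiling_ge)
  let ?p = "\<lambda>n. measure_pmf.prob (pmf_of_set (configs n (k n))) {c. real (num_multi n c) / (2 * real n) > \<epsilon>}"
  let ?B = "\<lambda>n :: nat. 2 * (real n ^ 2 * exp (- 2 * real n ^ 2 / C)) + (1/2) ^ n
    + 2 * (real n ^ 3 * (2 * sqrt C / sqrt (real n ^ 3) * exp (- 9/16 * ln (real n) * (1 - 2 / sqrt (real n)))) / (\<delta> * real n))"
  have "\<forall>\<^sub>F n in at_top. 4 ^ n * far_rate (k n) (\<eta> n) (s n) (u n) (v n) (m n) ^ m n \<le> (1/2) ^ n"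
    by (rule far_term_eventually_le[OF C(2,1) \<delta> m u_def v_def s_def \<eta>_def])
  moreover have "\<forall>\<^sub>F n :: nat in at_top. C * ln (real n) \<le> real n ^ 3"
    by real_asymp
  ultimately have "\<forall>\<^sub>F n in at_top. ?p n \<le> ?B n"
    using C(2) eventually_ge_at_top[of 16] eventually_ge_at_top[of "nat \<lceil>2 / \<epsilon>\<rceil>"]
  proof eventually_elim
    case (elim n)
    have n: "n \<ge> 2" using elim by simp
    have "0 < real n ^ 3" using n by simp
    then have "0 < C * real (k n)" using elim(3) by linarith
    then have k0: "0 < k n" using C(1) by (simp add: zero_less_mult_iff)
    \<comment> \<open>The requirement \<open>n \<ge> 16\<close> makes \<eta> at most
      \<open>1/4\<close>.\<close>
    have sqn: "4 \<le> sqrt (real n)" using elim(4) by (intro real_le_rsqrt) simp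
    have \<eta>: "0 \<le> \<eta> n" "\<eta> n \<le> 1/4" using frac_le[OF _ _ _ sqn, of 1 1] by (auto simp: \<eta>_def)
    have uv: "v n \<le> u n" using n by (simp add: u_def v_def mult_right_mono)
    have u2: "(u n)\<^sup>2 \<le> 2" unfolding u_def by (rule u_square_le[OF n elim(3) C(1) elim(2)])
    have m0: "0 < m n" using m[of n] \<delta> n by (metis mult_pos_pos not_gr_zero of_nat_0 of_nat_0_less_iff not_le less_le_trans zero_less_numeral)
    have s0: "0 \<le> s n" using n by (simp add: s_def)
    have c0: "0 < \<delta> * real n" using \<delta> n by simp
    have en: "2 \<le> \<epsilon> * real n"
    proof -
      have "2 / \<epsilon> \<le> real n" using elim(5) by linarith
      then show ?thesis using \<epsilon> by (simp add: field_simps)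
    qed
    have mle: "real (m n) \<le> \<delta> * real n + 1"
      unfolding m_def using c0 by linarith
    have "?p n \<le> measure_pmf.prob (pmf_of_set (configs n (k n))) {cfg. 2 * (\<delta> * real n) + 2 * real (m n) \<le> real (num_multi n cfg)}"
    proof (rule measure_pmf.finite_measure_mono)
      show "{c. real (num_multi n c) / (2 * real n) > \<epsilon>} \<subseteq> {cfg. 2 * (\<delta> * real n) + 2 * real (m n) \<le> real (num_multi n cfg)}"
      proof
        fix c assume "c \<in> {c. real (num_multi n c) / (2 * real n) > \<epsilon>}"
        then have "\<epsilon> * (2 * real n) < real (num_multi n c)" using n by (simp add: pos_less_divide_eq)
        moreover have "2 * (\<delta> * real n) + 2 * real (m n) \<le> \<epsilon> * (2 * real n)"
          using mle en by (simp add: \<delta>_def)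
        ultimately show "c \<in> {cfg. 2 * (\<delta> * real n) + 2 * real (m n) \<le> real (num_multi n cfg)}" by simp
      qed
    qed simp
    also have "\<dots> \<le> 2 * (real n ^ 2 * exp (- 2 * (\<eta> n)\<^sup>2 * real (k n))) + 4 ^ n * far_rate (k n) (\<eta> n) (s n) (u n) (v n) (m n) ^ m n
      + 2 * (real n ^ 3 * tie_rate (k n) (\<eta> n) (s n) / (\<delta> * real n))"
      by (rule prob_many_multi_le[OF k0 \<eta> uv u2 m0 s0 c0])
    also have "\<dots> \<le> ?B n"
    proof (rule add_mono[OF add_mono])
      show "2 * (real n ^ 2 * exp (- 2 * (\<eta> n)\<^sup>2 * real (k n))) \<le> 2 * (real n ^ 2 * exp (- 2 * real n ^ 2 / C))"
        unfolding \<eta>_def by (rule mult_left_mono[OF spread_term_le[OF n elim(3) C(1)]]) simp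
      show "2 * (real n ^ 3 * tie_rate (k n) (\<eta> n) (s n) / (\<delta> * real n)) \<le>
          2 * (real n ^ 3 * (2 * sqrt C / sqrt (real n ^ 3) * exp (- 9/16 * ln (real n) * (1 - 2 / sqrt (real n)))) / (\<delta> * real n))"
        unfolding \<eta>_def using c0
        by (intro mult_left_mono[OF divide_right_mono[OF mult_left_mono[OF tie_rate_le(1)[OF n elim(3) C(1) s_def]]]]) auto
    qed (rule elim(1))
    finally show ?case .
  qed
  moreover have "?B \<longlonglongrightarrow> 0"
  proof -
    have "(\<lambda>n :: nat. 2 * (real n ^ 2 * exp (- 2 * real n ^ 2 / C))) \<longlonglongrightarrow> 0"
      using C(1) by real_asymp
    moreover have "(\<lambda>n :: nat. (1/2 :: real) ^ n) \<longlonglongrightarrow> 0" by real_asymp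
    moreover have "(\<lambda>n :: nat. 2 * (real n ^ 3 * (2 * sqrt C / sqrt (real n ^ 3) * exp (- 9/16 * ln (real n) * (1 - 2 / sqrt (real n)))) / (\<delta> * real n))) \<longlonglongrightarrow> 0"
    proof -
      have "(\<lambda>n :: nat. real n ^ 3 / sqrt (real n ^ 3) * exp (- 9/16 * ln (real n) * (1 - 2 / sqrt (real n))) / real n) \<longlonglongrightarrow> 0"
        by real_asymp
      then have "(\<lambda>n :: nat. 4 * sqrt C / \<delta> * (real n ^ 3 / sqrt (real n ^ 3) * exp (- 9/16 * ln (real n) * (1 - 2 / sqrt (real n))) / real n)) \<longlonglongrightarrow> 4 * sqrt C / \<delta> * 0"
        by (intro tendsto_intros)
      then show ?thesis by (simp add: mult_ac)
    qed
    ultimately show ?thesis by (intro tendsto_add_zero)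
  qed
  ultimately show ?thesis
    by (intro tendsto_sandwich[of "\<lambda>_. 0" ?p at_top ?B 0]) auto
qed

text \<open>The last summand comes from ties between leftovers, with
  \<open>m \<le> 2 * \<delta> * n\<close> and \<open>sqrt k \<ge> n^3 / sqrt C\<close>. It is
  constant in \<open>n\<close> and becomes small only through \<delta>.\<close>

lemma not_unique_eventually_le:
  fixes k :: "nat \<Rightarrow> nat" and \<delta> :: real
  assumes C: "0 < C" "\<forall>\<^sub>F n in at_top. real n ^ 6 \<le> C * real (k n)" and \<delta>: "0 < \<delta>"
  shows "\<forall>\<^sub>F n in at_top. measure_pmf.prob (pmf_of_set (configs n (k n))) {c. \<not> unique_without_ties n c}
    \<le> (2 * (real n ^ 2 * exp (- 2 * real n ^ 2 / C)) + (1/2) ^ n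
      + 2 * (2 * sqrt C * exp (- 9/16 * ln (real n) * (1 - 2 / sqrt (real n))))) + 16 * \<delta>\<^sup>2 * sqrt C"
proof -
  have C3: "\<forall>\<^sub>F n in at_top. real n ^ 3 \<le> C * real (k n)"
    using C(2) eventually_ge_at_top[of 1]
  proof eventually_elim
    case (elim n)
    have "real n ^ 3 \<le> real n ^ 6" using elim(2) by (intro power_increasing) auto
    then show ?case using elim(1) by linarith
  qed
  define m where "m n = nat \<lceil>\<delta> * real n\<rceil>" for n
  define u where "u n = 9/10 * sqrt (ln (real n) / real (k n))" for n
  define v where "v n = 27/40 * sqrt (ln (real n) / real (k n))" for n
  define s where "s n = 3/8 * sqrt (ln (real n) * real (k n))" for n
  define \<eta> where "\<eta> n = 1 / sqrt (real n)" for n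
  have m: "\<delta> * real n \<le> real (m n)" for n unfolding m_def by (rule real_nat_ceiling_ge)
  let ?p = "\<lambda>n. measure_pmf.prob (pmf_of_set (configs n (k n))) {c. \<not> unique_without_ties n c}"
  have "\<forall>\<^sub>F n in at_top. 4 ^ n * far_rate (k n) (\<eta> n) (s n) (u n) (v n) (m n) ^ m n \<le> (1/2) ^ n"
    by (rule far_term_eventually_le[OF C3 C(1) \<delta> m u_def v_def s_def \<eta>_def])
  moreover have "\<forall>\<^sub>F n :: nat in at_top. C * ln (real n) \<le> real n ^ 3"
    by real_asymp
  ultimately show ?thesis
    using C3 C(2) eventually_ge_at_top[of 16] eventually_ge_at_top[of "nat \<lceil>1 / \<delta>\<rceil>"]
  proof eventually_elim
    case (elim n)
    have n: "n \<ge> 2" using elim by simp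
    have "0 < real n ^ 3" using n by simp
    then have "0 < C * real (k n)" using elim(3) by linarith
    then have k0: "0 < k n" using C(1) by (simp add: zero_less_mult_iff)
    have sqn: "4 \<le> sqrt (real n)" using elim(5) by (intro real_le_rsqrt) simp
    have \<eta>: "0 \<le> \<eta> n" "\<eta> n \<le> 1/4" using frac_le[OF _ _ _ sqn, of 1 1] by (auto simp: \<eta>_def)
    have uv: "v n \<le> u n" using n by (simp add: u_def v_def mult_right_mono)
    have u2: "(u n)\<^sup>2 \<le> 2" unfolding u_def by (rule u_square_le[OF n elim(3) C(1) elim(2)])
    have c0: "0 < \<delta> * real n" using \<delta> n by simp
    then have m0: "0 < m n" using m[of n] by linarith
    have s0: "0 \<le> s n" using n by (simp add: s_def)
    have dn: "1 \<le> \<delta> * real n"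
    proof -
      have "1 / \<delta> \<le> real n" using elim(6) by linarith
      then show ?thesis using \<delta> by (simp add: field_simps)
    qed
    have "real (m n) \<le> \<delta> * real n + 1"
      unfolding m_def using c0 by linarith
    then have mle: "real (m n) \<le> 2 * \<delta> * real n" using dn by linarith
    have sq6: "sqrt (real n ^ 6) = real n ^ 3"
      using real_sqrt_abs[of "real n ^ 3"] by (simp add: power_mult[symmetric])
    have "?p n \<le> 2 * (real n ^ 2 * exp (- 2 * (\<eta> n)\<^sup>2 * real (k n))) + 4 ^ n * far_rate (k n) (\<eta> n) (s n) (u n) (v n) (m n) ^ m n
      + 2 * (real n ^ 3 * tie_rate (k n) (\<eta> n) (s n)) + 2 * (real n * (real (m n) ^ 2 * (2 / sqrt (real (k n)))))"
      by (rule prob_not_unique_le[OF k0 \<eta> uv u2 m0 s0])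
    also have "\<dots> \<le> (2 * (real n ^ 2 * exp (- 2 * real n ^ 2 / C)) + (1/2) ^ n
      + 2 * (2 * sqrt C * exp (- 9/16 * ln (real n) * (1 - 2 / sqrt (real n))))) + 16 * \<delta>\<^sup>2 * sqrt C"
    proof (rule add_mono[OF add_mono[OF add_mono]])
      show "2 * (real n ^ 2 * exp (- 2 * (\<eta> n)\<^sup>2 * real (k n))) \<le> 2 * (real n ^ 2 * exp (- 2 * real n ^ 2 / C))"
        unfolding \<eta>_def by (rule mult_left_mono[OF spread_term_le[OF n elim(3) C(1)]]) simp
      have "real n ^ 3 * tie_rate (k n) (\<eta> n) (s n) \<le>
          real n ^ 3 * (2 * sqrt C / sqrt (real n ^ 6) * exp (- 9/16 * ln (real n) * (1 - 2 / sqrt (real n))))"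
        unfolding \<eta>_def by (rule mult_left_mono[OF tie_rate_le(1)[OF n elim(4) C(1) s_def]]) simp
      also have "\<dots> = 2 * sqrt C * exp (- 9/16 * ln (real n) * (1 - 2 / sqrt (real n)))"
        using n unfolding sq6 by simp
      finally show "2 * (real n ^ 3 * tie_rate (k n) (\<eta> n) (s n)) \<le>
          2 * (2 * sqrt C * exp (- 9/16 * ln (real n) * (1 - 2 / sqrt (real n))))"
        by (rule mult_left_mono) simp
      have "real (m n) ^ 2 * (2 / sqrt (real (k n))) \<le> (2 * \<delta> * real n) ^ 2 * (2 * sqrt C / real n ^ 3)"
        using tie_rate_le(2)[OF n elim(4) C(1) s_def] unfolding sq6
        by (intro mult_mono power_mono mle) auto
      then have "real n * (real (m n) ^ 2 * (2 / sqrt (real (k n)))) \<le> real n * ((2 * \<delta> * real n) ^ 2 * (2 * sqrt C / real n ^ 3))"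
        by (rule mult_left_mono) simp
      also have "\<dots> = 8 * \<delta>\<^sup>2 * sqrt C"
        using n by (simp add: power2_eq_square power3_eq_cube)
      finally show "2 * (real n * (real (m n) ^ 2 * (2 / sqrt (real (k n))))) \<le> 16 * \<delta>\<^sup>2 * sqrt C" by linarith
    qed (rule elim(1))
    finally show ?case .
  qed
qed

lemma unique_tendsto:
  fixes k :: "nat \<Rightarrow> nat"
  assumes big: "(\<lambda>n. real n ^ 6) \<in> O(\<lambda>n. real (k n))"
  shows "((\<lambda>n. measure_pmf.prob (pmf_of_set (configs n (k n))) {c. unique_without_ties n c}) \<longlongrightarrow> 1) at_top"
proof -
  obtain C where C: "0 < C" "\<forall>\<^sub>F n in at_top. real n ^ 6 \<le> C * real (k n)"
    using bigo_power_bound[OF big] by blast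
  let ?p = "\<lambda>n. measure_pmf.prob (pmf_of_set (configs n (k n))) {c. \<not> unique_without_ties n c}"
  let ?B = "\<lambda>n :: nat. 2 * (real n ^ 2 * exp (- 2 * real n ^ 2 / C)) + (1/2) ^ n
      + 2 * (2 * sqrt C * exp (- 9/16 * ln (real n) * (1 - 2 / sqrt (real n))))"
  have B: "?B \<longlonglongrightarrow> 0"
  proof -
    have "(\<lambda>n :: nat. 2 * (real n ^ 2 * exp (- 2 * real n ^ 2 / C))) \<longlonglongrightarrow> 0"
      using C(1) by real_asymp
    moreover have "(\<lambda>n :: nat. (1/2 :: real) ^ n) \<longlonglongrightarrow> 0" by real_asymp
    moreover have "(\<lambda>n :: nat. 2 * (2 * sqrt C * exp (- 9/16 * ln (real n) * (1 - 2 / sqrt (real n))))) \<longlonglongrightarrow> 0"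
    proof -
      have "(\<lambda>n :: nat. exp (- 9/16 * ln (real n) * (1 - 2 / sqrt (real n)))) \<longlonglongrightarrow> 0" by real_asymp
      then have "(\<lambda>n :: nat. 2 * (2 * sqrt C * exp (- 9/16 * ln (real n) * (1 - 2 / sqrt (real n))))) \<longlonglongrightarrow> 2 * (2 * sqrt C * 0)"
        by (intro tendsto_intros)
      then show ?thesis by simp
    qed
    ultimately show ?thesis by (intro tendsto_add_zero)
  qed
  have "?p \<longlonglongrightarrow> 0"
  proof (rule order_tendstoI)
    fix a :: real assume "a < 0"
    then have "a < ?p n" for n by (rule less_le_trans) simp
    then show "\<forall>\<^sub>F n in at_top. a < ?p n" by simp
  next
    fix a :: real assume a: "0 < a"
    \<comment> \<open>Makes the part that does not vanish with \<open>n\<close> equal to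
      \<open>a / 2\<close>.\<close>
    define \<delta> where "\<delta> = sqrt (a / (32 * sqrt C))"
    have \<delta>: "0 < \<delta>" using a C(1) by (simp add: \<delta>_def)
    have d: "16 * \<delta>\<^sup>2 * sqrt C = a / 2" using a C(1) by (simp add: \<delta>_def)
    have "\<forall>\<^sub>F n in at_top. ?B n < a / 2" using B by (rule order_tendstoD) (use a in simp)
    then show "\<forall>\<^sub>F n in at_top. ?p n < a"
      using not_unique_eventually_le[OF C \<delta>]
    proof eventually_elim
      case (elim n)
      then show ?case unfolding d by linarith
    qed
  qed
  then have "(\<lambda>n. 1 - ?p n) \<longlonglongrightarrow> 1 - 0" by (intro tendsto_intros)
  moreover have "measure_pmf.prob (pmf_of_set (configs n (k n))) {c. unique_without_ties n c} = 1 - ?p n" for n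
    using measure_pmf.prob_compl[of "{c. unique_without_ties n c}" "pmf_of_set (configs n (k n))"]
    by (simp add: Collect_neg_eq Compl_eq_Diff_UNIV)
  ultimately show ?thesis by simp
qed

theorem theorem3p3:
  fixes k :: "nat \<Rightarrow> nat"
  shows
   "((\<lambda>n. real n ^ 3) \<in> O(\<lambda>n. real (k n)) \<longrightarrow>
      (\<forall>\<epsilon>::real. \<epsilon> > 0 \<longrightarrow>
        ((\<lambda>n. measure_pmf.prob (pmf_of_set (configs n (k n)))
               {c. real (num_multi n c) / (2 * real n) > \<epsilon>}) \<longlongrightarrow> 0) at_top))
  \<and> ((\<lambda>n. real n ^ 6) \<in> O(\<lambda>n. real (k n)) \<longrightarrow>
      ((\<lambda>n. measure_pmf.prob (pmf_of_set (configs n (k n)))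
               {c. unique_without_ties n c}) \<longlongrightarrow> 1) at_top)
  \<and> (\<forall>n (\<beta>::real). n \<ge> 1 \<and> \<beta> > 1 \<longrightarrow>
      measure_pmf.prob (pmf_of_set (configs n (k n) \<times> (UNIV \<times> {..<n})))
        {(c, p). real (match_dist n c p) < real (k n) / 2 - sqrt (\<beta> * real (k n) * log 2 (real n))}
      \<le> real n powr (1 - \<beta>))"
  by (intro conjI allI impI multi_fraction_tendsto unique_tendsto match_dist_tail; simp)

end
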